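(* Let $S\subset\mathbb{H}^3$ be a $C^3$ smooth immersed oriented surface in hyperbolic 3-space and let $\Sigma\subset\mathbb{L}(\mathbb{H}^3)$ be the Lagrangian surface formed by the oriented geodesics normal to $S$. The surface $\Sigma$ is maximal if and only if $S$ is an equidistant tube around a geodesic in $\mathbb{H}^3$. In terms of holomorphic coordinates $(\mu_1,\mu_2)$ on $\mathbb{L}(\mathbb{H}^3)$, the (maximal) surface $\Sigma$ is given by $$\bar{\mu}_2=\frac{1+\lambda_1\mu_1}{\lambda_2+\mu_1},$$ where $\lambda_1,\lambda_2\in\mathbb{C}$ with $\lambda_1\lambda_2\neq 1$.
   Context: $\mathbb{L}(\mathbb{H}^3)$ denotes the space of oriented geodesics of hyperbolic 3-space $\mathbb{H}^3$. An oriented geodesic is determined by its beginning and end points on the sphere at infinity, so $\mathbb{L}(\mathbb{H}^3)$ is identified with $S^2\times S^2$ minus the diagonal. Holomorphic coordinates: in the upper half-space model $\{(z,t): z\in\mathbb{C},\,t>0\}$ with metric $(|dz|^2+dt^2)/t^2$, the oriented geodesic with coordinates $(\mu_1,\mu_2)$ is $r\mapsto (z,t)$ with $$z=\frac{1-\mu_1\bar{\mu}_2}{2\bar{\mu}_2}+\frac{1+\mu_1\bar{\mu}_2}{2\bar{\mu}_2}\tanh r,\qquad t=\frac{|1+\bar{\mu}_1\mu_2|}{2|\mu_2|\cosh r},$$ so it begins at $z=-\mu_1$ and ends at $z=1/\bar\mu_2$ on the boundary. These coordinates identify $\mathbb{L}(\mathbb{H}^3)$ with $\mathbb{P}^1\times\mathbb{P}^1-\overline{\Delta}$,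 where $\overline{\Delta}=\{\mu_1\bar\mu_2=-1\}$. $\mathbb{L}(\mathbb{H}^3)$ carries the corresponding complex structure $\mathbb{J}$, the symplectic form $$\Omega=-\left[\frac{d\mu_1\wedge d\bar\mu_2}{(1+\mu_1\bar\mu_2)^2}+\frac{d\bar\mu_1\wedge d\mu_2}{(1+\bar\mu_1\mu_2)^2}\right],$$ and the neutral (signature $++--$) Kähler metric $$\mathbb{G}=-i\left[\frac{d\mu_1\, d\bar\mu_2}{(1+\mu_1\bar\mu_2)^2}-\frac{d\bar\mu_1\, d\mu_2}{(1+\bar\mu_1\mu_2)^2}\right]$$ (symmetric products). A surface in $\mathbb{L}(\mathbb{H}^3)$ is Lagrangian if $\Omega$ pulls back to zero on it. The surface formed by the oriented normal geodesics of an oriented surface in $\mathbb{H}^3$ is always Lagrangian. A surface $\Sigma\subset\mathbb{L}(\mathbb{H}^3)$ is maximal if the metric induced on it by $\mathbb{G}$ is non-degenerate and it is stationary for the area functional of the induced metric (equivalently, its mean curvature vector vanishes). Surfaces are taken to be connected. An equidistant tube around a geodesic is the set of points at a fixed positive hyperbolic distance from that geodesic; since the statement is local, "$S$ is an equidistant tube" means that $S$ is an open part of such a tube, and the coordinate expression for $\Sigma$ is a local one.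
   Formalization: The coordinate formula misses tubes around geodesics with boundary end points w and −w (e.g. from −1 to 1, where μ̄₂ = −μ₁); the formal statement adds the limiting form μ̄₂ = cμ₁ with c ≠ 0 as a second alternative. *)

theory Defs
  imports "HOL-Analysis.Analysis"
begin

section \<open>Maps of class C^k\<close>

text \<open>Meant for open \<^term>\<open>S\<close>.\<close>

fun C_k_on :: "nat \<Rightarrow> ('a::euclidean_space \<Rightarrow> 'b::euclidean_space) \<Rightarrow> 'a set \<Rightarrow> bool" where
  "C_k_on 0 f S \<longleftrightarrow> continuous_on S f"
| "C_k_on (Suc k) f S \<longleftrightarrow> f differentiable_on S \<and>
     (\<forall>v. C_k_on k (\<lambda>x. frechet_derivative f (at x) v) S)"

section \<open>Mean curvature of a parametrised surface in a pseudo-Riemannian manifold\<close>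

text \<open>A pseudo-Riemannian metric on an open subset of a Euclidean space is a function
  \<^term>\<open>g\<close> assigning to each point a non-degenerate symmetric bilinear form.
  The Levi-Civita connection is \<open>\<nabla>\<^sub>u v = D\<^sub>u v + christoffel g x u v\<close>, with the Christoffel
  symbol determined by the Koszul formula for constant vector fields.\<close>

definition christoffel ::
  "('a::euclidean_space \<Rightarrow> 'a \<Rightarrow> 'a \<Rightarrow> real) \<Rightarrow> 'a \<Rightarrow> 'a \<Rightarrow> 'a \<Rightarrow> 'a" where
  "christoffel g x u v = (THE w. \<forall>y. g x w y =
     (frechet_derivative (\<lambda>x'. g x' v y) (at x) u
      + frechet_derivative (\<lambda>x'. g x' u y) (at x) v
      - frechet_derivative (\<lambda>x'. g x' u v) (at x) y) / 2)"

type_synonym R2 = "real \<times> real"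

definition induced_metric ::
  "('a::euclidean_space \<Rightarrow> 'a \<Rightarrow> 'a \<Rightarrow> real) \<Rightarrow> (R2 \<Rightarrow> 'a) \<Rightarrow> R2 \<Rightarrow> R2 \<Rightarrow> R2 \<Rightarrow> real" where
  "induced_metric g F p v w =
     g (F p) (frechet_derivative F (at p) v) (frechet_derivative F (at p) w)"

definition induced_det ::
  "('a::euclidean_space \<Rightarrow> 'a \<Rightarrow> 'a \<Rightarrow> real) \<Rightarrow> (R2 \<Rightarrow> 'a) \<Rightarrow> R2 \<Rightarrow> real" where
  "induced_det g F p =
     induced_metric g F p (1,0) (1,0) * induced_metric g F p (0,1) (0,1)
     - (induced_metric g F p (1,0) (0,1))\<^sup>2"

text \<open>The component of \<^term>\<open>w\<close> that is \<^term>\<open>g\<close>-orthogonal to the tangent plane at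
  \<^term>\<open>p\<close>; well defined where the induced metric is non-degenerate.\<close>

definition normal_part ::
  "('a::euclidean_space \<Rightarrow> 'a \<Rightarrow> 'a \<Rightarrow> real) \<Rightarrow> (R2 \<Rightarrow> 'a) \<Rightarrow> R2 \<Rightarrow> 'a \<Rightarrow> 'a" where
  "normal_part g F p w = (THE n.
     w - n \<in> range (frechet_derivative F (at p)) \<and>
     (\<forall>v. g (F p) n (frechet_derivative F (at p) v) = 0))"

definition second_fundamental_form ::
  "('a::euclidean_space \<Rightarrow> 'a \<Rightarrow> 'a \<Rightarrow> real) \<Rightarrow> (R2 \<Rightarrow> 'a) \<Rightarrow> R2 \<Rightarrow> R2 \<Rightarrow> R2 \<Rightarrow> 'a" where
  "second_fundamental_form g F p v w = normal_part g F p
     (frechet_derivative (\<lambda>q. frechet_derivative F (at q) w) (at p) v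
      + christoffel g (F p) (frechet_derivative F (at p) v) (frechet_derivative F (at p) w))"

text \<open>Half the trace of the second fundamental form with respect to the induced metric,
  the inverse of the 2-by-2 Gram matrix being written out.\<close>

definition mean_curvature_vector ::
  "('a::euclidean_space \<Rightarrow> 'a \<Rightarrow> 'a \<Rightarrow> real) \<Rightarrow> (R2 \<Rightarrow> 'a) \<Rightarrow> R2 \<Rightarrow> 'a" where
  "mean_curvature_vector g F p =
     (let I = induced_metric g F p; II = second_fundamental_form g F p; e1 = (1,0); e2 = (0,1) in
      (1 / (2 * induced_det g F p)) *\<^sub>R
        (I e2 e2 *\<^sub>R II e1 e1 - I e1 e2 *\<^sub>R II e1 e2 - I e2 e1 *\<^sub>R II e2 e1
         + I e1 e1 *\<^sub>R II e2 e2))"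

section \<open>Hyperbolic space and its oriented geodesics\<close>

text \<open>Upper half-space model: the points \<open>(z, t)\<close> with \<open>t > 0\<close>.\<close>

type_synonym half_space = "complex \<times> real"

definition H3 :: "half_space set" where
  "H3 = {x. snd x > 0}"

definition hyp_norm :: "half_space \<Rightarrow> half_space \<Rightarrow> real" where
  "hyp_norm x v = norm v / snd x"

definition hyp_dist :: "half_space \<Rightarrow> half_space \<Rightarrow> real" where
  "hyp_dist x y = arcosh (1 + (dist x y)\<^sup>2 / (2 * snd x * snd y))"

text \<open>The coordinates of an oriented geodesic lie in the complement of
  \<open>\<mu>\<^sub>1 cnj \<mu>\<^sub>2 = -1\<close> in \<open>P\<^sup>1 \<times> P\<^sup>1\<close>. Two affine charts cover it: \<open>(\<mu>\<^sub>1, \<mu>\<^sub>2)\<close>, and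
  \<open>(\<nu>\<^sub>1, \<nu>\<^sub>2) = (1/\<mu>\<^sub>1, 1/\<mu>\<^sub>2)\<close>. Indeed if \<open>\<mu>\<^sub>1 = \<infinity>\<close> then \<open>\<mu>\<^sub>2 \<noteq> 0\<close>, and if \<open>\<mu>\<^sub>2 = \<infinity>\<close> then
  \<open>\<mu>\<^sub>1 \<noteq> 0\<close>. The equation of the excluded set has the same form in both charts.\<close>

type_synonym coords = "complex \<times> complex"

definition coord_domain :: "coords set" where
  "coord_domain = {\<mu>. 1 + fst \<mu> * cnj (snd \<mu>) \<noteq> 0}"

text \<open>Unit-speed geodesic from \<open>-\<mu>\<^sub>1\<close> to \<open>1 / cnj \<mu>\<^sub>2\<close>, vertical if \<open>\<mu>\<^sub>2 = 0\<close>.\<close>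

definition geodesic :: "coords \<Rightarrow> real \<Rightarrow> half_space" where
  "geodesic \<mu> r = (let \<mu>1 = fst \<mu>; \<mu>2 = snd \<mu> in
     if \<mu>2 = 0 then (- \<mu>1, exp r)
     else ((1 - \<mu>1 * cnj \<mu>2) / (2 * cnj \<mu>2) + (1 + \<mu>1 * cnj \<mu>2) / (2 * cnj \<mu>2) * of_real (tanh r),
           cmod (1 + cnj \<mu>1 * \<mu>2) / (2 * cmod \<mu>2 * cosh r)))"

text \<open>The same in the second chart: from \<open>-1/\<nu>\<^sub>1\<close> to \<open>cnj \<nu>\<^sub>2\<close>, vertical downwards if \<open>\<nu>\<^sub>1 = 0\<close>.\<close>

definition geodesic' :: "coords \<Rightarrow> real \<Rightarrow> half_space" where
  "geodesic' \<nu> r = (let \<nu>1 = fst \<nu>; \<nu>2 = snd \<nu> in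
     if \<nu>1 = 0 then (cnj \<nu>2, exp (- r))
     else ((\<nu>1 * cnj \<nu>2 - 1) / (2 * \<nu>1) + (1 + \<nu>1 * cnj \<nu>2) / (2 * \<nu>1) * of_real (tanh r),
           cmod (1 + cnj \<nu>1 * \<nu>2) / (2 * cmod \<nu>1 * cosh r)))"

lemma geodesic'_eq_geodesic:
  assumes "\<nu>1 \<noteq> 0" "\<nu>2 \<noteq> 0"
  shows "geodesic' (\<nu>1, \<nu>2) = geodesic (1 / \<nu>1, 1 / \<nu>2)"
proof
  fix r
  have "cmod (1 + cnj (1 / \<nu>1) * (1 / \<nu>2)) = cmod ((1 + cnj \<nu>1 * \<nu>2) / (cnj \<nu>1 * \<nu>2))"
    using assms by (simp add: field_simps)
  also have "\<dots> = cmod (1 + cnj \<nu>1 * \<nu>2) / (cmod \<nu>1 * cmod \<nu>2)"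
    by (simp add: norm_divide norm_mult)
  finally show "geodesic' (\<nu>1, \<nu>2) r = geodesic (1 / \<nu>1, 1 / \<nu>2) r"
    using assms by (simp add: geodesic_def geodesic'_def norm_divide field_simps)
qed

text \<open>An oriented geodesic, as a point of the space of oriented geodesics, is a unit-speed
  geodesic up to shifts of the parameter. It is represented by its set of pairs
  (point, velocity).\<close>

type_synonym oriented_geodesic = "(half_space \<times> half_space) set"

definition orbit :: "(real \<Rightarrow> half_space) \<Rightarrow> oriented_geodesic" where
  "orbit \<gamma> = range (\<lambda>r. (\<gamma> r, vector_derivative \<gamma> (at r)))"

definition chart :: "coords \<Rightarrow> oriented_geodesic" where
  "chart \<mu> = orbit (geodesic \<mu>)"

definition chart' :: "coords \<Rightarrow> oriented_geodesic" where
  "chart' \<nu> = orbit (geodesic' \<nu>)"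

definition LH3 :: "oriented_geodesic set" where
  "LH3 = chart ` coord_domain \<union> chart' ` coord_domain"

text \<open>The neutral Kaehler metric. The expression in brackets is purely imaginary, so taking
  the real part only changes the type. The substitution \<open>\<mu>\<^sub>i = 1/\<nu>\<^sub>i\<close> does not change the
  expression: this is the metric in both charts.\<close>

definition neutral_metric :: "coords \<Rightarrow> coords \<Rightarrow> coords \<Rightarrow> real" where
  "neutral_metric \<mu> u v = Re (- \<i> *
     ( (fst u * cnj (snd v) + fst v * cnj (snd u)) / 2 / (1 + fst \<mu> * cnj (snd \<mu>))\<^sup>2
     - (cnj (fst u) * snd v + cnj (fst v) * snd u) / 2 / (1 + cnj (fst \<mu>) * snd \<mu>)\<^sup>2))"

definition equidistant_tube :: "oriented_geodesic \<Rightarrow> real \<Rightarrow> half_space set" where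
  "equidistant_tube l \<rho> = {x \<in> H3. (INF y \<in> fst ` l. hyp_dist x y) = \<rho>}"

section \<open>Immersed oriented surfaces and their normal geodesics\<close>

text \<open>An immersed surface is a map \<^term>\<open>f\<close> from a connected topological surface
  \<^term>\<open>M\<close>. The immersion determines the C^3 structure of \<^term>\<open>M\<close>: its local
  parametrisations \<open>\<phi> : V \<rightarrow> M\<close> are the homeomorphisms from open sets of the plane to open sets of
  \<^term>\<open>M\<close> for which \<open>f \<circ> \<phi>\<close> is a C^3 immersion.\<close>

definition local_params :: "'m::topological_space set \<Rightarrow> ('m \<Rightarrow> half_space) \<Rightarrow> (R2 set \<times> (R2 \<Rightarrow> 'm)) set"
  where
  "local_params M f = {(V, \<phi>). open V \<and> openin (top_of_set M) (\<phi> ` V) \<and>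
     (\<exists>\<psi>. homeomorphism V (\<phi> ` V) \<phi> \<psi>) \<and>
     C_k_on 3 (f \<circ> \<phi>) V \<and> (\<forall>p\<in>V. inj (frechet_derivative (f \<circ> \<phi>) (at p)))}"

text \<open>The orientation is given by a continuous hyperbolic unit normal field \<^term>\<open>N\<close>;
  orthogonality may be tested with the Euclidean inner product as the metric is conformal to it.\<close>

definition oriented_immersed_surface ::
  "'m::topological_space set \<Rightarrow> ('m \<Rightarrow> half_space) \<Rightarrow> ('m \<Rightarrow> half_space) \<Rightarrow> bool" where
  "oriented_immersed_surface M f N \<longleftrightarrow>
     M \<noteq> {} \<and> connected M \<and> f ` M \<subseteq> H3 \<and>
     (\<forall>m\<in>M. \<exists>(V, \<phi>)\<in>local_params M f. m \<in> \<phi> ` V) \<and>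
     continuous_on M N \<and> (\<forall>m\<in>M. hyp_norm (f m) (N m) = 1) \<and>
     (\<forall>(V, \<phi>)\<in>local_params M f. \<forall>p\<in>V. \<forall>v. N (\<phi> p) \<bullet> frechet_derivative (f \<circ> \<phi>) (at p) v = 0)"

definition normal_geodesic ::
  "('m \<Rightarrow> half_space) \<Rightarrow> ('m \<Rightarrow> half_space) \<Rightarrow> 'm \<Rightarrow> oriented_geodesic" where
  "normal_geodesic f N m = (THE l. l \<in> LH3 \<and> (f m, N m) \<in> l)"

section \<open>Maximal surfaces in the space of oriented geodesics\<close>

text \<open>\<^term>\<open>P\<close> is the set of local parametrisations of the surface \<^term>\<open>M\<close>, and
  \<^term>\<open>\<sigma>\<close> maps it to the space of oriented geodesics. Non-degeneracy and vanishing of the mean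
  curvature vector do not depend on the parametrisation or on the chart.\<close>

definition maximal_surface ::
  "'m set \<Rightarrow> (R2 set \<times> (R2 \<Rightarrow> 'm)) set \<Rightarrow> ('m \<Rightarrow> oriented_geodesic) \<Rightarrow> bool" where
  "maximal_surface M P \<sigma> \<longleftrightarrow>
     (\<forall>m\<in>M. \<exists>(V, \<phi>)\<in>P. m \<in> \<phi> ` V \<and>
        (\<exists>c\<in>{chart, chart'}. \<exists>F. C_k_on 2 F V \<and>
           (\<forall>p\<in>V. F p \<in> coord_domain \<and> c (F p) = \<sigma> (\<phi> p) \<and>
              induced_det neutral_metric F p \<noteq> 0 \<and>
              mean_curvature_vector neutral_metric F p = 0)))"

definition graph_family :: "complex \<Rightarrow> complex \<Rightarrow> coords set" where
  "graph_family l1 l2 = {\<mu> \<in> coord_domain. l2 + fst \<mu> \<noteq> 0 \<and>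
     cnj (snd \<mu>) = (1 + l1 * fst \<mu>) / (l2 + fst \<mu>)}"

text \<open>The limits of this family as \<open>l1\<close> and \<open>l2\<close> tend to infinity with \<open>l1 / l2\<close> tending to
  \<open>c \<noteq> 0\<close>. They belong to the geodesics orthogonal to an axis with end points
  \<open>\<plusminus>w\<close>, \<open>w\<^sup>2 = -1/c\<close>, which is not an axis for any finite \<open>l1\<close>, \<open>l2\<close>.\<close>

definition graph_limit :: "complex \<Rightarrow> coords set" where
  "graph_limit c = {\<mu> \<in> coord_domain. cnj (snd \<mu>) = c * fst \<mu>}"

definition coord_image :: "oriented_geodesic set \<Rightarrow> coords set" where
  "coord_image \<Sigma> = {\<mu> \<in> coord_domain. chart \<mu> \<in> \<Sigma>}"

end

theory Submission
  imports Defs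
begin

text \<open>Write \<open>A = \<mu>\<^sub>1\<close>, \<open>B = cnj \<mu>\<^sub>2\<close> and \<open>D = 1 + A B\<close>. In these complex coordinates the neutral metric is
  the imaginary part of the holomorphic metric \<open>2 dA dB / D\<^sup>2\<close>. Its complex geodesics are the graphs of
  Moebius maps \<open>p (A B - 1) + m B + n A = 0\<close> with \<open>p\<^sup>2 + m n \<noteq> 0\<close>; they are totally geodesic, hence maximal
  (\<open>graph_imp_maximal\<close>). In terms of end points the equation says that the two ends of the geodesic
  \<open>(A, B)\<close> are harmonic with respect to the roots of \<open>n z\<^sup>2 + 2 p z - m\<close>, that is, that the geodesic meets
  orthogonally the geodesic with these roots as ends: the axis.

  A maximal normal congruence is of this form. Let \<open>R\<close> be the exponential of the position of the point of the
  surface on its normal geodesic. The matrix with columns proportional to \<open>(1, B)\<close> and \<open>(-A, 1)\<close> is a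
  moving frame of the surface with values in \<open>SL\<^sub>2(\<complex>)\<close>. The off-diagonal entries of its Maurer-Cartan form
  are \<open>\<alpha> = - dA / (R D)\<close> and \<open>\<beta> = R dB / D\<close>, and its diagonal entry is the connection of the surface;
  orthogonality to the surface means \<open>d log R = Re \<kappa>\<close> with \<open>\<kappa> = (B dA - A dB) / D\<close>. The form
  \<open>\<theta> = \<alpha> + cnj \<beta>\<close> is the coframe of the surface, and \<open>\<alpha> - cnj \<beta> = H \<theta> + Q cnj \<theta>\<close> is its shape operator,
  where \<open>H\<close> is real and \<open>Q \<noteq> 0\<close>: the null directions of the induced metric are the principal directions.
  The vanishing of the mean curvature vector, together with the Codazzi equation, says that the principal
  directions are parallel, which in the present notation is the reality of \<open>d log Q - 2 \<kappa>\<close>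
  (\<open>nQ_real\<close>). Hence \<open>Y\<^sub>0 = R\<^sup>2 Q / |Q|\<close> satisfies \<open>dY\<^sub>0 = 2 \<kappa> Y\<^sub>0\<close>, so \<open>\<kappa>\<close> is closed. As
  \<open>d\<kappa> = - 2 dA \<and> dB / D\<^sup>2\<close>, the congruence is a complex curve (\<open>complex_curve\<close>); this is the Gauss
  equation of a flat surface. Now \<open>Y = - dA / dB\<close> is a real constant times \<open>Y\<^sub>0\<close>, and \<open>dA = - Y dB\<close>,
  \<open>dY = 2 \<kappa> Y\<close> imply that the coefficients \<open>(A + Y B, Y - A\<^sup>2, 1 - Y B\<^sup>2)\<close> are constant up to a common
  factor (\<open>on_graph\<close>). They are the coefficients \<open>(p, m, n)\<close> of the axis. The axis is determined by any open
  part of the congruence (\<open>local_axis_unique\<close>), so it is the same along a connected surface.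

  It remains to relate congruences orthogonal to an axis with tubes. Off the axis the geodesics orthogonal to
  it are the integral curves of the gradient of the distance from it, so the surface has normals meeting the
  axis orthogonally if and only if this distance is constant along it (\<open>axis_form_deriv_zero\<close>). A surface
  inside a tube is open in the tube because the distance is strictly monotone transversally to the surface
  (\<open>level_set_open\<close>).\<close>

section \<open>Maps of class \<open>C\<^sup>k\<close>\<close>

lemma C_k_on_cong:
  assumes "open S" "C_k_on k f S" "\<And>x. x \<in> S \<Longrightarrow> f x = g x"
  shows "C_k_on k g S"
  using assms(2,3)
proof (induction k arbitrary: f g)
  case 0
  then show ?case by (simp cong: continuous_on_cong)
next
  case (Suc k)
  have fr: "frechet_derivative f (at x) = frechet_derivative g (at x)" if "x \<in> S" for x
    using Suc.prems that \<open>open S\<close>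
    by (intro frechet_derivative_transform_within_open[of _ _ S])
       (auto simp: differentiable_on_eq_differentiable_at)
  have "g differentiable_on S"
    unfolding differentiable_on_eq_differentiable_at[OF \<open>open S\<close>] differentiable_def
  proof
    fix x assume x: "x \<in> S"
    then obtain D where "(f has_derivative D) (at x)"
      using Suc.prems(1) \<open>open S\<close> by (auto simp: differentiable_on_eq_differentiable_at differentiable_def)
    from has_derivative_transform_within_open[OF this \<open>open S\<close> x Suc.prems(2)]
    show "\<exists>D. (g has_derivative D) (at x)" by blast
  qed
  moreover have "C_k_on k (\<lambda>x. frechet_derivative g (at x) v) S" for v
    by (rule Suc.IH[of "\<lambda>x. frechet_derivative f (at x) v"]) (use Suc.prems fr in auto)
  ultimately show ?case by simp
qed

lemma C_k_on_subset: "C_k_on k f S \<Longrightarrow> T \<subseteq> S \<Longrightarrow> C_k_on k f T"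
  by (induction k arbitrary: f) (auto intro: continuous_on_subset differentiable_on_subset)

lemma C_k_on_Suc_has_derivative:
  "C_k_on (Suc k) f S \<Longrightarrow> open S \<Longrightarrow> x \<in> S \<Longrightarrow> (f has_derivative frechet_derivative f (at x)) (at x)"
  by (auto simp: differentiable_on_eq_differentiable_at frechet_derivative_works)

lemma C_k_on_SucI:
  assumes "open S" "\<And>x. x \<in> S \<Longrightarrow> (f has_derivative f' x) (at x)"
    and "\<And>v. C_k_on k (\<lambda>x. f' x v) S"
  shows "C_k_on (Suc k) f S"
proof -
  have "f' x = frechet_derivative f (at x)" if "x \<in> S" for x
    using assms(2)[OF that] by (rule frechet_derivative_at)
  then have "C_k_on k (\<lambda>x. frechet_derivative f (at x) v) S" for v
    by (intro C_k_on_cong[OF assms(1) assms(3)[of v]]) auto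
  then show ?thesis
    using assms by (auto simp: differentiable_on_eq_differentiable_at differentiable_def)
qed

lemma C_k_on_Suc_imp: "open S \<Longrightarrow> C_k_on (Suc k) f S \<Longrightarrow> C_k_on k f S"
  by (induction k arbitrary: f) (auto intro: differentiable_imp_continuous_on)

lemma C_k_on_le: "open S \<Longrightarrow> C_k_on k f S \<Longrightarrow> j \<le> k \<Longrightarrow> C_k_on j f S"
proof (induction k)
  case (Suc k)
  then show ?case using C_k_on_Suc_imp[of S k f] by (cases "j = Suc k") auto
qed auto

lemma C_k_on_const: "open S \<Longrightarrow> C_k_on k (\<lambda>x. c) S"
  by (induction k arbitrary: c) (auto intro!: C_k_on_SucI[where f' = "\<lambda>x v. 0"] simp del: C_k_on.simps(2))

lemma C_k_on_linear:
  assumes "open S" "bounded_linear L"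
  shows "C_k_on k f S \<Longrightarrow> C_k_on k (\<lambda>x. L (f x)) S"
proof (induction k arbitrary: f)
  case 0
  then show ?case using assms(2) by (simp add: bounded_linear.continuous_on)
next
  case (Suc k)
  show ?case
    by (rule C_k_on_SucI[OF assms(1), where f' = "\<lambda>x v. L (frechet_derivative f (at x) v)"])
       (use Suc C_k_on_Suc_has_derivative[OF Suc.prems assms(1)] in
          \<open>auto intro: bounded_linear.has_derivative[OF assms(2)]\<close>)
qed

lemma C_k_on_Pair:
  assumes "open S"
  shows "C_k_on k f S \<Longrightarrow> C_k_on k g S \<Longrightarrow> C_k_on k (\<lambda>x. (f x, g x)) S"
proof (induction k arbitrary: f g)
  case 0
  then show ?case by (simp add: continuous_on_Pair)
next
  case (Suc k)
  show ?case
    by (rule C_k_on_SucI[OF assms(1), where f' = "\<lambda>x v. (frechet_derivative f (at x) v, frechet_derivative g (at x) v)"])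
       (use Suc C_k_on_Suc_has_derivative[OF Suc.prems(1) assms(1)]
          C_k_on_Suc_has_derivative[OF Suc.prems(2) assms(1)] in
          \<open>auto intro: has_derivative_Pair\<close>)
qed

lemma C_k_on_add:
  assumes "open S" "C_k_on k f S" "C_k_on k g S"
  shows "C_k_on k (\<lambda>x. f x + g x) S"
proof -
  have "bounded_linear (\<lambda>p::'b \<times> 'b. fst p + snd p)"
    by (intro bounded_linear_add bounded_linear_fst bounded_linear_snd)
  from C_k_on_linear[OF assms(1) this C_k_on_Pair[OF assms]] show ?thesis by simp
qed

lemma C_k_on_bilinear:
  assumes "open S" "bounded_bilinear B"
  shows "C_k_on k f S \<Longrightarrow> C_k_on k g S \<Longrightarrow> C_k_on k (\<lambda>x. B (f x) (g x)) S"
proof (induction k arbitrary: f g)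
  case 0
  then show ?case using assms(2) by (simp add: bounded_bilinear.continuous_on)
next
  case (Suc k)
  have "C_k_on k f S" "C_k_on k g S" using Suc.prems assms(1) C_k_on_Suc_imp by blast+
  then show ?case
    by (intro C_k_on_SucI[OF assms(1), where f' = "\<lambda>x v. B (f x) (frechet_derivative g (at x) v) + B (frechet_derivative f (at x) v) (g x)"])
       (use Suc C_k_on_Suc_has_derivative[OF Suc.prems(1) assms(1)]
          C_k_on_Suc_has_derivative[OF Suc.prems(2) assms(1)] in
          \<open>auto intro!: bounded_bilinear.FDERIV[OF assms(2)] C_k_on_add[OF assms(1)]\<close>)
qed

lemmas C_k_on_mult = C_k_on_bilinear[OF _ bounded_bilinear_mult]
lemmas C_k_on_scaleR = C_k_on_bilinear[OF _ bounded_bilinear_scaleR]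
lemmas C_k_on_inner = C_k_on_bilinear[OF _ bounded_bilinear_inner]
lemmas C_k_on_minus = C_k_on_linear[OF _ bounded_linear_minus[OF bounded_linear_ident]]
lemmas C_k_on_fst = C_k_on_linear[OF _ bounded_linear_fst]
lemmas C_k_on_snd = C_k_on_linear[OF _ bounded_linear_snd]
lemmas C_k_on_cnj = C_k_on_linear[OF _ bounded_linear_cnj]
lemmas C_k_on_Re = C_k_on_linear[OF _ bounded_linear_Re]
lemmas C_k_on_Im = C_k_on_linear[OF _ bounded_linear_Im]
lemmas C_k_on_of_real = C_k_on_linear[OF _ bounded_linear_of_real]

lemma C_k_on_diff:
  assumes "open S" "C_k_on k f S" "C_k_on k g S"
  shows "C_k_on k (\<lambda>x. f x - g x) S"
  using C_k_on_add[OF assms(1,2) C_k_on_minus[OF assms(1,3)]] by simp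

lemma C_k_on_inverse:
  fixes f :: "'a::euclidean_space \<Rightarrow> 'b::{euclidean_space, real_normed_field}"
  assumes "open S" "\<And>x. x \<in> S \<Longrightarrow> f x \<noteq> 0"
  shows "C_k_on k f S \<Longrightarrow> C_k_on k (\<lambda>x. inverse (f x)) S"
proof (induction k)
  case 0
  then show ?case using assms by (auto intro: continuous_on_inverse)
next
  case (Suc k)
  have f: "C_k_on k (\<lambda>x. inverse (f x)) S" using Suc C_k_on_Suc_imp[OF assms(1)] by blast
  show ?case
    by (rule C_k_on_SucI[OF assms(1), where f' = "\<lambda>x v. - (inverse (f x) * frechet_derivative f (at x) v * inverse (f x))"])
       (use Suc.prems f assms(2) C_k_on_Suc_has_derivative[OF Suc.prems(1) assms(1)] in
          \<open>auto intro!: has_derivative_inverse C_k_on_minus C_k_on_mult assms(1)\<close>)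
qed

lemma C_k_on_divide:
  fixes f :: "'a::euclidean_space \<Rightarrow> 'b::{euclidean_space, real_normed_field}"
  assumes "open S" "C_k_on k f S" "C_k_on k g S" "\<And>x. x \<in> S \<Longrightarrow> g x \<noteq> 0"
  shows "C_k_on k (\<lambda>x. f x / g x) S"
  unfolding divide_inverse by (intro C_k_on_mult C_k_on_inverse assms)

lemma C_k_on_sqrt:
  assumes "open S" "\<And>x. x \<in> S \<Longrightarrow> f x > 0"
  shows "C_k_on k f S \<Longrightarrow> C_k_on k (\<lambda>x. sqrt (f x)) S"
proof (induction k)
  case 0
  then show ?case by (auto intro: continuous_on_real_sqrt)
next
  case (Suc k)
  have f: "C_k_on k (\<lambda>x. sqrt (f x)) S" using Suc C_k_on_Suc_imp[OF assms(1)] by blast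
  have nz: "sqrt (f x) \<noteq> 0" if "x \<in> S" for x using assms(2)[OF that] by simp
  show ?case
  proof (rule C_k_on_SucI[OF assms(1), where f' = "\<lambda>x v. frechet_derivative f (at x) v * (inverse (sqrt (f x)) / 2)"])
    show "((\<lambda>x. sqrt (f x)) has_derivative (\<lambda>v. frechet_derivative f (at x) v * (inverse (sqrt (f x)) / 2))) (at x)"
      if "x \<in> S" for x
      using has_derivative_real_sqrt[OF assms(2)[OF that] C_k_on_Suc_has_derivative[OF Suc.prems(1) assms(1) that]] by simp
    show "C_k_on k (\<lambda>x. frechet_derivative f (at x) v * (inverse (sqrt (f x)) / 2)) S" for v
      using Suc.prems f nz
      by (auto intro!: C_k_on_mult C_k_on_divide C_k_on_inverse C_k_on_const assms(1))
  qed
qed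

section \<open>Symmetry of second derivatives\<close>

text \<open>Young's form of the theorem of Schwarz: the mixed second difference quotient along the diagonal converges to
  the iterated derivative as soon as the inner directional derivative is differentiable at the point. No
  continuity of second derivatives is required. This matters below, where the symmetry is applied to functions
  that are known to be twice differentiable only through the differential equation that they satisfy.\<close>

lemma difference_quotient_second:
  fixes f :: "'a::euclidean_space \<Rightarrow> real"
  assumes "open S" "p \<in> S"
    and f: "\<And>x. x \<in> S \<Longrightarrow> (f has_derivative f' x) (at x)"
    and f2: "((\<lambda>x. f' x v) has_derivative g) (at p)"
  shows "((\<lambda>t. (f (p + t *\<^sub>R v + t *\<^sub>R w) - f (p + t *\<^sub>R v) - f (p + t *\<^sub>R w) + f p) / t\<^sup>2) \<longlongrightarrow> g w) (at_right 0)"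
proof (rule tendstoI)
  fix e :: real assume "e > 0"
  define K where "K = 2 * norm v + norm w + 1"
  have K: "K > 0" by (simp add: K_def add_nonneg_pos)
  interpret g: bounded_linear g using f2 by (rule has_derivative_bounded_linear)
  define e' where "e' = e / (3 * K)"
  have e': "e' > 0" using K \<open>e > 0\<close> by (simp add: e'_def)
  from f2 obtain d where d: "d > 0" "\<And>y. norm (y - p) < d \<Longrightarrow> norm (f' y v - f' p v - g (y - p)) \<le> e' * norm (y - p)"
    using e' unfolding has_derivative_at_alt by blast
  obtain r where r: "r > 0" "ball p r \<subseteq> S" using assms(1,2) openE by blast
  define \<delta> where "\<delta> = min d r / K"
  have \<delta>: "\<delta> > 0" using d r K by (simp add: \<delta>_def)
  have main: "dist ((f (p + t *\<^sub>R v + t *\<^sub>R w) - f (p + t *\<^sub>R v) - f (p + t *\<^sub>R w) + f p) / t\<^sup>2) (g w) < e"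
    if t: "0 < t" "t < \<delta>" for t
  proof -
    have tK: "t * K < min d r" using t K by (simp add: \<delta>_def pos_less_divide_eq)
    have nrm: "norm (s *\<^sub>R v + u *\<^sub>R w) < min d r \<and> norm (s *\<^sub>R v + u *\<^sub>R w) \<le> t * K"
      if "0 \<le> s" "s \<le> t" "0 \<le> u" "u \<le> t" for s u
    proof -
      have "norm (s *\<^sub>R v + u *\<^sub>R w) \<le> s * norm v + u * norm w"
        using norm_triangle_ineq[of "s *\<^sub>R v" "u *\<^sub>R w"] that by simp
      also have "\<dots> \<le> t * norm v + t * norm w"
        using that by (intro add_mono mult_right_mono) auto
      also have "\<dots> \<le> t * K"
        using t unfolding K_def by (simp add: algebra_simps)
      finally show ?thesis using tK by simp
    qed
    have inS: "p + s *\<^sub>R v + u *\<^sub>R w \<in> S" if "0 \<le> s" "s \<le> t" "0 \<le> u" "u \<le> t" for s u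
      using nrm[OF that] r(2) by (auto simp: subset_iff dist_norm add.assoc norm_minus_commute norm_minus_cancel)
    define h where "h s = f (p + s *\<^sub>R v + t *\<^sub>R w) - f (p + s *\<^sub>R v + 0 *\<^sub>R w)" for s
    have dh: "(h has_derivative (\<lambda>x. x * (f' (p + s *\<^sub>R v + t *\<^sub>R w) v - f' (p + s *\<^sub>R v + 0 *\<^sub>R w) v))) (at s)"
      if s: "0 \<le> s" "s \<le> t" for s
    proof -
      have c: "((\<lambda>s. f (p + s *\<^sub>R v + u *\<^sub>R w)) has_derivative (\<lambda>x. x * f' (p + s *\<^sub>R v + u *\<^sub>R w) v)) (at s)"
        if u: "0 \<le> u" "u \<le> t" for u
      proof -
        have fd: "(f has_derivative f' (p + s *\<^sub>R v + u *\<^sub>R w)) (at (p + s *\<^sub>R v + u *\<^sub>R w))"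
          using f inS s u by blast
        have i: "((\<lambda>s. p + s *\<^sub>R v + u *\<^sub>R w) has_derivative (\<lambda>x. x *\<^sub>R v)) (at s)"
          by (auto intro!: derivative_eq_intros)
        from has_derivative_compose[OF i fd] linear_cmul[OF has_derivative_linear[OF fd]]
        show ?thesis by (simp add: o_def)
      qed
      show ?thesis unfolding h_def using has_derivative_diff[OF c[of t] c[of 0]] t
        by (simp add: algebra_simps)
    qed
    have "continuous_on {0..t} h"
      using dh has_derivative_continuous by (fastforce intro: continuous_at_imp_continuous_on)
    then obtain s where s: "0 < s" "s < t" "h t - h 0 = (t - 0) * (f' (p + s *\<^sub>R v + t *\<^sub>R w) v - f' (p + s *\<^sub>R v + 0 *\<^sub>R w) v)"
      using mvt[of 0 t h "\<lambda>s x. x * (f' (p + s *\<^sub>R v + t *\<^sub>R w) v - f' (p + s *\<^sub>R v + 0 *\<^sub>R w) v)"] t dh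
      by auto
    have n1: "norm (f' (p + s *\<^sub>R v + t *\<^sub>R w) v - f' p v - g (s *\<^sub>R v + t *\<^sub>R w)) \<le> e' * (t * K)"
      using d(2)[of "p + s *\<^sub>R v + t *\<^sub>R w"] nrm[of s t] s t e'
      by (auto simp: add.assoc intro: order_trans mult_left_mono)
    have n2: "norm (f' (p + s *\<^sub>R v) v - f' p v - g (s *\<^sub>R v)) \<le> e' * (t * K)"
      using d(2)[of "p + s *\<^sub>R v"] nrm[of s 0] s t e'
      by (auto simp: add.assoc intro: order_trans mult_left_mono)
    define X where "X = f' (p + s *\<^sub>R v + t *\<^sub>R w) v - f' (p + s *\<^sub>R v) v"
    have "X - t * g w = (f' (p + s *\<^sub>R v + t *\<^sub>R w) v - f' p v - g (s *\<^sub>R v + t *\<^sub>R w)) - (f' (p + s *\<^sub>R v) v - f' p v - g (s *\<^sub>R v))"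
      by (simp add: X_def g.add g.scaleR)
    then have X: "\<bar>X - t * g w\<bar> \<le> 2 * (e' * (t * K))" using n1 n2 by simp
    have "(f (p + t *\<^sub>R v + t *\<^sub>R w) - f (p + t *\<^sub>R v) - f (p + t *\<^sub>R w) + f p) / t\<^sup>2 = X / t"
    proof -
      have "f (p + t *\<^sub>R v + t *\<^sub>R w) - f (p + t *\<^sub>R v) - f (p + t *\<^sub>R w) + f p = t * X"
        using s(3) by (simp add: h_def X_def)
      then show ?thesis using t by (simp add: power2_eq_square)
    qed
    then have "dist ((f (p + t *\<^sub>R v + t *\<^sub>R w) - f (p + t *\<^sub>R v) - f (p + t *\<^sub>R w) + f p) / t\<^sup>2) (g w) = \<bar>X / t - g w\<bar>"
      by (simp add: dist_real_def)
    also have "X / t - g w = (X - t * g w) / t" using t by (simp add: field_simps)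
    also have "\<bar>(X - t * g w) / t\<bar> \<le> 2 * (e' * K)" using X t by (simp add: abs_div pos_divide_le_eq algebra_simps)
    also have "\<dots> < e" using K \<open>e > 0\<close> by (simp add: e'_def field_simps)
    finally show ?thesis .
  qed
  then show "\<forall>\<^sub>F t in at_right 0. dist ((f (p + t *\<^sub>R v + t *\<^sub>R w) - f (p + t *\<^sub>R v) - f (p + t *\<^sub>R w) + f p) / t\<^sup>2) (g w) < e"
    unfolding eventually_at_right_field using \<delta> by blast
qed

lemma second_derivative_symmetric_real:
  fixes f :: "'a::euclidean_space \<Rightarrow> real"
  assumes "open S" "p \<in> S"
    and "\<And>x. x \<in> S \<Longrightarrow> (f has_derivative f' x) (at x)"
    and "((\<lambda>x. f' x v) has_derivative g) (at p)" "((\<lambda>x. f' x w) has_derivative h) (at p)"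
  shows "g w = h v"
proof -
  have "(\<lambda>t. (f (p + t *\<^sub>R w + t *\<^sub>R v) - f (p + t *\<^sub>R w) - f (p + t *\<^sub>R v) + f p) / t\<^sup>2)
      = (\<lambda>t. (f (p + t *\<^sub>R v + t *\<^sub>R w) - f (p + t *\<^sub>R v) - f (p + t *\<^sub>R w) + f p) / t\<^sup>2)"
    by (intro ext) (simp add: add_ac)
  then have *: "((\<lambda>t. (f (p + t *\<^sub>R v + t *\<^sub>R w) - f (p + t *\<^sub>R v) - f (p + t *\<^sub>R w) + f p) / t\<^sup>2) \<longlongrightarrow> h v) (at_right 0)"
    using difference_quotient_second[OF assms(1-3,5), of v] by simp
  show ?thesis
    by (rule tendsto_unique[OF trivial_limit_at_right_real difference_quotient_second[OF assms(1-4)] *])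
qed

lemma second_derivative_symmetric:
  fixes f :: "'a::euclidean_space \<Rightarrow> 'b::euclidean_space"
  assumes "open S" "p \<in> S"
    and "\<And>x. x \<in> S \<Longrightarrow> (f has_derivative f' x) (at x)"
    and "((\<lambda>x. f' x v) has_derivative g) (at p)" "((\<lambda>x. f' x w) has_derivative h) (at p)"
  shows "g w = h v"
proof (rule euclidean_eqI)
  fix b :: 'b
  have "((\<lambda>x. f x \<bullet> b) has_derivative (\<lambda>v. f' x v \<bullet> b)) (at x)" if "x \<in> S" for x
    using has_derivative_inner_left[OF assms(3)[OF that]] .
  from second_derivative_symmetric_real[OF assms(1,2) this
      has_derivative_inner_left[OF assms(4)] has_derivative_inner_left[OF assms(5)]]
  show "g w \<bullet> b = h v \<bullet> b" .
qed

section \<open>The neutral metric and its mean curvature\<close>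

lemma neutral_metric_eq_Im:
  "neutral_metric \<mu> u v =
     Im ((fst u * cnj (snd v) + fst v * cnj (snd u)) / (1 + fst \<mu> * cnj (snd \<mu>))\<^sup>2)"
proof -
  define c where "c = fst u * cnj (snd v) + fst v * cnj (snd u)"
  define X where "X = c / 2 / (1 + fst \<mu> * cnj (snd \<mu>))\<^sup>2"
  have "(cnj (fst u) * snd v + cnj (fst v) * snd u) / 2 / (1 + cnj (fst \<mu>) * snd \<mu>)\<^sup>2 = cnj X"
    by (simp add: X_def c_def)
  then have "neutral_metric \<mu> u v = 2 * Im X"
    unfolding neutral_metric_def c_def[symmetric] X_def[symmetric] by simp
  also have "\<dots> = Im (2 * X)" by simp
  also have "2 * X = c / (1 + fst \<mu> * cnj (snd \<mu>))\<^sup>2" by (simp add: X_def)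
  finally show ?thesis by (simp only: c_def)
qed

lemma neutral_metric_sym: "neutral_metric \<mu> u v = neutral_metric \<mu> v u"
  by (simp add: neutral_metric_eq_Im add.commute)

lemma neutral_metric_add: "neutral_metric \<mu> (u + u') v = neutral_metric \<mu> u v + neutral_metric \<mu> u' v"
proof -
  have "((fst (u + u') * cnj (snd v) + fst v * cnj (snd (u + u'))) / (1 + fst \<mu> * cnj (snd \<mu>))\<^sup>2) =
    ((fst u * cnj (snd v) + fst v * cnj (snd u)) / (1 + fst \<mu> * cnj (snd \<mu>))\<^sup>2) +
    ((fst u' * cnj (snd v) + fst v * cnj (snd u')) / (1 + fst \<mu> * cnj (snd \<mu>))\<^sup>2)"
    by (simp add: algebra_simps add_divide_distrib)
  then show ?thesis by (simp only: neutral_metric_eq_Im plus_complex.sel)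
qed

lemma neutral_metric_scale: "neutral_metric \<mu> (c *\<^sub>R u) v = c * neutral_metric \<mu> u v"
proof -
  have "((fst (c *\<^sub>R u) * cnj (snd v) + fst v * cnj (snd (c *\<^sub>R u))) / (1 + fst \<mu> * cnj (snd \<mu>))\<^sup>2) =
    c *\<^sub>R ((fst u * cnj (snd v) + fst v * cnj (snd u)) / (1 + fst \<mu> * cnj (snd \<mu>))\<^sup>2)"
    by (simp add: algebra_simps scaleR_conv_of_real add_divide_distrib)
  then show ?thesis by (simp only: neutral_metric_eq_Im scaleR_complex.sel)
qed

lemma neutral_metric_diff: "neutral_metric \<mu> (u - u') v = neutral_metric \<mu> u v - neutral_metric \<mu> u' v"
  using neutral_metric_add[of \<mu> u "- u'" v] neutral_metric_scale[of \<mu> "-1" u' v] by simp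

lemma neutral_metric_nondegenerate:
  assumes "\<mu> \<in> coord_domain" "\<And>y. neutral_metric \<mu> u y = 0"
  shows "u = 0"
proof -
  define D where "D = 1 + fst \<mu> * cnj (snd \<mu>)"
  have D: "D \<noteq> 0" using assms(1) by (simp add: coord_domain_def D_def)
  have "neutral_metric \<mu> u (0, cnj (D\<^sup>2 * \<i> * cnj (fst u))) = Im (\<i> * (fst u * cnj (fst u)))"
    unfolding neutral_metric_eq_Im D_def[symmetric] using D by (simp add: field_simps)
  moreover have "neutral_metric \<mu> u (D\<^sup>2 * \<i> * snd u, 0) = Im (\<i> * (snd u * cnj (snd u)))"
    unfolding neutral_metric_eq_Im D_def[symmetric] using D by (simp add: field_simps)
  ultimately have "(cmod (fst u))\<^sup>2 = 0" "(cmod (snd u))\<^sup>2 = 0"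
    using assms(2) by (simp_all add: complex_mult_cnj cmod_power2)
  then show ?thesis by (simp add: prod_eq_iff)
qed

text \<open>In the coordinates \<open>(\<mu>\<^sub>1, cnj \<mu>\<^sub>2)\<close> the metric is the imaginary part of a holomorphic metric
  whose null directions are the coordinate axes, hence only two Christoffel symbols survive.\<close>

definition neutral_christoffel :: "coords \<Rightarrow> coords \<Rightarrow> coords \<Rightarrow> coords" where
  "neutral_christoffel \<mu> u v =
     (- 2 * cnj (snd \<mu>) * fst u * fst v / (1 + fst \<mu> * cnj (snd \<mu>)),
      - 2 * cnj (fst \<mu>) * snd u * snd v / (1 + cnj (fst \<mu>) * snd \<mu>))"

lemma neutral_metric_has_derivative:
  assumes "\<mu> \<in> coord_domain"
  shows "((\<lambda>x. neutral_metric x u v) has_derivative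
     (\<lambda>h. Im (- 2 * (fst h * cnj (snd \<mu>) + fst \<mu> * cnj (snd h)) * (fst u * cnj (snd v) + fst v * cnj (snd u))
              / (1 + fst \<mu> * cnj (snd \<mu>)) ^ 3))) (at \<mu>)"
proof -
  define D where "D = 1 + fst \<mu> * cnj (snd \<mu>)"
  have D: "D \<noteq> 0" using assms(1) by (simp add: coord_domain_def D_def)
  define c where "c = fst u * cnj (snd v) + fst v * cnj (snd u)"
  have D': "((\<lambda>x. 1 + fst x * cnj (snd x)) has_derivative (\<lambda>h. fst h * cnj (snd \<mu>) + fst \<mu> * cnj (snd h))) (at \<mu>)"
    by (auto intro!: derivative_eq_intros)
  have "((\<lambda>x. inverse ((1 + fst x * cnj (snd x))\<^sup>2)) has_derivative
       (\<lambda>h. - 2 * (fst h * cnj (snd \<mu>) + fst \<mu> * cnj (snd h)) / D ^ 3)) (at \<mu>)"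
  proof -
    have "((\<lambda>z. inverse (z\<^sup>2)) has_field_derivative - 2 / D ^ 3) (at D)"
      using D by (auto intro!: derivative_eq_intros simp: field_simps power2_eq_square power3_eq_cube)
    from has_derivative_compose[OF D' this[unfolded has_field_derivative_def D_def]]
    show ?thesis by (rule has_derivative_eq_rhs) (simp only: D_def times_divide_eq_left)
  qed
  from has_derivative_Im[OF has_derivative_mult_left[OF this, of c]]
  have "((\<lambda>x. neutral_metric x u v) has_derivative
     (\<lambda>h. Im (- 2 * (fst h * cnj (snd \<mu>) + fst \<mu> * cnj (snd h)) / D ^ 3 * c))) (at \<mu>)"
    by (simp only: neutral_metric_eq_Im c_def divide_inverse mult.commute)
  then show ?thesis
    by (simp only: c_def D_def times_divide_eq_left)
qed

lemma christoffel_neutral: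
  assumes "\<mu> \<in> coord_domain"
  shows "christoffel neutral_metric \<mu> u v = neutral_christoffel \<mu> u v"
proof -
  define D where "D = 1 + fst \<mu> * cnj (snd \<mu>)"
  have D: "D \<noteq> 0" using assms(1) by (simp add: coord_domain_def D_def)
  have cD: "1 + cnj (fst \<mu>) * snd \<mu> = cnj D" by (simp add: D_def)
  have fr: "frechet_derivative (\<lambda>x. neutral_metric x u v) (at \<mu>) =
     (\<lambda>h. Im (- 2 * (fst h * cnj (snd \<mu>) + fst \<mu> * cnj (snd h)) * (fst u * cnj (snd v) + fst v * cnj (snd u))
              / D ^ 3))" for u v
    using frechet_derivative_at[OF neutral_metric_has_derivative[OF assms]] unfolding D_def by metis
  define kos where "kos y = (frechet_derivative (\<lambda>x'. neutral_metric x' v y) (at \<mu>) u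
      + frechet_derivative (\<lambda>x'. neutral_metric x' u y) (at \<mu>) v
      - frechet_derivative (\<lambda>x'. neutral_metric x' u v) (at \<mu>) y) / 2" for y
  have *: "neutral_metric \<mu> (neutral_christoffel \<mu> u v) y = kos y" for y
  proof -
    have "kos y = Im ((- 2 * (fst u * cnj (snd \<mu>) + fst \<mu> * cnj (snd u)) * (fst v * cnj (snd y) + fst y * cnj (snd v)) / D ^ 3
       + - 2 * (fst v * cnj (snd \<mu>) + fst \<mu> * cnj (snd v)) * (fst u * cnj (snd y) + fst y * cnj (snd u)) / D ^ 3
       - - 2 * (fst y * cnj (snd \<mu>) + fst \<mu> * cnj (snd y)) * (fst u * cnj (snd v) + fst v * cnj (snd u)) / D ^ 3) / 2)"
      unfolding kos_def fr by simp
    also have "(- 2 * (fst u * cnj (snd \<mu>) + fst \<mu> * cnj (snd u)) * (fst v * cnj (snd y) + fst y * cnj (snd v)) / D ^ 3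
       + - 2 * (fst v * cnj (snd \<mu>) + fst \<mu> * cnj (snd v)) * (fst u * cnj (snd y) + fst y * cnj (snd u)) / D ^ 3
       - - 2 * (fst y * cnj (snd \<mu>) + fst \<mu> * cnj (snd y)) * (fst u * cnj (snd v) + fst v * cnj (snd u)) / D ^ 3) / 2
       = (fst (neutral_christoffel \<mu> u v) * cnj (snd y) + fst y * cnj (snd (neutral_christoffel \<mu> u v))) / D\<^sup>2"
      unfolding neutral_christoffel_def D_def[symmetric] cD using D
      by (simp add: divide_simps power2_eq_square power3_eq_cube) (simp add: algebra_simps)
    finally show ?thesis by (simp add: neutral_metric_eq_Im D_def)
  qed
  show ?thesis
    unfolding christoffel_def kos_def[symmetric]
  proof (rule the_equality)
    show "\<forall>y. neutral_metric \<mu> (neutral_christoffel \<mu> u v) y = kos y" using * by blast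
    fix w assume "\<forall>y. neutral_metric \<mu> w y = kos y"
    then have "neutral_metric \<mu> w y = kos y" for y by blast
    then have "neutral_metric \<mu> (w - neutral_christoffel \<mu> u v) y = 0" for y
      by (simp add: neutral_metric_diff *)
    from neutral_metric_nondegenerate[OF assms this]
    show "w = neutral_christoffel \<mu> u v" by simp
  qed
qed

lemma induced_metric_sym: "induced_metric neutral_metric F p v w = induced_metric neutral_metric F p w v"
  by (simp add: induced_metric_def neutral_metric_sym)

text \<open>Orthogonal projection to a non-degenerate plane, by Cramer's rule for the Gram matrix.\<close>

lemma normal_part_ex1:
  fixes F :: "R2 \<Rightarrow> coords"
  assumes lin: "linear (frechet_derivative F (at p))" and det: "induced_det neutral_metric F p \<noteq> 0"
  shows "\<exists>!n. w - n \<in> range (frechet_derivative F (at p)) \<and>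
     (\<forall>v. neutral_metric (F p) n (frechet_derivative F (at p) v) = 0)"
proof -
  define L where "L = frechet_derivative F (at p)"
  interpret L: linear L using lin by (simp add: L_def)
  define g where "g = neutral_metric (F p)"
  define T1 where "T1 = L (1, 0)"
  define T2 where "T2 = L (0, 1)"
  have Lv: "L v = fst v *\<^sub>R T1 + snd v *\<^sub>R T2" for v
  proof -
    have "v = fst v *\<^sub>R (1, 0) + snd v *\<^sub>R (0, 1)" by (simp add: prod_eq_iff)
    then show ?thesis unfolding T1_def T2_def by (metis L.add L.scale)
  qed
  have g_add: "g (u + u') v = g u v + g u' v" and g_sc: "g (c *\<^sub>R u) v = c * g u v"
    and g_diff: "g (u - u') v = g u v - g u' v" for u u' v c
    by (simp_all add: g_def neutral_metric_add neutral_metric_scale neutral_metric_diff)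
  have g_sym: "g u v = g v u" for u v unfolding g_def by (rule neutral_metric_sym)
  have g_add2: "g v (u + u') = g v u + g v u'" and g_sc2: "g v (c *\<^sub>R u) = c * g v u" for u u' v c
    using g_add g_sc g_sym by metis+
  define d where "d = g T1 T1 * g T2 T2 - (g T1 T2)\<^sup>2"
  have d: "d \<noteq> 0"
    using det by (simp add: induced_det_def induced_metric_def d_def g_def T1_def T2_def L_def)
  define x where "x = (g w T1 * g T2 T2 - g w T2 * g T1 T2) / d"
  define y where "y = (g w T2 * g T1 T1 - g w T1 * g T1 T2) / d"
  define n where "n = w - (x *\<^sub>R T1 + y *\<^sub>R T2)"
  have xd: "x * d = g w T1 * g T2 T2 - g w T2 * g T1 T2" and yd: "y * d = g w T2 * g T1 T1 - g w T1 * g T1 T2"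
    using d by (simp_all add: x_def y_def)
  have n1: "g n T1 = 0"
  proof -
    have "d * g n T1 = d * g w T1 - (x * d) * g T1 T1 - (y * d) * g T2 T1"
      unfolding n_def g_diff g_add g_sc by (simp add: algebra_simps)
    also have "\<dots> = 0" unfolding xd yd unfolding d_def g_sym[of T2 T1] by (simp add: algebra_simps power2_eq_square)
    finally show ?thesis using d by simp
  qed
  have n2: "g n T2 = 0"
  proof -
    have "d * g n T2 = d * g w T2 - (x * d) * g T1 T2 - (y * d) * g T2 T2"
      unfolding n_def g_diff g_add g_sc by (simp add: algebra_simps)
    also have "\<dots> = 0" unfolding xd yd unfolding d_def by (simp add: algebra_simps power2_eq_square)
    finally show ?thesis using d by simp
  qed
  have "w - n = L (x, y)" by (simp add: n_def Lv)
  then have ex: "w - n \<in> range L \<and> (\<forall>v. g n (L v) = 0)"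
    by (metis Lv g_add2 g_sc2 n1 n2 rangeI add_0 mult_zero_right)
  have un: "n' = n" if n': "w - n' \<in> range L" "\<forall>v. g n' (L v) = 0" for n'
  proof -
    from n'(1) ex obtain v v' where "w - n' = L v" "w - n = L v'" by blast
    then have "n - n' = L (v - v')" by (simp add: L.diff algebra_simps)
    then obtain a b where ab: "n - n' = a *\<^sub>R T1 + b *\<^sub>R T2" by (auto simp: Lv)
    have "g (n - n') T1 = 0" "g (n - n') T2 = 0"
      using n'(2) n1 n2 by (auto simp: g_diff T1_def T2_def)
    then have e: "a * g T1 T1 + b * g T1 T2 = 0" "a * g T1 T2 + b * g T2 T2 = 0"
      unfolding ab g_add g_sc by (simp_all add: g_sym[of T2 T1])
    have "a * d = (a * g T1 T1 + b * g T1 T2) * g T2 T2 - (a * g T1 T2 + b * g T2 T2) * g T1 T2"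
      "b * d = (a * g T1 T2 + b * g T2 T2) * g T1 T1 - (a * g T1 T1 + b * g T1 T2) * g T1 T2"
      by (simp_all add: d_def algebra_simps power2_eq_square)
    then have "a * d = 0" "b * d = 0" unfolding e by simp_all
    then have "a = 0" "b = 0" using d by simp_all
    then show ?thesis using ab by simp
  qed
  show ?thesis using ex un unfolding L_def g_def by blast
qed

text \<open>The covariant second derivative of the parametrisation; the second fundamental form is its normal part.\<close>

definition covariant_second :: "(R2 \<Rightarrow> coords) \<Rightarrow> R2 \<Rightarrow> R2 \<Rightarrow> R2 \<Rightarrow> coords" where
  "covariant_second F p v w =
     frechet_derivative (\<lambda>q. frechet_derivative F (at q) w) (at p) v
     + neutral_christoffel (F p) (frechet_derivative F (at p) v) (frechet_derivative F (at p) w)"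

lemma second_fundamental_form_neutral:
  "F p \<in> coord_domain \<Longrightarrow> second_fundamental_form neutral_metric F p v w
     = normal_part neutral_metric F p (covariant_second F p v w)"
  by (simp add: second_fundamental_form_def covariant_second_def christoffel_neutral)

text \<open>The mean curvature vector vanishes exactly if the trace of the covariant second derivative is tangent.
  In this form the condition no longer refers to normal vectors.\<close>

lemma mean_curvature_zero_imp_tangent:
  fixes F :: "R2 \<Rightarrow> coords"
  assumes "F p \<in> coord_domain" and lin: "linear (frechet_derivative F (at p))"
    and det: "induced_det neutral_metric F p \<noteq> 0"
    and H: "mean_curvature_vector neutral_metric F p = 0"
  defines "I \<equiv> induced_metric neutral_metric F p" and "W \<equiv> covariant_second F p"
  shows "I (0,1) (0,1) *\<^sub>R W (1,0) (1,0) - I (1,0) (0,1) *\<^sub>R W (1,0) (0,1)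
      - I (1,0) (0,1) *\<^sub>R W (0,1) (1,0) + I (1,0) (1,0) *\<^sub>R W (0,1) (0,1)
      \<in> range (frechet_derivative F (at p))"
proof -
  define n where "n = normal_part neutral_metric F p"
  have n: "w - n w \<in> range (frechet_derivative F (at p))" for w
    using theI'[OF normal_part_ex1[OF lin det, of w]] by (simp add: n_def normal_part_def)
  define S where "S f = I (0,1) (0,1) *\<^sub>R f (W (1,0) (1,0)) - I (1,0) (0,1) *\<^sub>R f (W (1,0) (0,1))
      - I (1,0) (0,1) *\<^sub>R f (W (0,1) (1,0)) + I (1,0) (1,0) *\<^sub>R f (W (0,1) (0,1))" for f :: "coords \<Rightarrow> coords"
  have "mean_curvature_vector neutral_metric F p = (1 / (2 * induced_det neutral_metric F p)) *\<^sub>R S n"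
    unfolding mean_curvature_vector_def Let_def second_fundamental_form_neutral[of F p, OF assms(1)]
    by (simp only: S_def I_def n_def W_def induced_metric_sym[of F p "(0,1)" "(1,0)"])
  then have "S n = 0" using H det by simp
  moreover have "S (\<lambda>w. w) = S (\<lambda>w. w - n w) + S n"
    by (simp add: S_def algebra_simps)
  ultimately have "S (\<lambda>w. w) = S (\<lambda>w. w - n w)" by simp
  also have "\<dots> \<in> range (frechet_derivative F (at p))"
    unfolding S_def using linear_subspace_image[OF lin subspace_UNIV]
    by (intro subspace_add subspace_diff[of "range (frechet_derivative F (at p))"] subspace_scale n)
  finally show ?thesis by (simp add: S_def)
qed

lemma mean_curvature_zero_if_tangent:
  fixes F :: "R2 \<Rightarrow> coords"
  assumes "F p \<in> coord_domain" and lin: "linear (frechet_derivative F (at p))"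
    and det: "induced_det neutral_metric F p \<noteq> 0"
    and W: "\<And>v w. covariant_second F p v w \<in> range (frechet_derivative F (at p))"
  shows "mean_curvature_vector neutral_metric F p = 0"
proof -
  have "second_fundamental_form neutral_metric F p v w = 0" for v w
    unfolding second_fundamental_form_neutral[of F p, OF assms(1)] normal_part_def
  proof (rule the1_equality[OF normal_part_ex1[OF lin det]])
    have "neutral_metric (F p) 0 u = 0" for u by (simp add: neutral_metric_eq_Im)
    then show "covariant_second F p v w - 0 \<in> range (frechet_derivative F (at p)) \<and>
      (\<forall>v. neutral_metric (F p) 0 (frechet_derivative F (at p) v) = 0)" using W by simp
  qed
  then show ?thesis by (simp add: mean_curvature_vector_def Let_def)
qed

section \<open>Geodesics in terms of spinors\<close>

text \<open>A point of the boundary sphere is represented by a non-zero vector \<open>\<xi>\<close> of \<open>\<complex>\<^sup>2\<close>, standing for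
  \<open>\<xi>\<^sub>1 / \<xi>\<^sub>2\<close>. The point \<open>geo_point \<xi> \<eta> R\<close> of the geodesic from \<open>\<eta>\<close> to \<open>\<xi>\<close> corresponds to the positive Hermitian matrix
  \<open>(R \<xi> \<xi>\<^sup>* + \<eta> \<eta>\<^sup>* / R) / |wedge \<xi> \<eta>|\<close> of determinant 1, under the identification of \<open>(z, t)\<close> with the matrix
  whose rows are \<open>(|z|\<^sup>2 + t\<^sup>2, z) / t\<close> and \<open>(cnj z, 1) / t\<close>. The parameter \<open>R\<close> is the exponential of arc length.
  Both charts are obtained by normalising one component of \<open>\<xi>\<close> and one of \<open>\<eta>\<close>.\<close>

definition wedge :: "complex \<times> complex \<Rightarrow> complex \<times> complex \<Rightarrow> complex" where
  "wedge \<xi> \<eta> = fst \<xi> * snd \<eta> - snd \<xi> * fst \<eta>"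

definition geo_denom :: "complex \<times> complex \<Rightarrow> complex \<times> complex \<Rightarrow> real \<Rightarrow> real" where
  "geo_denom \<xi> \<eta> R = R\<^sup>2 * (cmod (snd \<xi>))\<^sup>2 + (cmod (snd \<eta>))\<^sup>2"

definition geo_point :: "complex \<times> complex \<Rightarrow> complex \<times> complex \<Rightarrow> real \<Rightarrow> half_space" where
  "geo_point \<xi> \<eta> R = ((R\<^sup>2 * fst \<xi> * cnj (snd \<xi>) + fst \<eta> * cnj (snd \<eta>)) / geo_denom \<xi> \<eta> R,
     cmod (wedge \<xi> \<eta>) * R / geo_denom \<xi> \<eta> R)"

definition geo_velocity :: "complex \<times> complex \<Rightarrow> complex \<times> complex \<Rightarrow> real \<Rightarrow> half_space" where
  "geo_velocity \<xi> \<eta> R = (2 * R\<^sup>2 * cnj (snd \<xi> * snd \<eta>) * wedge \<xi> \<eta> / (geo_denom \<xi> \<eta> R)\<^sup>2,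
     cmod (wedge \<xi> \<eta>) * R * ((cmod (snd \<eta>))\<^sup>2 - R\<^sup>2 * (cmod (snd \<xi>))\<^sup>2) / (geo_denom \<xi> \<eta> R)\<^sup>2)"

text \<open>The tangent vectors orthogonal to the geodesic: \<open>\<theta>\<close> corresponds to the Hermitian matrix
  \<open>(\<theta> \<xi> \<eta>\<^sup>* + cnj \<theta> \<eta> \<xi>\<^sup>*) / |wedge \<xi> \<eta>|\<close>.\<close>

definition geo_normal :: "complex \<times> complex \<Rightarrow> complex \<times> complex \<Rightarrow> real \<Rightarrow> complex \<Rightarrow> half_space" where
  "geo_normal \<xi> \<eta> R \<theta> =
    (R * wedge \<xi> \<eta> * (\<theta> * (cnj (snd \<eta>))\<^sup>2 - R\<^sup>2 * cnj \<theta> * (cnj (snd \<xi>))\<^sup>2) / (geo_denom \<xi> \<eta> R)\<^sup>2,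
     - 2 * cmod (wedge \<xi> \<eta>) * R\<^sup>2 * Re (\<theta> * snd \<xi> * cnj (snd \<eta>)) / (geo_denom \<xi> \<eta> R)\<^sup>2)"

lemma geo_denom_pos:
  assumes "wedge \<xi> \<eta> \<noteq> 0" "R > 0"
  shows "geo_denom \<xi> \<eta> R > 0"
proof (cases "snd \<xi> = 0")
  case True
  then have "snd \<eta> \<noteq> 0" using assms by (auto simp: wedge_def)
  then show ?thesis using True by (simp add: geo_denom_def)
next
  case False
  then show ?thesis using assms(2) by (simp add: geo_denom_def add_pos_nonneg)
qed

lemma geo_denom_complex:
  "complex_of_real (geo_denom \<xi> \<eta> R) = (complex_of_real R)\<^sup>2 * (snd \<xi> * cnj (snd \<xi>)) + snd \<eta> * cnj (snd \<eta>)"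
  unfolding geo_denom_def of_real_add of_real_mult complex_norm_square by simp

lemma geo_point_in_H3: "wedge \<xi> \<eta> \<noteq> 0 \<Longrightarrow> R > 0 \<Longrightarrow> geo_point \<xi> \<eta> R \<in> H3"
  using geo_denom_pos by (simp add: geo_point_def H3_def)

text \<open>The Maurer-Cartan form of the frame \<open>(\<xi>, \<eta>)\<close>: the derivative of a point moving with its geodesic splits into a
  component along the geodesic, given by the diagonal entries, and one orthogonal to it, given by the
  off-diagonal entries.\<close>

lemma geo_point_has_derivative:
  fixes \<xi> \<eta> :: "'a::real_normed_vector \<Rightarrow> complex \<times> complex"
  assumes \<xi>: "(\<xi> has_derivative \<xi>') (at p)" and \<eta>: "(\<eta> has_derivative \<eta>') (at p)"
    and R: "(R has_derivative R') (at p)" and D: "wedge (\<xi> p) (\<eta> p) \<noteq> 0" and Rp: "R p > 0"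
  shows "((\<lambda>x. geo_point (\<xi> x) (\<eta> x) (R x)) has_derivative
    (\<lambda>w. (R' w / R p + Re ((wedge (\<xi>' w) (\<eta> p) - wedge (\<xi> p) (\<eta>' w)) / wedge (\<xi> p) (\<eta> p))) *\<^sub>R geo_velocity (\<xi> p) (\<eta> p) (R p)
      + geo_normal (\<xi> p) (\<eta> p) (R p)
          (R p * cnj (wedge (\<xi> p) (\<xi>' w) / wedge (\<xi> p) (\<eta> p)) + wedge (\<eta>' w) (\<eta> p) / wedge (\<xi> p) (\<eta> p) / R p))) (at p)"
proof -
  define x1 x2 y1 y2 where "x1 = fst (\<xi> p)" and "x2 = snd (\<xi> p)" and "y1 = fst (\<eta> p)" and "y2 = snd (\<eta> p)"
  define d where "d = wedge (\<xi> p) (\<eta> p)"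
  have d: "d \<noteq> 0" and d_eq: "d = x1 * y2 - x2 * y1"
    using D by (simp_all add: d_def wedge_def x1_def x2_def y1_def y2_def)
  define r where "r = R p"
  have r: "r > 0" using Rp by (simp add: r_def)
  define q where "q = geo_denom (\<xi> p) (\<eta> p) r"
  have q: "q > 0" using geo_denom_pos[OF D r] by (simp add: q_def)
  have qc: "complex_of_real q = (complex_of_real r)\<^sup>2 * (x2 * cnj x2) + y2 * cnj y2"
    unfolding q_def geo_denom_complex x2_def y2_def ..
  define t1 where "t1 w = wedge (\<xi>' w) (\<eta> p) / d" for w
  define t2 where "t2 w = wedge (\<xi> p) (\<eta>' w) / d" for w
  define b where "b w = wedge (\<xi> p) (\<xi>' w) / d" for w
  define a where "a w = wedge (\<eta>' w) (\<eta> p) / d" for w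
  have dec: "fst (\<xi>' w) = t1 w * x1 + b w * y1" "snd (\<xi>' w) = t1 w * x2 + b w * y2"
     "fst (\<eta>' w) = a w * x1 + t2 w * y1" "snd (\<eta>' w) = a w * x2 + t2 w * y2" for w
  proof -
    have td: "t1 w * d = wedge (\<xi>' w) (\<eta> p)" "t2 w * d = wedge (\<xi> p) (\<eta>' w)"
      "b w * d = wedge (\<xi> p) (\<xi>' w)" "a w * d = wedge (\<eta>' w) (\<eta> p)"
      using d by (simp_all add: t1_def t2_def a_def b_def)
    have "(t1 w * x1 + b w * y1) * d = (t1 w * d) * x1 + (b w * d) * y1"
      "(t1 w * x2 + b w * y2) * d = (t1 w * d) * x2 + (b w * d) * y2"
      "(a w * x1 + t2 w * y1) * d = (a w * d) * x1 + (t2 w * d) * y1"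
      "(a w * x2 + t2 w * y2) * d = (a w * d) * x2 + (t2 w * d) * y2"
      by (simp_all add: algebra_simps)
    then have "(t1 w * x1 + b w * y1) * d = fst (\<xi>' w) * d"
      "(t1 w * x2 + b w * y2) * d = snd (\<xi>' w) * d"
      "(a w * x1 + t2 w * y1) * d = fst (\<eta>' w) * d"
      "(a w * x2 + t2 w * y2) * d = snd (\<eta>' w) * d"
      unfolding td unfolding wedge_def x1_def[symmetric] x2_def[symmetric] y1_def[symmetric] y2_def[symmetric] d_eq
      by (simp_all add: algebra_simps)
    then show "fst (\<xi>' w) = t1 w * x1 + b w * y1" "snd (\<xi>' w) = t1 w * x2 + b w * y2"
     "fst (\<eta>' w) = a w * x1 + t2 w * y1" "snd (\<eta>' w) = a w * x2 + t2 w * y2"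
      using d by simp_all
  qed
  define \<theta> where "\<theta> w = r * cnj (b w) + a w / r" for w
  define e where "e w = R' w / r + Re (t1 w - t2 w)" for w
  define rho where "rho w = R' w / r" for w
  have rho: "R' w = r * rho w" for w using r by (simp add: rho_def)
  have f1: "((\<lambda>x. fst (\<xi> x)) has_derivative (\<lambda>w. fst (\<xi>' w))) (at p)"
    and f2: "((\<lambda>x. snd (\<xi> x)) has_derivative (\<lambda>w. snd (\<xi>' w))) (at p)"
    and f3: "((\<lambda>x. fst (\<eta> x)) has_derivative (\<lambda>w. fst (\<eta>' w))) (at p)"
    and f4: "((\<lambda>x. snd (\<eta> x)) has_derivative (\<lambda>w. snd (\<eta>' w))) (at p)"
    using \<xi> \<eta> by (auto intro!: derivative_intros)
  define N where "N x = (R x)\<^sup>2 * fst (\<xi> x) * cnj (snd (\<xi> x)) + fst (\<eta> x) * cnj (snd (\<eta> x))" for x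
  define N' where "N' w = 2 * r * R' w * x1 * cnj x2 + r\<^sup>2 * (fst (\<xi>' w) * cnj x2 + x1 * cnj (snd (\<xi>' w)))
      + (fst (\<eta>' w) * cnj y2 + y1 * cnj (snd (\<eta>' w)))" for w
  have dN: "(N has_derivative N') (at p)"
    unfolding N_def N'_def
    by (rule f1 f2 f3 f4 R refl derivative_eq_intros)+
       (auto simp: fun_eq_iff x1_def x2_def y1_def y2_def r_def algebra_simps power2_eq_square)
  define Qf where "Qf x = geo_denom (\<xi> x) (\<eta> x) (R x)" for x
  define Q' where "Q' w = 2 * r * R' w * (cmod x2)\<^sup>2 + r\<^sup>2 * (2 * Re (cnj x2 * snd (\<xi>' w))) + 2 * Re (cnj y2 * snd (\<eta>' w))" for w
  have Qfe: "Qf x = (R x)\<^sup>2 * ((Re (snd (\<xi> x)))\<^sup>2 + (Im (snd (\<xi> x)))\<^sup>2) + ((Re (snd (\<eta> x)))\<^sup>2 + (Im (snd (\<eta> x)))\<^sup>2)" for x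
    by (simp add: Qf_def geo_denom_def cmod_power2)
  have dQ: "(Qf has_derivative Q') (at p)"
    unfolding Qfe Q'_def cmod_power2
    by (rule R refl has_derivative_Re[OF f2] has_derivative_Im[OF f2] has_derivative_Re[OF f4]
          has_derivative_Im[OF f4] derivative_eq_intros)+
       (auto simp: fun_eq_iff x2_def y2_def r_def algebra_simps power2_eq_square)
  have Qp: "Qf p = q" by (simp add: Qf_def q_def r_def)
  have dD: "((\<lambda>x. wedge (\<xi> x) (\<eta> x)) has_derivative (\<lambda>w. (t1 w + t2 w) * d)) (at p)"
    unfolding wedge_def
    by (rule f1 f2 f3 f4 refl derivative_eq_intros)+
       (auto simp: fun_eq_iff dec d_eq x1_def[symmetric] x2_def[symmetric] y1_def[symmetric] y2_def[symmetric] algebra_simps)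
  have dabs: "((\<lambda>x. cmod (wedge (\<xi> x) (\<eta> x))) has_derivative (\<lambda>w. cmod d * Re (t1 w + t2 w))) (at p)"
  proof -
    have "((\<lambda>z. cmod z) has_derivative (\<lambda>h. h \<bullet> sgn d)) (at d)"
      using d by (rule has_derivative_norm)
    from has_derivative_compose[OF dD, of cmod, folded d_def, OF this]
    show ?thesis
    proof (rule has_derivative_eq_rhs, intro ext)
      fix w
      have "((t1 w + t2 w) * d) \<bullet> sgn d = Re ((t1 w + t2 w) * (d * cnj d)) / cmod d"
        by (simp add: inner_complex_def sgn_div_norm algebra_simps add_divide_distrib divide_inverse)
      also have "d * cnj d = complex_of_real ((cmod d)\<^sup>2)" by (simp add: complex_norm_square[symmetric] del: of_real_power)
      also have "Re ((t1 w + t2 w) * complex_of_real ((cmod d)\<^sup>2)) / cmod d = cmod d * Re (t1 w + t2 w)"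
        using d by (simp add: power2_eq_square)
      finally show "((t1 w + t2 w) * d) \<bullet> sgn d = cmod d * Re (t1 w + t2 w)" .
    qed
  qed
  have z: "((\<lambda>x. N x / of_real (Qf x)) has_derivative (\<lambda>w. (N' w * of_real q - N p * of_real (Q' w)) / (of_real q)\<^sup>2)) (at p)"
    using q by (auto intro!: derivative_eq_intros dN dQ simp: Qp field_simps power2_eq_square)
  have t: "((\<lambda>x. cmod (wedge (\<xi> x) (\<eta> x)) * R x / Qf x) has_derivative
      (\<lambda>w. cmod d * r * ((Re (t1 w + t2 w) + rho w) * q - Q' w) / q\<^sup>2)) (at p)"
    using q by (auto intro!: derivative_eq_intros dabs R dQ simp: Qp rho d_def[symmetric] r_def[symmetric] field_simps power2_eq_square)
  have zeq: "(N' w * of_real q - N p * of_real (Q' w)) / (of_real q)\<^sup>2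
     = e w *\<^sub>R (2 * r\<^sup>2 * cnj (x2 * y2) * d / (complex_of_real q)\<^sup>2) + r * d * (\<theta> w * (cnj y2)\<^sup>2 - r\<^sup>2 * cnj (\<theta> w) * (cnj x2)\<^sup>2) / (complex_of_real q)\<^sup>2" for w
  proof -
    have ec: "complex_of_real (e w) = rho w + (t1 w - t2 w + cnj (t1 w - t2 w)) / 2"
      by (simp add: e_def rho_def complex_eq_iff)
    have Qc: "complex_of_real (Q' w) = 2 * r * (r * rho w) * (x2 * cnj x2)
       + r\<^sup>2 * (cnj x2 * snd (\<xi>' w) + x2 * cnj (snd (\<xi>' w))) + (cnj y2 * snd (\<eta>' w) + y2 * cnj (snd (\<eta>' w)))"
      by (simp add: Q'_def rho complex_eq_iff cmod_power2) (simp add: power2_eq_square)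
    have rt: "r * \<theta> w = r\<^sup>2 * cnj (b w) + a w" "r * cnj (\<theta> w) = r\<^sup>2 * b w + cnj (a w)"
      using r by (simp_all add: \<theta>_def field_simps power2_eq_square)
    have "N' w * of_real q - N p * of_real (Q' w) =
      of_real (e w) * (2 * r\<^sup>2 * cnj (x2 * y2) * d) + d * ((r * \<theta> w) * (cnj y2)\<^sup>2 - r\<^sup>2 * (r * cnj (\<theta> w)) * (cnj x2)\<^sup>2)"
      unfolding rt ec Qc qc unfolding N'_def N_def rho dec d_eq
        x1_def[symmetric] x2_def[symmetric] y1_def[symmetric] y2_def[symmetric] r_def[symmetric]
      by (simp add: dec) algebra
    then show ?thesis
      by (simp only:) (simp add: scaleR_conv_of_real add_divide_distrib diff_divide_distrib right_diff_distrib mult_ac)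
  qed
  have teq: "cmod d * r * ((Re (t1 w + t2 w) + rho w) * q - Q' w) / q\<^sup>2
    = e w * (cmod d * r * ((cmod y2)\<^sup>2 - r\<^sup>2 * (cmod x2)\<^sup>2) / q\<^sup>2) + (- 2 * cmod d * r\<^sup>2 * Re (\<theta> w * x2 * cnj y2) / q\<^sup>2)" for w
  proof -
    have rt: "r * Re (\<theta> w * x2 * cnj y2) = Re ((r\<^sup>2 * cnj (b w) + a w) * x2 * cnj y2)"
    proof -
      have "r * Re (\<theta> w * x2 * cnj y2) = Re ((r * \<theta> w) * x2 * cnj y2)" by (simp add: algebra_simps)
      also have "r * \<theta> w = r\<^sup>2 * cnj (b w) + a w" using r by (simp add: \<theta>_def field_simps power2_eq_square)
      finally show ?thesis .
    qed
    have ew: "e w = rho w + Re (t1 w - t2 w)" by (simp add: e_def rho_def)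
    have qe: "q = r\<^sup>2 * (cmod x2)\<^sup>2 + (cmod y2)\<^sup>2" by (simp add: q_def geo_denom_def x2_def y2_def)
    have "(Re (t1 w + t2 w) + rho w) * q - Q' w
      = e w * ((cmod y2)\<^sup>2 - r\<^sup>2 * (cmod x2)\<^sup>2) - 2 * (r * Re (\<theta> w * x2 * cnj y2))"
      unfolding rt ew Q'_def rho qe dec cmod_power2
      by (simp add: algebra_simps power2_eq_square)
    then have "cmod d * r * ((Re (t1 w + t2 w) + rho w) * q - Q' w)
      = e w * (cmod d * r * ((cmod y2)\<^sup>2 - r\<^sup>2 * (cmod x2)\<^sup>2)) + (- 2 * cmod d * r\<^sup>2 * Re (\<theta> w * x2 * cnj y2))"
      by (simp only:) (simp add: algebra_simps power2_eq_square)
    then show ?thesis by (simp add: add_divide_distrib diff_divide_distrib)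
  qed
  have "((\<lambda>x. (N x / of_real (Qf x), cmod (wedge (\<xi> x) (\<eta> x)) * R x / Qf x)) has_derivative
    (\<lambda>w. e w *\<^sub>R geo_velocity (\<xi> p) (\<eta> p) r + geo_normal (\<xi> p) (\<eta> p) r (\<theta> w))) (at p)"
    by (rule has_derivative_eq_rhs[OF has_derivative_Pair[OF z t]])
       (simp only: zeq teq geo_velocity_def geo_normal_def d_def[symmetric] q_def[symmetric] x2_def[symmetric] y2_def[symmetric]
          fun_eq_iff prod_eq_iff fst_conv snd_conv fst_add snd_add fst_scaleR snd_scaleR real_scaleR_def, simp)
  moreover have "(\<lambda>x. (N x / of_real (Qf x), cmod (wedge (\<xi> x) (\<eta> x)) * R x / Qf x)) = (\<lambda>x. geo_point (\<xi> x) (\<eta> x) (R x))"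
    by (simp add: fun_eq_iff geo_point_def N_def Qf_def)
  ultimately show ?thesis
    by (simp add: e_def \<theta>_def t1_def t2_def a_def b_def r_def d_def diff_divide_distrib)
qed

lemma inner_half_space: "(x::half_space) \<bullet> y = Re (fst x * cnj (fst y)) + snd x * snd y"
  by (simp add: inner_prod_def inner_complex_def)

lemma geo_frame_inner:
  assumes "wedge \<xi> \<eta> \<noteq> 0" "R > 0"
  shows "geo_velocity \<xi> \<eta> R \<bullet> geo_velocity \<xi> \<eta> R = (snd (geo_point \<xi> \<eta> R))\<^sup>2"
    and "geo_velocity \<xi> \<eta> R \<bullet> geo_normal \<xi> \<eta> R \<theta> = 0"
proof -
  define x y d q where "x = snd \<xi>" and "y = snd \<eta>" and "d = wedge \<xi> \<eta>" and "q = geo_denom \<xi> \<eta> R"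
  have q: "q > 0" using geo_denom_pos[OF assms] by (simp add: q_def)
  have qe: "q = R\<^sup>2 * ((Re x)\<^sup>2 + (Im x)\<^sup>2) + ((Re y)\<^sup>2 + (Im y)\<^sup>2)"
    by (simp add: q_def geo_denom_def x_def y_def cmod_power2)
  note defs = x_def[symmetric] y_def[symmetric] d_def[symmetric] q_def[symmetric]
  have vel: "geo_velocity \<xi> \<eta> R = (1 / q\<^sup>2) *\<^sub>R (2 * R\<^sup>2 * cnj (x * y) * d, cmod d * R * ((cmod y)\<^sup>2 - R\<^sup>2 * (cmod x)\<^sup>2))"
    by (simp add: geo_velocity_def defs scaleR_conv_of_real divide_inverse mult_ac)
  have perp: "geo_normal \<xi> \<eta> R \<theta> = (1 / q\<^sup>2) *\<^sub>R (R * d * (\<theta> * (cnj y)\<^sup>2 - R\<^sup>2 * cnj \<theta> * (cnj x)\<^sup>2), - 2 * cmod d * R\<^sup>2 * Re (\<theta> * x * cnj y))"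
    by (simp add: geo_normal_def defs scaleR_conv_of_real divide_inverse mult_ac)
  have t: "snd (geo_point \<xi> \<eta> R) = cmod d * R / q" by (simp add: geo_point_def defs)
  have cd: "d * cnj d = complex_of_real ((cmod d)\<^sup>2)" by (simp add: complex_norm_square[symmetric] del: of_real_power)
  have pull: "Re ((a * d) * cnj (b * d)) = (cmod d)\<^sup>2 * Re (a * cnj b)" for a b
  proof -
    have "(a * d) * cnj (b * d) = (d * cnj d) * (a * cnj b)" by (simp add: algebra_simps)
    then show ?thesis by (simp only: cd Re_complex_of_real) (simp add: mult.commute)
  qed
  have in2: "((a * d, cmod d * u) :: half_space) \<bullet> (b * d, cmod d * v) = (cmod d)\<^sup>2 * (Re (a * cnj b) + u * v)" for a b u v
    unfolding inner_half_space fst_conv snd_conv pull by (simp add: algebra_simps power2_eq_square)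
  have V: "(2 * R\<^sup>2 * cnj (x * y) * d, cmod d * R * ((cmod y)\<^sup>2 - R\<^sup>2 * (cmod x)\<^sup>2)) =
     ((2 * R\<^sup>2 * cnj (x * y)) * d, cmod d * (R * (((Re y)\<^sup>2 + (Im y)\<^sup>2) - R\<^sup>2 * ((Re x)\<^sup>2 + (Im x)\<^sup>2))))"
    by (simp add: cmod_power2)
  have P: "(R * d * (\<theta> * (cnj y)\<^sup>2 - R\<^sup>2 * cnj \<theta> * (cnj x)\<^sup>2), - 2 * cmod d * R\<^sup>2 * Re (\<theta> * x * cnj y)) =
     ((R * (\<theta> * (cnj y)\<^sup>2 - R\<^sup>2 * cnj \<theta> * (cnj x)\<^sup>2)) * d, cmod d * (- 2 * R\<^sup>2 * Re (\<theta> * x * cnj y)))"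
    by (simp add: mult_ac)
  have "Re ((2 * R\<^sup>2 * cnj (x * y)) * cnj (2 * R\<^sup>2 * cnj (x * y))) + (R * (((Re y)\<^sup>2 + (Im y)\<^sup>2) - R\<^sup>2 * ((Re x)\<^sup>2 + (Im x)\<^sup>2))) * (R * (((Re y)\<^sup>2 + (Im y)\<^sup>2) - R\<^sup>2 * ((Re x)\<^sup>2 + (Im x)\<^sup>2)))
    = R\<^sup>2 * q\<^sup>2" unfolding qe by simp algebra
  then show "geo_velocity \<xi> \<eta> R \<bullet> geo_velocity \<xi> \<eta> R = (snd (geo_point \<xi> \<eta> R))\<^sup>2"
    unfolding vel t V inner_scaleR_left inner_scaleR_right in2 using q
    by (simp add: field_simps power2_eq_square)
  have "Re ((2 * R\<^sup>2 * cnj (x * y)) * cnj (R * (\<theta> * (cnj y)\<^sup>2 - R\<^sup>2 * cnj \<theta> * (cnj x)\<^sup>2)))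
     + (R * (((Re y)\<^sup>2 + (Im y)\<^sup>2) - R\<^sup>2 * ((Re x)\<^sup>2 + (Im x)\<^sup>2))) * (- 2 * R\<^sup>2 * Re (\<theta> * x * cnj y)) = 0"
    by (simp add: Re_power2 Im_power2) algebra
  then show "geo_velocity \<xi> \<eta> R \<bullet> geo_normal \<xi> \<eta> R \<theta> = 0"
    unfolding vel perp V P inner_scaleR_left inner_scaleR_right in2 by simp
qed

lemma geo_normal_scale: "geo_normal \<xi> \<eta> R (c *\<^sub>R \<theta>) = c *\<^sub>R geo_normal \<xi> \<eta> R \<theta>"
  by (simp add: geo_normal_def algebra_simps scaleR_conv_of_real diff_divide_distrib)

section \<open>Distance from a geodesic\<close>

text \<open>The value at \<open>(- s\<^sub>2, s\<^sub>1)\<close> of the Hermitian form corresponding to the point; up to a factor this is the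
  exponential of the Busemann function of the boundary point \<open>s\<close>.\<close>

definition horo :: "complex \<times> complex \<Rightarrow> half_space \<Rightarrow> real" where
  "horo s x = ((cmod (snd s))\<^sup>2 * ((cmod (fst x))\<^sup>2 + (snd x)\<^sup>2) - 2 * Re (snd s * cnj (fst s) * fst x) + (cmod (fst s))\<^sup>2) / snd x"

lemma horo_eq_norms: "snd x \<noteq> 0 \<Longrightarrow> horo s x = ((cmod (snd s * fst x - fst s))\<^sup>2 + (cmod (snd s) * snd x)\<^sup>2) / snd x"
  by (simp add: horo_def cmod_power2 power_mult_distrib) (simp add: algebra_simps power2_eq_square)

lemma horo_pos: "x \<in> H3 \<Longrightarrow> s \<noteq> 0 \<Longrightarrow> horo s x > 0"
  by (cases "snd s = 0") (auto simp: H3_def horo_eq_norms prod_eq_iff add_nonneg_pos)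

lemma horo_geo_point:
  assumes "wedge \<xi> \<eta> \<noteq> 0" "R > 0"
  shows "horo s (geo_point \<xi> \<eta> R) = (R * (cmod (wedge s \<xi>))\<^sup>2 + (cmod (wedge s \<eta>))\<^sup>2 / R) / cmod (wedge \<xi> \<eta>)"
proof -
  define x1 x2 y1 y2 where "x1 = fst \<xi>" and "x2 = snd \<xi>" and "y1 = fst \<eta>" and "y2 = snd \<eta>"
  define d q where "d = wedge \<xi> \<eta>" and "q = geo_denom \<xi> \<eta> R"
  have q: "q > 0" using geo_denom_pos[OF assms] by (simp add: q_def)
  have qe: "q = R\<^sup>2 * (cmod x2)\<^sup>2 + (cmod y2)\<^sup>2"
    by (simp add: q_def geo_denom_def x2_def y2_def)
  have de: "d = x1 * y2 - x2 * y1" by (simp add: d_def wedge_def x1_def x2_def y1_def y2_def)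
  have d: "cmod d > 0" using assms by (simp add: d_def)
  define N where "N = (complex_of_real R)\<^sup>2 * x1 * cnj x2 + y1 * cnj y2"
  have g: "geo_point \<xi> \<eta> R = (N / q, cmod d * R / q)"
    by (simp add: geo_point_def N_def q_def d_def x1_def x2_def y1_def y2_def)
  have lag: "(cmod N)\<^sup>2 + (cmod d * R)\<^sup>2 = q * (R\<^sup>2 * (cmod x1)\<^sup>2 + (cmod y1)\<^sup>2)"
    unfolding qe N_def de power_mult_distrib cmod_power2 by simp algebra
  have "horo s (geo_point \<xi> \<eta> R) = ((cmod (snd s))\<^sup>2 * (((cmod N)\<^sup>2 + (cmod d * R)\<^sup>2) / q\<^sup>2) - 2 * Re (snd s * cnj (fst s) * N) / q + (cmod (fst s))\<^sup>2) / (cmod d * R / q)"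
    using q by (simp add: horo_def g norm_divide power_divide add_divide_distrib)
  also have "\<dots> = ((cmod (snd s))\<^sup>2 * (R\<^sup>2 * (cmod x1)\<^sup>2 + (cmod y1)\<^sup>2) - 2 * Re (snd s * cnj (fst s) * N) + (cmod (fst s))\<^sup>2 * q) / (cmod d * R)"
    unfolding lag using q d assms(2) by (simp add: field_simps power2_eq_square)
  also have "(cmod (snd s))\<^sup>2 * (R\<^sup>2 * (cmod x1)\<^sup>2 + (cmod y1)\<^sup>2) - 2 * Re (snd s * cnj (fst s) * N) + (cmod (fst s))\<^sup>2 * q
    = R\<^sup>2 * (cmod (wedge s \<xi>))\<^sup>2 + (cmod (wedge s \<eta>))\<^sup>2"
    unfolding qe N_def wedge_def x1_def[symmetric] x2_def[symmetric] y1_def[symmetric] y2_def[symmetric] cmod_power2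
    by simp algebra
  finally show ?thesis using assms(2) d by (simp add: d_def[symmetric] field_simps power2_eq_square)
qed

lemma horo_differentiable: "x \<in> H3 \<Longrightarrow> horo s differentiable (at x)"
proof -
  assume "x \<in> H3"
  then have nz: "snd x \<noteq> 0" by (simp add: H3_def)
  have "(\<lambda>x. ((cmod (snd s))\<^sup>2 * (((Re (fst x))\<^sup>2 + (Im (fst x))\<^sup>2) + (snd x)\<^sup>2) - 2 * Re (snd s * cnj (fst s) * fst x) + (cmod (fst s))\<^sup>2) / snd x) differentiable (at x)"
    using nz unfolding differentiable_def by (auto intro!: exI derivative_eq_intros)
  then show ?thesis unfolding horo_def[abs_def] cmod_power2[of "fst _"] .
qed

text \<open>Every tangent vector is the velocity of a curve obtained by moving only \<open>\<eta>\<close> and \<open>R\<close>, along which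
  \<open>horo_geo_point\<close> gives the value of the form.\<close>

lemma horo_derivative:
  assumes "wedge \<xi> \<eta> \<noteq> 0" "R > 0"
    and D: "(horo s has_derivative D) (at (geo_point \<xi> \<eta> R))"
  shows "D (e *\<^sub>R geo_velocity \<xi> \<eta> R + geo_normal \<xi> \<eta> R \<theta>) =
    (e * (R * (cmod (wedge s \<xi>))\<^sup>2 - (cmod (wedge s \<eta>))\<^sup>2 / R) + 2 * Re (\<theta> * wedge s \<xi> * cnj (wedge s \<eta>))) / cmod (wedge \<xi> \<eta>)"
proof -
  define c where "c = (complex_of_real R * \<theta> * fst \<xi>, complex_of_real R * \<theta> * snd \<xi>)"
  define H where "H u = \<eta> + u *\<^sub>R c" for u :: real
  define S where "S u = R + u * (R * e)" for u :: real
  have wH: "wedge \<xi> (H u) = wedge \<xi> \<eta>" for u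
    by (simp add: wedge_def H_def c_def scaleR_conv_of_real algebra_simps)
  have dH: "(H has_derivative (\<lambda>u. u *\<^sub>R c)) (at 0)"
    unfolding H_def by (auto intro!: derivative_eq_intros)
  have dS: "(S has_derivative (\<lambda>u. u * (R * e))) (at 0)"
    unfolding S_def by (auto intro!: derivative_eq_intros)
  have wc: "wedge (u *\<^sub>R c) \<eta> = u * (R * \<theta> * wedge \<xi> \<eta>)" "wedge \<xi> (u *\<^sub>R c) = 0" for u :: real
    by (simp_all add: wedge_def c_def scaleR_conv_of_real algebra_simps)
  have wc': "wedge (u *\<^sub>R c) \<eta> / wedge \<xi> \<eta> / complex_of_real R = u *\<^sub>R \<theta>"
    "Re (wedge \<xi> (u *\<^sub>R c)) = 0" for u
    unfolding wc using assms by (simp_all add: scaleR_conv_of_real)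
  have w0: "wedge 0 s = 0" "wedge s 0 = 0" for s by (simp_all add: wedge_def)
  have S0: "S 0 = R" "H 0 = \<eta>" by (simp_all add: S_def H_def)
  have "((\<lambda>u. geo_point \<xi> (H u) (S u)) has_derivative
     (\<lambda>u. u *\<^sub>R (e *\<^sub>R geo_velocity \<xi> \<eta> R + geo_normal \<xi> \<eta> R \<theta>))) (at 0)"
  proof (rule has_derivative_eq_rhs)
    show "((\<lambda>u. geo_point \<xi> (H u) (S u)) has_derivative
      (\<lambda>u. (u * (R * e) / R + Re ((wedge 0 \<eta> - wedge \<xi> (u *\<^sub>R c)) / wedge \<xi> \<eta>)) *\<^sub>R geo_velocity \<xi> \<eta> R
      + geo_normal \<xi> \<eta> R (R * cnj (wedge \<xi> 0 / wedge \<xi> \<eta>) + wedge (u *\<^sub>R c) \<eta> / wedge \<xi> \<eta> / R))) (at 0)"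
      using geo_point_has_derivative[OF has_derivative_const dH dS, of \<xi>] assms unfolding S0 by simp
  qed (unfold wc' wc(2) w0, use assms in \<open>simp add: geo_normal_scale scaleR_add_right\<close>)
  from has_derivative_compose[OF this, of "horo s"] D
  have 1: "((\<lambda>u. horo s (geo_point \<xi> (H u) (S u))) has_derivative
     (\<lambda>u. D (u *\<^sub>R (e *\<^sub>R geo_velocity \<xi> \<eta> R + geo_normal \<xi> \<eta> R \<theta>)))) (at 0)"
    by (simp add: S0)
  define k l where "k = wedge s \<xi>" and "l = wedge s \<eta>"
  have wl: "wedge s (H u) = l + u * (R * \<theta> * k)" for u
    by (simp add: wedge_def H_def c_def k_def l_def scaleR_conv_of_real algebra_simps)
  have "\<forall>\<^sub>F u in nhds 0. S u > 0"
    unfolding S_def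
    by (rule order_tendstoD(1)[of _ R]) (auto intro!: tendsto_eq_intros filterlim_ident simp: assms)
  then obtain U where U: "open U" "0 \<in> U" "\<And>u. u \<in> U \<Longrightarrow> S u > 0"
    unfolding eventually_nhds by blast
  have der: "((\<lambda>u. ((R + u * (R * e)) * K + (L + u * P + u\<^sup>2 * M) / (R + u * (R * e))) / W) has_real_derivative
      (R * e * K + (P - L * e) / R) / W) (at 0)" for K L P M W :: real
  proof (rule DERIV_cdivide)
    show "((\<lambda>u. (R + u * (R * e)) * K + (L + u * P + u\<^sup>2 * M) / (R + u * (R * e))) has_real_derivative
      R * e * K + (P - L * e) / R) (at 0)"
      using assms(2) by (auto intro!: derivative_eq_intros simp: field_simps power2_eq_square)
  qed
  define P where "P = 2 * R * Re (\<theta> * k * cnj l)"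
  have nl: "(cmod (wedge s (H u)))\<^sup>2 = (cmod l)\<^sup>2 + u * P + u\<^sup>2 * (cmod (R * \<theta> * k))\<^sup>2" for u
  proof -
    have n: "(cmod (a + complex_of_real u * b))\<^sup>2 = (cmod a)\<^sup>2 + u * (2 * Re (b * cnj a)) + u\<^sup>2 * (cmod b)\<^sup>2" for a b
      unfolding cmod_power2 by (simp add: algebra_simps power2_eq_square)
    have "Re (complex_of_real R * \<theta> * k * cnj l) = R * Re (\<theta> * k * cnj l)" by (simp add: algebra_simps)
    then show ?thesis using n[of l "complex_of_real R * \<theta> * k"] unfolding wl by (simp only: P_def mult.assoc mult.left_commute[of 2])
  qed
  have "((\<lambda>u. horo s (geo_point \<xi> (H u) (S u))) has_derivative
     (\<lambda>u. ((R * e * (cmod k)\<^sup>2 + (P - (cmod l)\<^sup>2 * e) / R) / cmod (wedge \<xi> \<eta>)) * u)) (at 0)"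
  proof (rule has_derivative_transform_within_open[OF _ U(1,2)])
    show "((\<lambda>u. ((R + u * (R * e)) * (cmod k)\<^sup>2 + ((cmod l)\<^sup>2 + u * P + u\<^sup>2 * (cmod (R * \<theta> * k))\<^sup>2) / (R + u * (R * e))) / cmod (wedge \<xi> \<eta>)) has_derivative
     (\<lambda>u. ((R * e * (cmod k)\<^sup>2 + (P - (cmod l)\<^sup>2 * e) / R) / cmod (wedge \<xi> \<eta>)) * u)) (at 0)"
      using der unfolding has_field_derivative_def .
    show "((R + u * (R * e)) * (cmod k)\<^sup>2 + ((cmod l)\<^sup>2 + u * P + u\<^sup>2 * (cmod (R * \<theta> * k))\<^sup>2) / (R + u * (R * e))) / cmod (wedge \<xi> \<eta>)
      = horo s (geo_point \<xi> (H u) (S u))" if "u \<in> U" for u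
    proof -
      have "horo s (geo_point \<xi> (H u) (S u)) = (S u * (cmod k)\<^sup>2 + (cmod (wedge s (H u)))\<^sup>2 / S u) / cmod (wedge \<xi> \<eta>)"
        using horo_geo_point[of \<xi> "H u" "S u" s] assms(1) U(3)[OF that] by (simp add: wH k_def)
      then show ?thesis by (simp only: nl S_def)
    qed
  qed
  from fun_cong[OF has_derivative_unique[OF 1 this], of 1]
  have "D (e *\<^sub>R geo_velocity \<xi> \<eta> R + geo_normal \<xi> \<eta> R \<theta>) = (R * e * (cmod k)\<^sup>2 + (P - (cmod l)\<^sup>2 * e) / R) / cmod (wedge \<xi> \<eta>)"
    by simp
  also have "R * e * (cmod k)\<^sup>2 + (P - (cmod l)\<^sup>2 * e) / R = e * (R * (cmod k)\<^sup>2 - (cmod l)\<^sup>2 / R) + 2 * Re (\<theta> * k * cnj l)"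
    using assms(2) by (simp add: P_def field_simps)
  finally show ?thesis by (simp add: k_def l_def)
qed

text \<open>The algebra of the product of two forms whose matrix entries in an adapted frame are built from \<open>k\<close> and \<open>l\<close>. The
  number \<open>E = l\<^sub>1 k\<^sub>2 + l\<^sub>2 k\<^sub>1\<close> vanishes if and only if the geodesic of the frame is orthogonal to the axis. The two
  lemmas that follow say that the product has no critical points except those where it takes its minimal
  value, which is attained on the axis.\<close>

lemma gradient_product_identity:
  fixes k1 k2 l1 l2 :: complex
  defines "E \<equiv> l1 * k2 + l2 * k1"
  shows "complex_of_real ((cmod k1)\<^sup>2 + (cmod k2)\<^sup>2) * (l1 * cnj l2) + complex_of_real ((cmod l1)\<^sup>2 + (cmod l2)\<^sup>2) * (k1 * cnj k2)
    = cnj E * (l1 * k1) + E * cnj (l2 * k2)"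
  unfolding of_real_add complex_norm_square E_def by (simp add: algebra_simps)

lemma critical_oblique:
  fixes k1 k2 l1 l2 :: complex
  defines "E \<equiv> l1 * k2 + l2 * k1"
  assumes "cnj E * (l1 * k1) + E * cnj (l2 * k2) = 0" "E \<noteq> 0"
  shows "((cmod k1)\<^sup>2 + (cmod k2)\<^sup>2) * ((cmod l1)\<^sup>2 + (cmod l2)\<^sup>2) = (cmod (l1 * k2 - l2 * k1))\<^sup>2"
proof -
  define a b y w where "a = l1 * k2" and "b = l2 * k1" and "y = l1 * k1" and "w = l2 * k2"
  have E: "E = a + b" by (simp add: E_def a_def b_def)
  have ab: "a * b = y * w" by (simp add: a_def b_def y_def w_def)
  have eq: "cnj E * y = - (E * cnj w)" using assms(2) by (simp add: y_def w_def add_eq_0_iff2)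
  then have "cmod (cnj E * y) = cmod (E * cnj w)" by simp
  then have yw: "cmod y = cmod w" using assms(3) by (simp add: norm_mult)
  define om where "om = (cmod w)\<^sup>2"
  have nab: "(cmod a)\<^sup>2 * (cmod b)\<^sup>2 = om\<^sup>2"
  proof -
    have "cmod a * cmod b = cmod w * cmod w" using arg_cong[OF ab, of cmod] yw by (simp add: norm_mult)
    then show ?thesis by (metis om_def power_mult_distrib power2_eq_square)
  qed
  have "cnj E * (a * b) = - (E * of_real om)"
  proof -
    have "cnj E * (a * b) = (cnj E * y) * w" by (simp add: ab)
    also have "\<dots> = - (E * (w * cnj w))" by (simp add: eq)
    finally show ?thesis by (simp only: om_def complex_norm_square)
  qed
  then have "(a * cnj a) * (b * cnj b) + (b * cnj b) * (a * cnj b) = - (a * cnj b * of_real om) - (b * cnj b) * of_real om"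
    unfolding E by (simp add: algebra_simps) algebra
  then have "of_real ((cmod a)\<^sup>2) * of_real ((cmod b)\<^sup>2) + of_real ((cmod b)\<^sup>2) * (a * cnj b) = - (a * cnj b * of_real om) - of_real ((cmod b)\<^sup>2) * of_real om"
    unfolding complex_norm_square .
  from arg_cong[OF this, of Re]
  have "(cmod a)\<^sup>2 * (cmod b)\<^sup>2 + (cmod b)\<^sup>2 * Re (a * cnj b) = - (Re (a * cnj b) * om) - (cmod b)\<^sup>2 * om"
    by simp
  then have *: "(Re (a * cnj b) + om) * ((cmod b)\<^sup>2 + om) = 0"
    unfolding nab by (simp add: algebra_simps power2_eq_square)
  have "Re (a * cnj b) = - om"
  proof (cases "(cmod b)\<^sup>2 + om = 0")
    case True
    then have "b = 0" "om = 0" by (auto simp: om_def add_nonneg_eq_0_iff)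
    then show ?thesis by simp
  next
    case False then show ?thesis using * by auto
  qed
  moreover have "(cmod (a - b))\<^sup>2 = (cmod a)\<^sup>2 + (cmod b)\<^sup>2 - 2 * Re (a * cnj b)"
    unfolding cmod_power2 by (simp add: power2_eq_square algebra_simps)
  ultimately have "(cmod (a - b))\<^sup>2 = (cmod a)\<^sup>2 + (cmod b)\<^sup>2 + (cmod y)\<^sup>2 + (cmod w)\<^sup>2"
    by (simp add: om_def yw)
  then show ?thesis by (simp add: a_def b_def y_def w_def norm_mult power_mult_distrib algebra_simps)
qed

lemma critical_perpendicular:
  fixes k1 k2 l1 l2 :: complex
  assumes E: "l1 * k2 + l2 * k1 = 0" and eq: "cmod (l1 * k1) = cmod (l2 * k2)"
  shows "((cmod k1)\<^sup>2 + (cmod k2)\<^sup>2) * ((cmod l1)\<^sup>2 + (cmod l2)\<^sup>2) = (cmod (l1 * k2 - l2 * k1))\<^sup>2"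
proof -
  define a b y w where "a = l1 * k2" and "b = l2 * k1" and "y = l1 * k1" and "w = l2 * k2"
  have b: "b = - a" using E by (simp add: a_def b_def add_eq_0_iff)
  have "cmod (a * b) = cmod (y * w)" by (simp add: a_def b_def y_def w_def mult_ac)
  then have "(cmod a)\<^sup>2 = (cmod y)\<^sup>2" using eq by (simp add: b norm_mult power2_eq_square y_def[symmetric] w_def[symmetric])
  moreover have "(cmod (a - b))\<^sup>2 = 4 * (cmod a)\<^sup>2"
  proof -
    have "a - b = 2 * a" by (simp add: b)
    then show ?thesis by (simp only: norm_mult) (simp add: power_mult_distrib)
  qed
  moreover have "(cmod b)\<^sup>2 = (cmod a)\<^sup>2" by (simp add: b)
  moreover have "(cmod w)\<^sup>2 = (cmod y)\<^sup>2" using eq by (simp add: y_def w_def)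
  ultimately have "(cmod (a - b))\<^sup>2 = (cmod a)\<^sup>2 + (cmod b)\<^sup>2 + (cmod y)\<^sup>2 + (cmod w)\<^sup>2" by simp
  then show ?thesis by (simp add: a_def b_def y_def w_def norm_mult power_mult_distrib algebra_simps)
qed

text \<open>Up to the factor \<open>|wedge \<xi>0 \<eta>0|\<^sup>2\<close> this is \<open>cosh\<^sup>2\<close> of the distance from the geodesic from \<open>\<eta>0\<close> to \<open>\<xi>0\<close>, see
  \<open>INF_hyp_dist_axis\<close>. Unlike the distance it is smooth.\<close>

definition axis_form :: "complex \<times> complex \<Rightarrow> complex \<times> complex \<Rightarrow> half_space \<Rightarrow> real" where
  "axis_form \<xi>0 \<eta>0 x = horo \<xi>0 x * horo \<eta>0 x"

text \<open>The pairing, symmetric in \<open>\<xi>\<close> and \<open>\<eta>\<close>, of the end points of a geodesic by the quadratic form with roots \<open>\<xi>0\<close>, \<open>\<eta>0\<close>.\<close>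

definition perp_form :: "complex \<times> complex \<Rightarrow> complex \<times> complex \<Rightarrow> complex \<times> complex \<Rightarrow> complex \<times> complex \<Rightarrow> complex" where
  "perp_form \<xi>0 \<eta>0 \<xi> \<eta> = wedge \<eta>0 \<xi> * wedge \<xi>0 \<eta> + wedge \<eta>0 \<eta> * wedge \<xi>0 \<xi>"

lemma axis_form_differentiable: "x \<in> H3 \<Longrightarrow> axis_form \<xi>0 \<eta>0 differentiable (at x)"
  unfolding axis_form_def[abs_def] by (intro differentiable_mult horo_differentiable)

text \<open>The factors \<open>sqrt R\<close> turn \<open>R\<close> into 1 by rescaling the frame.\<close>

context
  fixes \<xi>0 \<eta>0 \<xi> \<eta> :: "complex \<times> complex" and R :: real and D :: "half_space \<Rightarrow> real"
  assumes W: "wedge \<xi> \<eta> \<noteq> 0" and R: "R > 0"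
    and D: "(axis_form \<xi>0 \<eta>0 has_derivative D) (at (geo_point \<xi> \<eta> R))"
begin

abbreviation (input) "k1 \<equiv> sqrt R * wedge \<xi>0 \<xi>"
abbreviation (input) "k2 \<equiv> wedge \<xi>0 \<eta> / sqrt R"
abbreviation (input) "l1 \<equiv> sqrt R * wedge \<eta>0 \<xi>"
abbreviation (input) "l2 \<equiv> wedge \<eta>0 \<eta> / sqrt R"

lemma scaled_norms:
  "(cmod k1)\<^sup>2 = R * (cmod (wedge \<xi>0 \<xi>))\<^sup>2" "(cmod k2)\<^sup>2 = (cmod (wedge \<xi>0 \<eta>))\<^sup>2 / R"
  "(cmod l1)\<^sup>2 = R * (cmod (wedge \<eta>0 \<xi>))\<^sup>2" "(cmod l2)\<^sup>2 = (cmod (wedge \<eta>0 \<eta>))\<^sup>2 / R"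
  using R by (simp_all add: norm_mult norm_divide power_mult_distrib power_divide)

lemma scaled_products:
  "k1 * cnj k2 = wedge \<xi>0 \<xi> * cnj (wedge \<xi>0 \<eta>)" "l1 * cnj l2 = wedge \<eta>0 \<xi> * cnj (wedge \<eta>0 \<eta>)"
  "l1 * k2 + l2 * k1 = perp_form \<xi>0 \<eta>0 \<xi> \<eta>" "l1 * k2 - l2 * k1 = - (wedge \<xi>0 \<eta>0 * wedge \<xi> \<eta>)"
  using R by (simp_all add: perp_form_def) (simp add: wedge_def algebra_simps)

lemma axis_form_geo_point:
  "axis_form \<xi>0 \<eta>0 (geo_point \<xi> \<eta> R) = ((cmod k1)\<^sup>2 + (cmod k2)\<^sup>2) * ((cmod l1)\<^sup>2 + (cmod l2)\<^sup>2) / (cmod (wedge \<xi> \<eta>))\<^sup>2"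
  unfolding axis_form_def horo_geo_point[OF W R] scaled_norms by (simp add: power2_eq_square)

lemma axis_form_derivative:
  "D (e *\<^sub>R geo_velocity \<xi> \<eta> R + geo_normal \<xi> \<eta> R \<theta>) = 2 * (e * ((cmod (l1 * k1))\<^sup>2 - (cmod (l2 * k2))\<^sup>2)
     + Re (\<theta> * (cnj (perp_form \<xi>0 \<eta>0 \<xi> \<eta>) * (l1 * k1) + perp_form \<xi>0 \<eta>0 \<xi> \<eta> * cnj (l2 * k2)))) / (cmod (wedge \<xi> \<eta>))\<^sup>2"
proof -
  define \<nu> where "\<nu> = e *\<^sub>R geo_velocity \<xi> \<eta> R + geo_normal \<xi> \<eta> R \<theta>"
  obtain D1 D2 where D1: "(horo \<xi>0 has_derivative D1) (at (geo_point \<xi> \<eta> R))" and D2: "(horo \<eta>0 has_derivative D2) (at (geo_point \<xi> \<eta> R))"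
    using horo_differentiable geo_point_in_H3[OF W R] unfolding differentiable_def by blast
  have gen: "a / w * (b' / w) + b / w * (a' / w) = (a * b' + a' * b) / w\<^sup>2" for a b a' b' w :: real
    by (simp add: power2_eq_square add_divide_distrib mult_ac)
  have "D = (\<lambda>\<nu>. horo \<xi>0 (geo_point \<xi> \<eta> R) * D2 \<nu> + D1 \<nu> * horo \<eta>0 (geo_point \<xi> \<eta> R))"
    by (rule has_derivative_unique[OF D]) (unfold axis_form_def[abs_def], rule has_derivative_mult[OF D1 D2])
  then have "D \<nu> = horo \<xi>0 (geo_point \<xi> \<eta> R) * D2 \<nu> + D1 \<nu> * horo \<eta>0 (geo_point \<xi> \<eta> R)" by simp
  also have "\<dots> = (((cmod k1)\<^sup>2 + (cmod k2)\<^sup>2) * (e * ((cmod l1)\<^sup>2 - (cmod l2)\<^sup>2) + 2 * Re (\<theta> * (l1 * cnj l2)))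
     + ((cmod l1)\<^sup>2 + (cmod l2)\<^sup>2) * (e * ((cmod k1)\<^sup>2 - (cmod k2)\<^sup>2) + 2 * Re (\<theta> * (k1 * cnj k2)))) / (cmod (wedge \<xi> \<eta>))\<^sup>2"
    unfolding \<nu>_def horo_derivative[OF W R D1] horo_derivative[OF W R D2] horo_geo_point[OF W R] scaled_norms scaled_products
    by (simp only: gen mult.assoc)
  also have "((cmod k1)\<^sup>2 + (cmod k2)\<^sup>2) * (e * ((cmod l1)\<^sup>2 - (cmod l2)\<^sup>2) + 2 * Re (\<theta> * (l1 * cnj l2)))
     + ((cmod l1)\<^sup>2 + (cmod l2)\<^sup>2) * (e * ((cmod k1)\<^sup>2 - (cmod k2)\<^sup>2) + 2 * Re (\<theta> * (k1 * cnj k2)))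
     = 2 * e * ((cmod l1 * cmod k1)\<^sup>2 - (cmod l2 * cmod k2)\<^sup>2) +
      2 * Re (\<theta> * (complex_of_real ((cmod k1)\<^sup>2 + (cmod k2)\<^sup>2) * (l1 * cnj l2) + complex_of_real ((cmod l1)\<^sup>2 + (cmod l2)\<^sup>2) * (k1 * cnj k2)))"
  proof -
    have "Re (\<theta> * (complex_of_real u * a + complex_of_real v * b)) = u * Re (\<theta> * a) + v * Re (\<theta> * b)" for u v a b
      by (simp add: algebra_simps)
    then show ?thesis by (simp only:) (simp add: algebra_simps power2_eq_square)
  qed
  also have "\<dots> = 2 * (e * ((cmod (l1 * k1))\<^sup>2 - (cmod (l2 * k2))\<^sup>2)
     + Re (\<theta> * (cnj (perp_form \<xi>0 \<eta>0 \<xi> \<eta>) * (l1 * k1) + perp_form \<xi>0 \<eta>0 \<xi> \<eta> * cnj (l2 * k2))))"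
    unfolding gradient_product_identity scaled_products(3) norm_mult[of l1 k1, symmetric] norm_mult[of l2 k2, symmetric] by (simp only: distrib_left mult.assoc)
  finally show ?thesis by (simp add: \<nu>_def)
qed

lemma axis_form_perp_imp:
  "perp_form \<xi>0 \<eta>0 \<xi> \<eta> = 0 \<Longrightarrow> D (geo_normal \<xi> \<eta> R \<theta>) = 0"
  using axis_form_derivative[of 0 \<theta>] by simp

lemma axis_form_critical:
  assumes "\<And>\<theta>. D (geo_normal \<xi> \<eta> R \<theta>) = 0"
  shows "perp_form \<xi>0 \<eta>0 \<xi> \<eta> = 0 \<or> axis_form \<xi>0 \<eta>0 (geo_point \<xi> \<eta> R) = (cmod (wedge \<xi>0 \<eta>0))\<^sup>2"
proof (cases "perp_form \<xi>0 \<eta>0 \<xi> \<eta> = 0")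
  case E: False
  define X where "X = cnj (perp_form \<xi>0 \<eta>0 \<xi> \<eta>) * (l1 * k1) + perp_form \<xi>0 \<eta>0 \<xi> \<eta> * cnj (l2 * k2)"
  have "Re (cnj X * X) = 0"
    using assms[of "cnj X"] axis_form_derivative[of 0 "cnj X"] W by (simp add: X_def)
  then have "X = 0" by (simp add: complex_eq_iff)
  then have "((cmod k1)\<^sup>2 + (cmod k2)\<^sup>2) * ((cmod l1)\<^sup>2 + (cmod l2)\<^sup>2) = (cmod (l1 * k2 - l2 * k1))\<^sup>2"
    using E unfolding X_def scaled_products(3)[symmetric] by (rule critical_oblique)
  then show ?thesis
    unfolding axis_form_geo_point scaled_products(4) using W by (simp add: norm_mult power_mult_distrib)
qed simp

lemma axis_form_critical_vel:
  assumes E: "perp_form \<xi>0 \<eta>0 \<xi> \<eta> = 0" and "D (geo_velocity \<xi> \<eta> R) = 0"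
  shows "axis_form \<xi>0 \<eta>0 (geo_point \<xi> \<eta> R) = (cmod (wedge \<xi>0 \<eta>0))\<^sup>2"
proof -
  have g0: "geo_normal \<xi> \<eta> R 0 = 0" by (simp add: geo_normal_def zero_prod_def)
  have "(cmod (l1 * k1))\<^sup>2 = (cmod (l2 * k2))\<^sup>2"
    using assms(2) axis_form_derivative[of 1 0] W by (simp add: g0)
  then have "cmod (l1 * k1) = cmod (l2 * k2)" by (simp only: power2_eq_iff_nonneg norm_ge_zero)
  with E have "((cmod k1)\<^sup>2 + (cmod k2)\<^sup>2) * ((cmod l1)\<^sup>2 + (cmod l2)\<^sup>2) = (cmod (l1 * k2 - l2 * k1))\<^sup>2"
    unfolding scaled_products(3)[symmetric] by (rule critical_perpendicular)
  then show ?thesis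
    unfolding axis_form_geo_point scaled_products(4) using W by (simp add: norm_mult power_mult_distrib)
qed

end

lemma hyp_dist_geo_point:
  assumes W: "wedge \<xi> \<eta> \<noteq> 0" and R: "R > 0" and x: "x \<in> H3"
  shows "hyp_dist x (geo_point \<xi> \<eta> R) = arcosh ((R * horo \<xi> x + horo \<eta> x / R) / (2 * cmod (wedge \<xi> \<eta>)))"
proof -
  define x1 x2 y1 y2 where "x1 = fst \<xi>" and "x2 = snd \<xi>" and "y1 = fst \<eta>" and "y2 = snd \<eta>"
  define d q where "d = wedge \<xi> \<eta>" and "q = geo_denom \<xi> \<eta> R"
  have q: "q > 0" using geo_denom_pos[OF assms(1,2)] by (simp add: q_def)
  have qe: "q = R\<^sup>2 * (cmod x2)\<^sup>2 + (cmod y2)\<^sup>2"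
    by (simp add: q_def geo_denom_def x2_def y2_def)
  have de: "d = x1 * y2 - x2 * y1" by (simp add: d_def wedge_def x1_def x2_def y1_def y2_def)
  have d: "cmod d > 0" using assms by (simp add: d_def)
  define N where "N = (complex_of_real R)\<^sup>2 * x1 * cnj x2 + y1 * cnj y2"
  have g: "geo_point \<xi> \<eta> R = (N / q, cmod d * R / q)"
    by (simp add: geo_point_def N_def q_def d_def x1_def x2_def y1_def y2_def)
  have lag: "(cmod N)\<^sup>2 + (cmod d * R)\<^sup>2 = q * (R\<^sup>2 * (cmod x1)\<^sup>2 + (cmod y1)\<^sup>2)"
    unfolding qe N_def de power_mult_distrib cmod_power2 by simp algebra
  obtain z t where xz: "x = (z, t)" by (cases x)
  have t: "t > 0" using x by (simp add: H3_def xz)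
  have "q\<^sup>2 * (dist x (geo_point \<xi> \<eta> R))\<^sup>2 = (cmod (q * z - N))\<^sup>2 + (q * t - cmod d * R)\<^sup>2"
  proof -
    have "q\<^sup>2 * (dist x (geo_point \<xi> \<eta> R))\<^sup>2 = q\<^sup>2 * ((cmod (z - N / q))\<^sup>2 + (t - cmod d * R / q)\<^sup>2)"
      unfolding g xz dist_Pair_Pair by (simp add: dist_norm power2_commute)
    also have "\<dots> = (cmod (q * (z - N / q)))\<^sup>2 + (q * (t - cmod d * R / q))\<^sup>2"
      using q by (simp add: norm_mult power_mult_distrib distrib_left)
    also have "complex_of_real q * (z - N / q) = q * z - N" using q by (simp add: right_diff_distrib)
    also have "q * (t - cmod d * R / q) = q * t - cmod d * R" using q by (simp add: right_diff_distrib)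
    finally show ?thesis .
  qed
  also have "\<dots> = q\<^sup>2 * ((cmod z)\<^sup>2 + t\<^sup>2) - 2 * q * Re (cnj z * N) + ((cmod N)\<^sup>2 + (cmod d * R)\<^sup>2) - 2 * q * t * (cmod d * R)"
    by (simp add: cmod_power2) (simp add: algebra_simps power2_eq_square)
  also have "\<dots> = q * (q * ((cmod z)\<^sup>2 + t\<^sup>2) - 2 * Re (cnj z * N) + (R\<^sup>2 * (cmod x1)\<^sup>2 + (cmod y1)\<^sup>2) - 2 * t * (cmod d * R))"
    unfolding lag by (simp add: algebra_simps power2_eq_square)
  finally have "q * (dist x (geo_point \<xi> \<eta> R))\<^sup>2 = q * ((cmod z)\<^sup>2 + t\<^sup>2) - 2 * Re (cnj z * N) + (R\<^sup>2 * (cmod x1)\<^sup>2 + (cmod y1)\<^sup>2) - 2 * t * (cmod d * R)"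
    using q by (simp add: power2_eq_square)
  then have "(dist x (geo_point \<xi> \<eta> R))\<^sup>2 + 2 * t * (cmod d * R) / q =
     (q * ((cmod z)\<^sup>2 + t\<^sup>2) - 2 * Re (cnj z * N) + (R\<^sup>2 * (cmod x1)\<^sup>2 + (cmod y1)\<^sup>2)) / q"
    using q by (simp add: field_simps)
  also have "q * ((cmod z)\<^sup>2 + t\<^sup>2) - 2 * Re (cnj z * N) + (R\<^sup>2 * (cmod x1)\<^sup>2 + (cmod y1)\<^sup>2) = t * (R\<^sup>2 * horo \<xi> x + horo \<eta> x)"
  proof -
    have "t * horo s x = (cmod (snd s))\<^sup>2 * ((cmod z)\<^sup>2 + t\<^sup>2) - 2 * Re (snd s * cnj (fst s) * z) + (cmod (fst s))\<^sup>2" for s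
      using t by (simp add: horo_def xz)
    then have "t * (R\<^sup>2 * horo \<xi> x + horo \<eta> x) = R\<^sup>2 * ((cmod x2)\<^sup>2 * ((cmod z)\<^sup>2 + t\<^sup>2) - 2 * Re (x2 * cnj x1 * z) + (cmod x1)\<^sup>2)
       + ((cmod y2)\<^sup>2 * ((cmod z)\<^sup>2 + t\<^sup>2) - 2 * Re (y2 * cnj y1 * z) + (cmod y1)\<^sup>2)"
      by (simp add: distrib_left x1_def x2_def y1_def y2_def mult.left_commute[of t])
    also have "\<dots> = q * ((cmod z)\<^sup>2 + t\<^sup>2) - 2 * Re (cnj z * N) + (R\<^sup>2 * (cmod x1)\<^sup>2 + (cmod y1)\<^sup>2)"
    proof -
      have "Re (cnj z * N) = R\<^sup>2 * Re (x2 * cnj x1 * z) + Re (y2 * cnj y1 * z)"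
        by (simp add: N_def algebra_simps flip: of_real_power)
      then show ?thesis by (simp add: qe algebra_simps)
    qed
    finally show ?thesis ..
  qed
  finally have "1 + (dist x (geo_point \<xi> \<eta> R))\<^sup>2 / (2 * t * (cmod d * R / q)) = (R * horo \<xi> x + horo \<eta> x / R) / (2 * cmod d)"
    using q t d R by (simp add: field_simps power2_eq_square)
  then show ?thesis by (simp add: hyp_dist_def xz g d_def)
qed

text \<open>Along the geodesic, \<open>cosh\<close> of the distance from \<open>x\<close> is half of \<open>R u + v / R\<close> up to a constant; its minimum is the
  geometric mean of \<open>u\<close> and \<open>v\<close>.\<close>

lemma INF_hyp_dist_axis:
  assumes W: "wedge \<xi> \<eta> \<noteq> 0" and x: "x \<in> H3"
  defines "d \<equiv> INF y \<in> {geo_point \<xi> \<eta> R |R. R > 0}. hyp_dist x y"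
  shows "d \<ge> 0" "cosh d = sqrt (axis_form \<xi> \<eta> x) / cmod (wedge \<xi> \<eta>)"
proof -
  define u v where "u = horo \<xi> x" and "v = horo \<eta> x"
  have "\<xi> \<noteq> 0" "\<eta> \<noteq> 0" using W by (auto simp: wedge_def zero_prod_def)
  then have uv: "u > 0" "v > 0" using horo_pos[OF x] by (auto simp: u_def v_def)
  define c where "c R = (R * u + v / R) / (2 * cmod (wedge \<xi> \<eta>))" for R
  define m where "m = sqrt (axis_form \<xi> \<eta> x) / cmod (wedge \<xi> \<eta>)"
  have hd: "hyp_dist x (geo_point \<xi> \<eta> R) = arcosh (c R)" if "R > 0" for R
    using hyp_dist_geo_point[OF W that x] by (simp add: c_def u_def v_def)
  have ge: "c R \<ge> m" if "R > 0" for R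
  proof -
    have "sqrt ((R * u) * (v / R)) \<le> (R * u + v / R) / 2"
      using uv that by (intro arith_geo_mean_sqrt) auto
    then show ?thesis using that W by (simp add: c_def m_def axis_form_def u_def[symmetric] v_def[symmetric] field_simps)
  qed
  define R0 where "R0 = sqrt (v / u)"
  have R0: "R0 > 0" using uv by (simp add: R0_def)
  have "R0 * u = sqrt (u * v)"
  proof -
    have "R0 * u = sqrt (v / u) * sqrt (u * u)" using uv by (simp add: R0_def)
    also have "\<dots> = sqrt (u * v)" by (simp only: real_sqrt_mult[symmetric]) (use uv in \<open>simp add: field_simps\<close>)
    finally show ?thesis .
  qed
  moreover have "v / R0 = sqrt (u * v)"
  proof -
    have "v / R0 = sqrt (v * v) / sqrt (v / u)" using uv by (simp add: R0_def)
    also have "\<dots> = sqrt (u * v)" by (simp only: real_sqrt_divide[symmetric]) (use uv in \<open>simp add: field_simps\<close>)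
    finally show ?thesis .
  qed
  ultimately have cR0: "c R0 = m"
    by (simp add: c_def m_def axis_form_def u_def[symmetric] v_def[symmetric])
  have m1: "m \<ge> 1"
  proof -
    have tx: "snd x > 0" using x by (simp add: H3_def)
    have "(cmod (wedge \<xi> \<eta>))\<^sup>2 \<le> u * v"
    proof -
      obtain z t where xz: "x = (z, t)" by (cases x)
      have t: "t > 0" using tx by (simp add: xz)
      define a b e f where "a = snd \<xi> * z - fst \<xi>" and "b = snd \<eta> * z - fst \<eta>" and "e = snd \<xi> * t" and "f = snd \<eta> * t"
      have u: "u * t = (cmod a)\<^sup>2 + (cmod e)\<^sup>2" and v: "v * t = (cmod b)\<^sup>2 + (cmod f)\<^sup>2"
        using t by (simp_all add: u_def v_def horo_eq_norms xz a_def b_def e_def f_def norm_mult)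
      have "b * e - a * f = t * wedge \<xi> \<eta>"
        by (simp add: a_def b_def e_def f_def wedge_def algebra_simps)
      then have "t\<^sup>2 * (cmod (wedge \<xi> \<eta>))\<^sup>2 = (cmod (b * e - a * f))\<^sup>2"
        by (simp add: norm_mult power_mult_distrib)
      also have "\<dots> \<le> ((cmod a)\<^sup>2 + (cmod e)\<^sup>2) * ((cmod b)\<^sup>2 + (cmod f)\<^sup>2)"
      proof -
        have "((cmod a)\<^sup>2 + (cmod e)\<^sup>2) * ((cmod b)\<^sup>2 + (cmod f)\<^sup>2) = (cmod (b * e - a * f))\<^sup>2 + (cmod (a * cnj b + e * cnj f))\<^sup>2"
          unfolding cmod_power2 by simp algebra
        then show ?thesis by simp
      qed
      also have "\<dots> = t\<^sup>2 * (u * v)" unfolding u[symmetric] v[symmetric] by (simp add: power2_eq_square)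
      finally show ?thesis using t by simp
    qed
    then have "cmod (wedge \<xi> \<eta>) \<le> sqrt (u * v)" by (rule real_le_rsqrt)
    then show ?thesis using W by (simp add: m_def axis_form_def u_def v_def)
  qed
  have "d = arcosh m"
    unfolding d_def
  proof (rule cInf_eq_minimum)
    show "arcosh m \<in> hyp_dist x ` {geo_point \<xi> \<eta> R |R. 0 < R}"
      using hd[OF R0] cR0 R0 by (metis (mono_tags, lifting) imageI mem_Collect_eq)
    show "arcosh m \<le> y" if "y \<in> hyp_dist x ` {geo_point \<xi> \<eta> R |R. 0 < R}" for y
    proof -
      from that obtain R where R: "R > 0" "y = arcosh (c R)" using hd by auto
      have "\<not> arcosh (c R) < arcosh m" using ge[OF R(1)] m1 by simp
      then show ?thesis using R by simp
    qed
  qed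
  then show "d \<ge> 0" "cosh d = sqrt (axis_form \<xi> \<eta> x) / cmod (wedge \<xi> \<eta>)"
    using m1 by (simp_all add: m_def[symmetric])
qed

lemma equidistant_tube_axis_form:
  assumes W: "wedge \<xi> \<eta> \<noteq> 0" and l: "fst ` l = {geo_point \<xi> \<eta> R |R. R > 0}" and "\<rho> > 0"
  shows "equidistant_tube l \<rho> = {x \<in> H3. axis_form \<xi> \<eta> x = (cosh \<rho> * cmod (wedge \<xi> \<eta>))\<^sup>2}"
proof -
  have "(INF y \<in> fst ` l. hyp_dist x y) = \<rho> \<longleftrightarrow> axis_form \<xi> \<eta> x = (cosh \<rho> * cmod (wedge \<xi> \<eta>))\<^sup>2" if x: "x \<in> H3" for x
  proof -
    define d where "d = (INF y \<in> fst ` l. hyp_dist x y)"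
    have d: "d \<ge> 0" "cosh d = sqrt (axis_form \<xi> \<eta> x) / cmod (wedge \<xi> \<eta>)"
      using INF_hyp_dist_axis[OF W x] by (simp_all add: d_def l)
    have "\<xi> \<noteq> 0" "\<eta> \<noteq> 0" using W by (auto simp: wedge_def zero_prod_def)
    then have ax: "axis_form \<xi> \<eta> x \<ge> 0" using horo_pos[OF x] by (simp add: axis_form_def less_imp_le)
    have "d = \<rho> \<longleftrightarrow> cosh d = cosh \<rho>" using d(1) \<open>\<rho> > 0\<close> arcosh_cosh_real by (metis less_imp_le)
    also have "\<dots> \<longleftrightarrow> sqrt (axis_form \<xi> \<eta> x) = cosh \<rho> * cmod (wedge \<xi> \<eta>)"
      unfolding d(2) using W by (simp add: field_simps)
    also have "\<dots> \<longleftrightarrow> axis_form \<xi> \<eta> x = (cosh \<rho> * cmod (wedge \<xi> \<eta>))\<^sup>2"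
    proof -
      have "cosh \<rho> * cmod (wedge \<xi> \<eta>) \<ge> 0" by simp
      then show ?thesis using ax real_sqrt_pow2 real_sqrt_abs abs_of_nonneg by metis
    qed
    finally show ?thesis by (simp add: d_def)
  qed
  then show ?thesis by (auto simp: equidistant_tube_def)
qed

section \<open>The two charts\<close>

definition chart_of :: "bool \<Rightarrow> coords \<Rightarrow> oriented_geodesic" where
  "chart_of b = (if b then chart else chart')"

definition end_spinor :: "bool \<Rightarrow> coords \<Rightarrow> complex \<times> complex" where
  "end_spinor b \<mu> = (if b then (1, cnj (snd \<mu>)) else (cnj (snd \<mu>), 1))"

definition begin_spinor :: "bool \<Rightarrow> coords \<Rightarrow> complex \<times> complex" where
  "begin_spinor b \<mu> = (if b then (- fst \<mu>, 1) else (- 1, fst \<mu>))"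

lemma wedge_spinor: "wedge (end_spinor b \<mu>) (begin_spinor b \<mu>) = 1 + fst \<mu> * cnj (snd \<mu>)"
  by (simp add: wedge_def end_spinor_def begin_spinor_def)

lemma wedge_spinor_nonzero: "\<mu> \<in> coord_domain \<Longrightarrow> wedge (end_spinor b \<mu>) (begin_spinor b \<mu>) \<noteq> 0"
  by (simp add: wedge_spinor coord_domain_def)

lemma geodesic_geo_point:
  assumes "\<mu> \<in> coord_domain"
  shows "geodesic \<mu> r = geo_point (end_spinor True \<mu>) (begin_spinor True \<mu>) ((if snd \<mu> = 0 then 1 else 1 / cmod (snd \<mu>)) * exp r)"
proof (cases "snd \<mu> = 0")
  case True
  then show ?thesis by (simp add: geodesic_def geo_point_def geo_denom_def end_spinor_def begin_spinor_def wedge_def)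
next
  case False
  define A B u where "A = fst \<mu>" and "B = cnj (snd \<mu>)" and "u = exp r"
  have B: "B \<noteq> 0" "snd \<mu> = cnj B" "cmod (snd \<mu>) = cmod B" using False by (auto simp: B_def)
  have u: "u > 0" "exp (- r) = 1 / u" by (simp_all add: u_def exp_minus inverse_eq_divide)
  have u2: "u\<^sup>2 + 1 > 0" by (simp add: add_nonneg_pos)
  have th: "tanh r = (u\<^sup>2 - 1) / (u\<^sup>2 + 1)"
    unfolding tanh_def sinh_field_def cosh_field_def u_def[symmetric] u(2) using u(1) u2
    by (simp add: divide_simps power2_eq_square)
  have ch: "cosh r = (u\<^sup>2 + 1) / (2 * u)"
    unfolding cosh_field_def u_def[symmetric] u(2) using u(1) by (simp add: field_simps power2_eq_square)
  have q: "geo_denom (end_spinor True \<mu>) (begin_spinor True \<mu>) (1 / cmod B * u) = u\<^sup>2 + 1"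
    using B by (simp add: geo_denom_def end_spinor_def begin_spinor_def power_mult_distrib power_divide)
  have BB: "B * cnj B = complex_of_real ((cmod B)\<^sup>2)" by (simp add: complex_norm_square[symmetric] del: of_real_power)
  have cB: "cnj B / (complex_of_real (cmod B))\<^sup>2 = 1 / B"
    using B(1) BB by (simp add: field_simps)
  have u2c: "(complex_of_real u)\<^sup>2 + 1 \<noteq> 0" using u2 by (metis of_real_1 of_real_add of_real_power of_real_eq_0_iff less_irrefl)
  have u2d: "2 + 2 * (complex_of_real u)\<^sup>2 \<noteq> 0"
  proof
    assume "2 + 2 * (complex_of_real u)\<^sup>2 = 0"
    then have "2 * ((complex_of_real u)\<^sup>2 + 1) = 0" by (simp only: distrib_left) (simp add: add.commute)
    then show False using u2c by (simp only: mult_eq_0_iff) simp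
  qed
  have "(1 - A * B) / (2 * B) + (1 + A * B) / (2 * B) * complex_of_real (tanh r) = ((complex_of_real u)\<^sup>2 * (1 / B) - A) / (u\<^sup>2 + 1)"
    unfolding th using B(1) u2c u2d by (simp add: divide_simps) (simp add: algebra_simps)
  also have "(complex_of_real u)\<^sup>2 * (1 / B) = (complex_of_real (1 / cmod B * u))\<^sup>2 * cnj B"
    unfolding cB[symmetric] by (simp add: power_mult_distrib power_divide)
  finally have z: "(1 - A * B) / (2 * B) + (1 + A * B) / (2 * B) * complex_of_real (tanh r) =
    ((complex_of_real (1 / cmod B * u))\<^sup>2 * cnj B - A) / complex_of_real (u\<^sup>2 + 1)" by simp
  have cn: "cmod (1 + cnj A * cnj B) = cmod (1 + A * B)"
    by (metis complex_cnj_add complex_cnj_mult complex_cnj_one complex_mod_cnj)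
  have t: "cmod (1 + cnj A * cnj B) / (2 * cmod B * cosh r) = cmod (1 + A * B) * (1 / cmod B * u) / (u\<^sup>2 + 1)"
  proof -
    have "W / (2 * a * (K / (2 * u))) = W * (1 / a * u) / K" if "a \<noteq> 0" "K > 0" for W a K :: real
      using that u(1) by (simp add: field_simps)
    then show ?thesis unfolding ch cn using B(1) u2 by simp
  qed
  have "geodesic \<mu> r = ((1 - A * B) / (2 * B) + (1 + A * B) / (2 * B) * complex_of_real (tanh r), cmod (1 + cnj A * cnj B) / (2 * cmod B * cosh r))"
    using False by (simp add: geodesic_def Let_def A_def B_def)
  also have "\<dots> = geo_point (end_spinor True \<mu>) (begin_spinor True \<mu>) (1 / cmod B * u)"
    unfolding z t geo_point_def q wedge_spinor A_def[symmetric] B_def[symmetric]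
    by (simp add: end_spinor_def begin_spinor_def A_def[symmetric] B_def[symmetric])
  finally show ?thesis using False by (simp add: B_def u_def)
qed

lemma geodesic'_geo_point:
  assumes "\<nu> \<in> coord_domain"
  shows "geodesic' \<nu> r = geo_point (end_spinor False \<nu>) (begin_spinor False \<nu>) ((if fst \<nu> = 0 then 1 else cmod (fst \<nu>)) * exp r)"
proof (cases "fst \<nu> = 0")
  case True
  then show ?thesis by (simp add: geodesic'_def geo_point_def geo_denom_def end_spinor_def begin_spinor_def wedge_def exp_minus power2_eq_square field_simps)
next
  case False
  define A B u where "A = fst \<nu>" and "B = cnj (snd \<nu>)" and "u = exp r"
  have A: "A \<noteq> 0" using False by (auto simp: A_def)
  have B: "snd \<nu> = cnj B" by (simp add: B_def)
  have u: "u > 0" "exp (- r) = 1 / u" by (simp_all add: u_def exp_minus inverse_eq_divide)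
  have u2: "u\<^sup>2 + 1 > 0" by (simp add: add_nonneg_pos)
  have th: "tanh r = (u\<^sup>2 - 1) / (u\<^sup>2 + 1)"
    unfolding tanh_def sinh_field_def cosh_field_def u_def[symmetric] u(2) using u(1) u2
    by (simp add: divide_simps power2_eq_square)
  have ch: "cosh r = (u\<^sup>2 + 1) / (2 * u)"
    unfolding cosh_field_def u_def[symmetric] u(2) using u(1) by (simp add: field_simps power2_eq_square)
  have q: "geo_denom (end_spinor False \<nu>) (begin_spinor False \<nu>) (cmod A * u) = (cmod A)\<^sup>2 * (u\<^sup>2 + 1)"
    by (simp add: geo_denom_def end_spinor_def begin_spinor_def power_mult_distrib A_def algebra_simps)
  have AA: "complex_of_real ((cmod A)\<^sup>2) = A * cnj A" by (rule complex_norm_square)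
  have u2c: "(complex_of_real u)\<^sup>2 + 1 \<noteq> 0" using u2 by (metis of_real_1 of_real_add of_real_power of_real_eq_0_iff less_irrefl)
  have u2d: "2 + 2 * (complex_of_real u)\<^sup>2 \<noteq> 0"
  proof
    assume "2 + 2 * (complex_of_real u)\<^sup>2 = 0"
    then have "2 * ((complex_of_real u)\<^sup>2 + 1) = 0" by (simp only: distrib_left) (simp add: add.commute)
    then show False using u2c by (simp only: mult_eq_0_iff) simp
  qed
  have "(A * B - 1) / (2 * A) + (1 + A * B) / (2 * A) * complex_of_real (tanh r) = ((complex_of_real u)\<^sup>2 * B - 1 / A) / (u\<^sup>2 + 1)"
    unfolding th using A u2c u2d by (simp add: divide_simps) (simp add: algebra_simps)
  also have "\<dots> = ((complex_of_real (cmod A * u))\<^sup>2 * B - cnj A) / complex_of_real ((cmod A)\<^sup>2 * (u\<^sup>2 + 1))"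
  proof -
    have "(complex_of_real (cmod A * u))\<^sup>2 * B - cnj A = complex_of_real ((cmod A)\<^sup>2) * ((complex_of_real u)\<^sup>2 * B - 1 / A)"
      using A AA by (simp add: power_mult_distrib right_diff_distrib)
    then show ?thesis using A by (simp del: of_real_power)
  qed
  finally have z: "(A * B - 1) / (2 * A) + (1 + A * B) / (2 * A) * complex_of_real (tanh r) =
    ((complex_of_real (cmod A * u))\<^sup>2 * B - cnj A) / complex_of_real ((cmod A)\<^sup>2 * (u\<^sup>2 + 1))" .
  have "cmod (1 + cnj A * cnj B) = cmod (1 + A * B)"
    by (metis complex_cnj_add complex_cnj_mult complex_cnj_one complex_mod_cnj)
  then have t: "cmod (1 + cnj A * cnj B) / (2 * cmod A * cosh r) = cmod (1 + A * B) * (cmod A * u) / ((cmod A)\<^sup>2 * (u\<^sup>2 + 1))"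
  proof -
    have "W / (2 * a * (K / (2 * u))) = W * (a * u) / (a\<^sup>2 * K)" if "a \<noteq> 0" "K > 0" for W a K :: real
      using that u(1) by (simp add: field_simps power2_eq_square)
    then show ?thesis unfolding ch using A u2 \<open>cmod (1 + cnj A * cnj B) = _\<close> by simp
  qed
  have "geodesic' \<nu> r = ((A * B - 1) / (2 * A) + (1 + A * B) / (2 * A) * complex_of_real (tanh r), cmod (1 + cnj A * cnj B) / (2 * cmod A * cosh r))"
    using False by (simp add: geodesic'_def Let_def A_def B_def)
  also have "\<dots> = geo_point (end_spinor False \<nu>) (begin_spinor False \<nu>) (cmod A * u)"
    unfolding z t geo_point_def q wedge_spinor A_def[symmetric] B_def[symmetric]
    by (simp add: end_spinor_def begin_spinor_def A_def[symmetric] B_def[symmetric])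
  finally show ?thesis using False by (simp add: A_def u_def)
qed

lemma geo_point_ray_derivative:
  assumes "wedge \<xi> \<eta> \<noteq> 0" "k > 0"
  shows "vector_derivative (\<lambda>r. geo_point \<xi> \<eta> (k * exp r)) (at r) = geo_velocity \<xi> \<eta> (k * exp r)"
proof (rule vector_derivative_at)
  have R: "((\<lambda>r. k * exp r) has_derivative (\<lambda>w. w * (k * exp r))) (at r)"
    by (auto intro!: derivative_eq_intros)
  have w0: "wedge 0 s = 0" "wedge s 0 = 0" for s by (simp_all add: wedge_def)
  have g0: "geo_normal \<xi> \<eta> R 0 = 0" for R by (simp add: geo_normal_def zero_prod_def)
  show "((\<lambda>r. geo_point \<xi> \<eta> (k * exp r)) has_vector_derivative geo_velocity \<xi> \<eta> (k * exp r)) (at r)"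
    using geo_point_has_derivative[OF has_derivative_const has_derivative_const R assms(1)] assms(2)
    by (simp add: has_vector_derivative_def w0 g0)
qed

lemma chart_of_eq:
  assumes "\<mu> \<in> coord_domain"
  shows "chart_of b \<mu> = {(geo_point (end_spinor b \<mu>) (begin_spinor b \<mu>) R, geo_velocity (end_spinor b \<mu>) (begin_spinor b \<mu>) R) |R. R > 0}"
proof -
  define k where "k = (if b then (if snd \<mu> = 0 then 1 else 1 / cmod (snd \<mu>)) else (if fst \<mu> = 0 then 1 else cmod (fst \<mu>)))"
  have k: "k > 0" by (simp add: k_def)
  have "chart_of b \<mu> = orbit (\<lambda>r. geo_point (end_spinor b \<mu>) (begin_spinor b \<mu>) (k * exp r))"
  proof (cases b)
    case True
    have "geodesic \<mu> = (\<lambda>r. geo_point (end_spinor b \<mu>) (begin_spinor b \<mu>) (k * exp r))"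
      using geodesic_geo_point[OF assms] True by (intro ext) (simp add: k_def)
    then show ?thesis using True by (simp add: chart_of_def chart_def)
  next
    case False
    have "geodesic' \<mu> = (\<lambda>r. geo_point (end_spinor b \<mu>) (begin_spinor b \<mu>) (k * exp r))"
      using geodesic'_geo_point[OF assms] False by (intro ext) (simp add: k_def)
    then show ?thesis using False by (simp add: chart_of_def chart'_def)
  qed
  also have "\<dots> = range (\<lambda>r. (geo_point (end_spinor b \<mu>) (begin_spinor b \<mu>) (k * exp r), geo_velocity (end_spinor b \<mu>) (begin_spinor b \<mu>) (k * exp r)))"
    by (simp add: orbit_def geo_point_ray_derivative[OF wedge_spinor_nonzero[OF assms] k])
  also have "\<dots> = {(geo_point (end_spinor b \<mu>) (begin_spinor b \<mu>) R, geo_velocity (end_spinor b \<mu>) (begin_spinor b \<mu>) R) |R. R > 0}"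
  proof -
    have "\<exists>r. R = k * exp r" if "R > 0" for R
      using that k by (intro exI[of _ "ln (R / k)"]) simp
    then show ?thesis using k by (fastforce intro: mult_pos_pos)
  qed
  finally show ?thesis .
qed

lemma LH3_eq: "LH3 = (\<Union>b. chart_of b ` coord_domain)"
  by (auto simp: LH3_def chart_of_def UNIV_bool)

text \<open>For a unit tangent vector \<open>v\<close> at \<open>x\<close> the sum of the Hermitian matrices of \<open>x\<close> and \<open>v\<close> has rank one and is a
  multiple of \<open>\<xi> \<xi>\<^sup>*\<close>, where \<open>\<xi>\<close> is the forward end of the geodesic; for \<open>- v\<close> this gives the backward end. These are
  the entries of the sum, multiplied by the square of the height. The coordinates of the geodesic are quotients of
  them, hence as smooth as \<open>x\<close> and \<open>v\<close>.\<close>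

definition mat11 :: "half_space \<Rightarrow> half_space \<Rightarrow> real" where
  "mat11 x v = (cmod (fst x))\<^sup>2 * (snd x - snd v) + 2 * snd x * Re (cnj (fst x) * fst v) + (snd x)\<^sup>2 * (snd x + snd v)"
definition mat12 :: "half_space \<Rightarrow> half_space \<Rightarrow> complex" where
  "mat12 x v = fst x * complex_of_real (snd x - snd v) + complex_of_real (snd x) * fst v"
definition mat22 :: "half_space \<Rightarrow> half_space \<Rightarrow> real" where
  "mat22 x v = snd x - snd v"

lemma mat_geo_point:
  assumes "wedge \<xi> \<eta> \<noteq> 0" "R > 0"
  defines "x \<equiv> geo_point \<xi> \<eta> R" and "v \<equiv> geo_velocity \<xi> \<eta> R"
  obtains c c' :: real where "c > 0" "c' > 0"
    "mat11 x v = c * (cmod (fst \<xi>))\<^sup>2" "mat12 x v = c * (fst \<xi> * cnj (snd \<xi>))" "mat22 x v = c * (cmod (snd \<xi>))\<^sup>2"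
    "mat11 x (- v) = c' * (cmod (fst \<eta>))\<^sup>2" "mat12 x (- v) = c' * (fst \<eta> * cnj (snd \<eta>))" "mat22 x (- v) = c' * (cmod (snd \<eta>))\<^sup>2"
proof -
  define x1 x2 y1 y2 where "x1 = fst \<xi>" and "x2 = snd \<xi>" and "y1 = fst \<eta>" and "y2 = snd \<eta>"
  define d q where "d = wedge \<xi> \<eta>" and "q = geo_denom \<xi> \<eta> R"
  have q: "q > 0" using geo_denom_pos[OF assms(1,2)] by (simp add: q_def)
  have qe: "q = R\<^sup>2 * ((Re x2)\<^sup>2 + (Im x2)\<^sup>2) + ((Re y2)\<^sup>2 + (Im y2)\<^sup>2)"
    by (simp add: q_def geo_denom_def x2_def y2_def cmod_power2)
  have qc: "complex_of_real q = (complex_of_real R)\<^sup>2 * (x2 * cnj x2) + y2 * cnj y2"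
    unfolding q_def geo_denom_complex x2_def y2_def ..
  have de: "d = x1 * y2 - x2 * y1" by (simp add: d_def wedge_def x1_def x2_def y1_def y2_def)
  have d: "cmod d > 0" using assms by (simp add: d_def)
  define N where "N = (complex_of_real R)\<^sup>2 * x1 * cnj x2 + y1 * cnj y2"
  define w where "w = 2 * (complex_of_real R)\<^sup>2 * cnj (x2 * y2) * d"
  define s where "s = (cmod y2)\<^sup>2 - R\<^sup>2 * (cmod x2)\<^sup>2"
  define t where "t = cmod d * R / q"
  have t: "t > 0" using d assms(2) q by (simp add: t_def)
  have x: "x = (N / q, t)"
    by (simp add: x_def geo_point_def N_def q_def d_def x1_def x2_def y1_def y2_def t_def)
  have v: "v = (w / (of_real q)\<^sup>2, t * s / q)"
    by (simp add: v_def geo_velocity_def w_def s_def q_def d_def x1_def x2_def y1_def y2_def t_def power2_eq_square)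
  have tt: "t\<^sup>2 = (cmod d)\<^sup>2 * R\<^sup>2 / q\<^sup>2" by (simp add: t_def power_divide power_mult_distrib)
  have m22: "q - s = 2 * R\<^sup>2 * (cmod x2)\<^sup>2" "q + s = 2 * (cmod y2)\<^sup>2"
    by (simp_all add: qe s_def cmod_power2)
  have M22: "mat22 x v = t / q * (q - s)" "mat22 x (- v) = t / q * (q + s)"
    using q by (simp_all add: mat22_def x v field_simps)
  have M12: "mat12 x v = of_real (t / q\<^sup>2) * (N * of_real (q - s) + w)" "mat12 x (- v) = of_real (t / q\<^sup>2) * (N * of_real (q + s) - w)"
    using q by (simp_all add: mat12_def x v field_simps power2_eq_square)
  have M11: "mat11 x v = t / q ^ 3 * ((cmod N)\<^sup>2 * (q - s) + 2 * Re (cnj N * w) + (cmod d)\<^sup>2 * R\<^sup>2 * (q + s))"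
    "mat11 x (- v) = t / q ^ 3 * ((cmod N)\<^sup>2 * (q + s) - 2 * Re (cnj N * w) + (cmod d)\<^sup>2 * R\<^sup>2 * (q - s))"
  proof -
    have a: "Re (cnj (N / q) * (w / (of_real q)\<^sup>2)) = Re (cnj N * w) / q ^ 3"
    proof -
      have "cnj (N / q) * (w / (of_real q)\<^sup>2) = (cnj N * w) / of_real (q ^ 3)"
        by (simp add: power2_eq_square power3_eq_cube)
      then show ?thesis by (simp only: Re_divide_of_real)
    qed
    show "mat11 x v = t / q ^ 3 * ((cmod N)\<^sup>2 * (q - s) + 2 * Re (cnj N * w) + (cmod d)\<^sup>2 * R\<^sup>2 * (q + s))"
      unfolding mat11_def x v fst_conv snd_conv a tt using q
      by (simp add: norm_divide power_divide field_simps power2_eq_square power3_eq_cube)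
    show "mat11 x (- v) = t / q ^ 3 * ((cmod N)\<^sup>2 * (q + s) - 2 * Re (cnj N * w) + (cmod d)\<^sup>2 * R\<^sup>2 * (q - s))"
      unfolding mat11_def x v fst_conv snd_conv uminus_Pair mult_minus_right uminus_complex.sel a tt using q
      by (simp add: norm_divide power_divide field_simps power2_eq_square power3_eq_cube)
  qed
  have n12: "N * of_real (q - s) + w = 2 * of_real (R\<^sup>2) * of_real q * (x1 * cnj x2)"
    "N * of_real (q + s) - w = 2 * of_real q * (y1 * cnj y2)"
    unfolding m22 of_real_mult complex_norm_square w_def N_def de qc by (simp_all add: algebra_simps power2_eq_square)
  have n11: "(cmod N)\<^sup>2 * (q - s) + 2 * Re (cnj N * w) + (cmod d)\<^sup>2 * R\<^sup>2 * (q + s) = q\<^sup>2 * (2 * R\<^sup>2 * (cmod x1)\<^sup>2)"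
    "(cmod N)\<^sup>2 * (q + s) - 2 * Re (cnj N * w) + (cmod d)\<^sup>2 * R\<^sup>2 * (q - s) = q\<^sup>2 * (2 * (cmod y1)\<^sup>2)"
    unfolding m22 unfolding qe w_def N_def de cmod_power2 by (simp add: Re_power2 Im_power2, algebra)+
  have "mat11 x v = 2 * R\<^sup>2 * t / q * (cmod x1)\<^sup>2" "mat11 x (- v) = 2 * t / q * (cmod y1)\<^sup>2"
    unfolding M11 n11 using q by (simp_all add: power2_eq_square power3_eq_cube)
  moreover have "mat12 x v = of_real (2 * R\<^sup>2 * t / q) * (x1 * cnj x2)" "mat12 x (- v) = of_real (2 * t / q) * (y1 * cnj y2)"
    unfolding M12 n12 using q by (simp_all add: power2_eq_square)
  moreover have "mat22 x v = 2 * R\<^sup>2 * t / q * (cmod x2)\<^sup>2" "mat22 x (- v) = 2 * t / q * (cmod y2)\<^sup>2"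
    unfolding M22 m22 by simp_all
  moreover have "2 * R\<^sup>2 * t / q > 0" "2 * t / q > 0" using q t assms(2) by simp_all
  ultimately show ?thesis using that unfolding x1_def x2_def y1_def y2_def by blast
qed

text \<open>The geodesic through \<open>x\<close> with velocity \<open>v\<close> has coordinates in the chart \<open>b\<close>.\<close>

definition in_chart :: "bool \<Rightarrow> half_space \<Rightarrow> half_space \<Rightarrow> bool" where
  "in_chart b x v \<longleftrightarrow> (if b then mat11 x v \<noteq> 0 \<and> mat22 x (- v) \<noteq> 0 else mat22 x v \<noteq> 0 \<and> mat11 x (- v) \<noteq> 0)"

definition coords_of :: "bool \<Rightarrow> half_space \<Rightarrow> half_space \<Rightarrow> coords" where
  "coords_of b x v = (if b then (- mat12 x (- v) / mat22 x (- v), mat12 x v / mat11 x v)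
     else (- cnj (mat12 x (- v)) / mat11 x (- v), cnj (mat12 x v) / mat22 x v))"

lemma chart_of_coords:
  assumes "\<mu> \<in> coord_domain" "(x, v) \<in> chart_of b \<mu>"
  shows "in_chart b x v" "coords_of b x v = \<mu>"
    "in_chart (\<not> b) x v \<Longrightarrow> fst \<mu> \<noteq> 0 \<and> snd \<mu> \<noteq> 0 \<and> coords_of (\<not> b) x v = (1 / fst \<mu>, 1 / snd \<mu>)"
proof -
  obtain R where R: "R > 0" "x = geo_point (end_spinor b \<mu>) (begin_spinor b \<mu>) R" "v = geo_velocity (end_spinor b \<mu>) (begin_spinor b \<mu>) R"
    using assms(2) unfolding chart_of_eq[OF assms(1)] by blast
  obtain c c' :: real where c: "c > 0" "c' > 0"
    "mat11 x v = c * (cmod (fst (end_spinor b \<mu>)))\<^sup>2" "mat12 x v = c * (fst (end_spinor b \<mu>) * cnj (snd (end_spinor b \<mu>)))" "mat22 x v = c * (cmod (snd (end_spinor b \<mu>)))\<^sup>2"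
    "mat11 x (- v) = c' * (cmod (fst (begin_spinor b \<mu>)))\<^sup>2" "mat12 x (- v) = c' * (fst (begin_spinor b \<mu>) * cnj (snd (begin_spinor b \<mu>)))" "mat22 x (- v) = c' * (cmod (snd (begin_spinor b \<mu>)))\<^sup>2"
    unfolding R(2,3) using mat_geo_point[OF wedge_spinor_nonzero[OF assms(1)] R(1)] by metis
  have dv: "cnj z / (complex_of_real (cmod z))\<^sup>2 = 1 / z" "z / (complex_of_real (cmod z))\<^sup>2 = 1 / cnj z" if "z \<noteq> 0" for z
    using that complex_norm_square[of z] by (simp_all add: field_simps)
  show "in_chart b x v"
    using c(1,2) unfolding in_chart_def c(3-8) by (simp add: end_spinor_def begin_spinor_def)
  show "coords_of b x v = \<mu>"
    using c(1,2) unfolding coords_of_def c(3-8) by (simp add: end_spinor_def begin_spinor_def prod_eq_iff)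
  show "fst \<mu> \<noteq> 0 \<and> snd \<mu> \<noteq> 0 \<and> coords_of (\<not> b) x v = (1 / fst \<mu>, 1 / snd \<mu>)" if g: "in_chart (\<not> b) x v"
  proof -
    have nz: "fst \<mu> \<noteq> 0" "snd \<mu> \<noteq> 0"
      using g c(1,2) unfolding in_chart_def c(3-8) by (auto simp: end_spinor_def begin_spinor_def split: if_splits)
    then show ?thesis
      using c(1,2) unfolding coords_of_def c(3-8) by (simp add: end_spinor_def begin_spinor_def dv)
  qed
qed

definition spinor_scale :: "complex \<Rightarrow> complex \<times> complex \<Rightarrow> complex \<times> complex" where
  "spinor_scale s \<xi> = (s * fst \<xi>, s * snd \<xi>)"

lemma wedge_scale: "wedge (spinor_scale s \<xi>) (spinor_scale t \<eta>) = s * t * wedge \<xi> \<eta>"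
  by (simp add: wedge_def spinor_scale_def algebra_simps)

lemma geodesic_scale:
  assumes s: "s \<noteq> 0" and t: "t \<noteq> 0"
  shows "geo_point (spinor_scale s \<xi>) (spinor_scale t \<eta>) R = geo_point \<xi> \<eta> (R * cmod s / cmod t)"
    and "geo_velocity (spinor_scale s \<xi>) (spinor_scale t \<eta>) R = geo_velocity \<xi> \<eta> (R * cmod s / cmod t)"
proof -
  define r where "r = R * cmod s / cmod t"
  have R: "R = r * cmod t / cmod s" using s t by (simp add: r_def)
  define a where "a = complex_of_real ((cmod t)\<^sup>2)"
  have a: "a \<noteq> 0" "t * cnj t = a" using t by (simp_all add: a_def complex_norm_square[symmetric] del: of_real_power)
  have ss: "(complex_of_real R)\<^sup>2 * (s * cnj s) = (complex_of_real r)\<^sup>2 * a"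
    unfolding complex_norm_square[symmetric] a_def R using s by (simp add: power_divide power_mult_distrib)
  have q: "geo_denom (spinor_scale s \<xi>) (spinor_scale t \<eta>) R = (cmod t)\<^sup>2 * geo_denom \<xi> \<eta> r"
    unfolding R using s by (simp add: geo_denom_def spinor_scale_def norm_mult power_mult_distrib power_divide algebra_simps)
  have qc: "complex_of_real ((cmod t)\<^sup>2 * geo_denom \<xi> \<eta> r) = a * of_real (geo_denom \<xi> \<eta> r)"
    "complex_of_real (((cmod t)\<^sup>2 * geo_denom \<xi> \<eta> r)\<^sup>2) = a\<^sup>2 * of_real ((geo_denom \<xi> \<eta> r)\<^sup>2)" by (simp_all add: a_def power_mult_distrib)
  have w: "cmod (wedge (spinor_scale s \<xi>) (spinor_scale t \<eta>)) * R = (cmod t)\<^sup>2 * (cmod (wedge \<xi> \<eta>) * r)"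
    unfolding R wedge_scale using s by (simp add: norm_mult power2_eq_square)
  have n: "(complex_of_real R)\<^sup>2 * fst (spinor_scale s \<xi>) * cnj (snd (spinor_scale s \<xi>)) + fst (spinor_scale t \<eta>) * cnj (snd (spinor_scale t \<eta>))
     = a * ((complex_of_real r)\<^sup>2 * fst \<xi> * cnj (snd \<xi>) + fst \<eta> * cnj (snd \<eta>))"
  proof -
    have "(complex_of_real R)\<^sup>2 * fst (spinor_scale s \<xi>) * cnj (snd (spinor_scale s \<xi>)) + fst (spinor_scale t \<eta>) * cnj (snd (spinor_scale t \<eta>))
      = ((complex_of_real R)\<^sup>2 * (s * cnj s)) * (fst \<xi> * cnj (snd \<xi>)) + (t * cnj t) * (fst \<eta> * cnj (snd \<eta>))"
      by (simp add: spinor_scale_def algebra_simps)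
    then show ?thesis unfolding ss a(2) by (simp add: algebra_simps)
  qed
  show "geo_point (spinor_scale s \<xi>) (spinor_scale t \<eta>) R = geo_point \<xi> \<eta> (R * cmod s / cmod t)"
    unfolding r_def[symmetric] geo_point_def q qc w n using a(1) t by simp
  have v1: "2 * (complex_of_real R)\<^sup>2 * cnj (snd (spinor_scale s \<xi>) * snd (spinor_scale t \<eta>)) * wedge (spinor_scale s \<xi>) (spinor_scale t \<eta>)
     = a\<^sup>2 * (2 * (complex_of_real r)\<^sup>2 * cnj (snd \<xi> * snd \<eta>) * wedge \<xi> \<eta>)"
  proof -
    have "2 * (complex_of_real R)\<^sup>2 * cnj (snd (spinor_scale s \<xi>) * snd (spinor_scale t \<eta>)) * wedge (spinor_scale s \<xi>) (spinor_scale t \<eta>)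
      = 2 * ((complex_of_real R)\<^sup>2 * (s * cnj s)) * (t * cnj t) * cnj (snd \<xi> * snd \<eta>) * wedge \<xi> \<eta>"
      unfolding wedge_scale by (simp add: spinor_scale_def)
    then show ?thesis unfolding ss a(2) by (simp add: power2_eq_square)
  qed
  have v2: "(cmod (snd (spinor_scale t \<eta>)))\<^sup>2 - R\<^sup>2 * (cmod (snd (spinor_scale s \<xi>)))\<^sup>2 = (cmod t)\<^sup>2 * ((cmod (snd \<eta>))\<^sup>2 - r\<^sup>2 * (cmod (snd \<xi>))\<^sup>2)"
    unfolding R using s by (simp add: spinor_scale_def norm_mult power_mult_distrib power_divide algebra_simps)
  show "geo_velocity (spinor_scale s \<xi>) (spinor_scale t \<eta>) R = geo_velocity \<xi> \<eta> (R * cmod s / cmod t)"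
    unfolding r_def[symmetric] geo_velocity_def q qc w v1 v2 using a(1) t by (simp add: power_mult_distrib) (simp add: power2_eq_square power4_eq_xxxx)
qed

text \<open>Vertical geodesics are treated separately. Otherwise the ends are \<open>z + t w / (t - s)\<close> and \<open>z - t w / (t + s)\<close>, where
  \<open>(w, s)\<close> is the velocity at \<open>(z, t)\<close>.\<close>

lemma geodesic_through:
  assumes "x \<in> H3" "norm v = snd x"
  obtains \<xi> \<eta> R where "wedge \<xi> \<eta> \<noteq> 0" "R > 0" "x = geo_point \<xi> \<eta> R" "v = geo_velocity \<xi> \<eta> R"
proof -
  obtain z t w s where x: "x = (z, t)" and v: "v = (w, s)" by (cases x, cases v)
  have t: "t > 0" using assms(1) by (simp add: H3_def x)
  have ws: "(cmod w)\<^sup>2 = t\<^sup>2 - s\<^sup>2"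
  proof -
    have "(norm v)\<^sup>2 = (cmod w)\<^sup>2 + s\<^sup>2" by (simp add: v norm_Pair)
    then show ?thesis using assms(2) by (simp add: x)
  qed
  have w0: "w = 0" if "s = t \<or> s = - t" using that ws by auto
  consider "s = t" | "s = - t" | "s \<noteq> t" "s \<noteq> - t" by blast
  then show ?thesis
  proof cases
    case 1
    then show ?thesis using w0 t
      by (intro that[of "(1, 0)" "(z, 1)" t]) (auto simp: geo_point_def geo_velocity_def geo_denom_def wedge_def x v)
  next
    case 2
    then show ?thesis using w0 t
      by (intro that[of "(z, 1)" "(1, 0)" "1 / t"])
         (auto simp: geo_point_def geo_velocity_def geo_denom_def wedge_def x v field_simps power2_eq_square)
  next
    case 3
    have "s\<^sup>2 \<le> t\<^sup>2" using ws by (metis zero_le_power2 diff_ge_0_iff_ge)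
    then have "\<bar>s\<bar> \<le> t" using t by (metis abs_le_square_iff abs_of_pos)
    then have st: "t - s > 0" "t + s > 0" using 3 by auto
    have "(cmod w)\<^sup>2 = (t - s) * (t + s)" unfolding ws by (simp add: algebra_simps power2_eq_square)
    then have w: "w \<noteq> 0" using st by auto
    have wc: "complex_of_real t - s \<noteq> 0" "complex_of_real t + s \<noteq> 0"
      using st by (simp_all flip: of_real_diff of_real_add)
    have ww: "w * cnj w = (complex_of_real t - s) * (complex_of_real t + s)"
    proof -
      have "w * cnj w = complex_of_real (t\<^sup>2 - s\<^sup>2)" using complex_norm_square[of w] ws by simp
      then show ?thesis by (simp add: algebra_simps power2_eq_square)
    qed
    define e f where "e = z + t * w / (complex_of_real t - s)" and "f = z - t * w / (complex_of_real t + s)"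
    have ef: "e - f = 2 * t\<^sup>2 / cnj w"
    proof -
      have "e - f = t * w * (2 * t) / ((complex_of_real t - s) * (complex_of_real t + s))"
        unfolding e_def f_def using wc by (simp add: field_simps)
      also have "\<dots> = 2 * t\<^sup>2 / cnj w" unfolding ww[symmetric] using w by (simp add: field_simps power2_eq_square)
      finally show ?thesis .
    qed
    define k where "k = sqrt ((t - s) / (t + s))"
    have k: "k > 0" "k\<^sup>2 = (t - s) / (t + s)" using st by (simp_all add: k_def)
    have kc: "(complex_of_real k)\<^sup>2 = (complex_of_real t - s) / (complex_of_real t + s)"
      using arg_cong[OF k(2), of complex_of_real] by simp
    have k1: "k\<^sup>2 + 1 = 2 * t / (t + s)" "1 - k\<^sup>2 = 2 * s / (t + s)" using st unfolding k(2) by (simp_all add: field_simps)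
    have ktw: "k * (t + s) = cmod w"
    proof -
      have "(k * (t + s))\<^sup>2 = (cmod w)\<^sup>2" unfolding power_mult_distrib k(2) ws using st by (simp add: field_simps power2_eq_square)
      then show ?thesis using k(1) st by (simp add: power2_eq_iff_nonneg)
    qed
    have ncw: "cmod (2 * t\<^sup>2 / cnj w) = 2 * t\<^sup>2 / cmod w" by (simp add: norm_divide norm_mult norm_power)
    have zz: "((complex_of_real k)\<^sup>2 * e + f) / complex_of_real (2 * t / (t + s)) = z"
    proof -
      have gen: "(P / Q * (z + c / P) + (z - c / Q)) / ((P + Q) / Q) = z" if "P \<noteq> 0" "Q \<noteq> 0" "P + Q \<noteq> 0" for P Q c :: complex
      proof -
        have "P / Q * (z + c / P) + (z - c / Q) = z * ((P + Q) / Q)"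
          using that(1,2) by (simp add: field_simps)
        then show ?thesis using that by simp
      qed
      have PQ: "(complex_of_real t - s) + (complex_of_real t + s) = of_real (2 * t)" by simp
      have "complex_of_real (2 * t / (t + s)) = ((complex_of_real t - s) + (complex_of_real t + s)) / (complex_of_real t + s)"
        unfolding PQ by simp
      then show ?thesis unfolding kc e_def f_def using gen[OF wc, of "t * w"] t by simp
    qed
    have tt: "cmod (2 * t\<^sup>2 / cnj w) * k / (2 * t / (t + s)) = t"
    proof -
      have "2 * t\<^sup>2 / cmod w * k / (2 * t / (t + s)) = t * (k * (t + s)) / cmod w"
        using t by (simp add: power2_eq_square)
      then show ?thesis unfolding ncw ktw using w by simp
    qed
    have vz: "2 * (complex_of_real k)\<^sup>2 * (2 * t\<^sup>2 / cnj w) / (complex_of_real (2 * t / (t + s)))\<^sup>2 = w"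
    proof -
      have "2 * (complex_of_real k)\<^sup>2 * (2 * t\<^sup>2 / cnj w) / (complex_of_real (2 * t / (t + s)))\<^sup>2 = (complex_of_real t - s) * (complex_of_real t + s) / cnj w"
      proof -
        have gen: "2 * (P / Q) * (2 * T\<^sup>2 / c) / (2 * T / Q)\<^sup>2 = P * Q / c" if "T \<noteq> 0" "Q \<noteq> 0" "c \<noteq> 0" for P Q T c :: complex
          using that by (simp add: power2_eq_square)
        have "complex_of_real (2 * t / (t + s)) = 2 * complex_of_real t / (complex_of_real t + s)" by simp
        then show ?thesis unfolding kc using gen[of t "complex_of_real t + s" "cnj w" "complex_of_real t - s"] wc t w by simp
      qed
      then show ?thesis unfolding ww[symmetric] using w by simp
    qed
    have vt: "t * (1 - k\<^sup>2) / (2 * t / (t + s)) = s" unfolding k1 using st t by simp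
    define X where "X = e - f"
    have X0: "X \<noteq> 0" using ef t w by (simp add: X_def)
    note tt = tt[folded ef X_def] and vz = vz[folded ef X_def]

    have W: "wedge (e, 1) (f, 1) = X" by (simp add: wedge_def X_def)
    have q: "geo_denom (e, 1) (f, 1) k = 2 * t / (t + s)" by (simp add: geo_denom_def k1(1))
    have "geo_point (e, 1) (f, 1) k = x"
      unfolding geo_point_def q W x using zz tt by simp
    moreover have "geo_velocity (e, 1) (f, 1) k = v"
    proof -
      have "cmod X * k * (1 - k\<^sup>2) / (2 * t / (t + s))\<^sup>2 = s"
      proof -
        have "cmod X * k * (1 - k\<^sup>2) / Q\<^sup>2 = cmod X * k / Q * (1 - k\<^sup>2) / Q" for Q :: real
          by (simp add: power2_eq_square)
        then show ?thesis by (simp only: tt vt)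
      qed
      then show ?thesis unfolding geo_velocity_def q W v using vz by simp
    qed
    ultimately show ?thesis using that[of "(e, 1)" "(f, 1)" k] W X0 k(1) by simp
  qed
qed

lemma chart_of_coords_of:
  assumes "x \<in> H3" "norm v = snd x"
  shows "\<exists>b. in_chart b x v"
    and "in_chart b x v \<Longrightarrow> coords_of b x v \<in> coord_domain \<and> (x, v) \<in> chart_of b (coords_of b x v)"
proof -
  obtain \<xi> \<eta> R where W: "wedge \<xi> \<eta> \<noteq> 0" and R: "R > 0" and x: "x = geo_point \<xi> \<eta> R" "v = geo_velocity \<xi> \<eta> R"
    using geodesic_through[OF assms] by blast
  obtain c c' :: real where c: "c > 0" "c' > 0"
    "mat11 x v = c * (cmod (fst \<xi>))\<^sup>2" "mat12 x v = c * (fst \<xi> * cnj (snd \<xi>))" "mat22 x v = c * (cmod (snd \<xi>))\<^sup>2"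
    "mat11 x (- v) = c' * (cmod (fst \<eta>))\<^sup>2" "mat12 x (- v) = c' * (fst \<eta> * cnj (snd \<eta>))" "mat22 x (- v) = c' * (cmod (snd \<eta>))\<^sup>2"
    unfolding x using mat_geo_point[OF W R] by metis
  have good: "in_chart b x v \<longleftrightarrow> (if b then fst \<xi> \<noteq> 0 \<and> snd \<eta> \<noteq> 0 else snd \<xi> \<noteq> 0 \<and> fst \<eta> \<noteq> 0)" for b
    using c(1,2) by (simp add: in_chart_def c(3-8))
  have "in_chart True x v \<or> in_chart False x v" using W by (auto simp: good wedge_def)
  then show "\<exists>b. in_chart b x v" by blast
  show "coords_of b x v \<in> coord_domain \<and> (x, v) \<in> chart_of b (coords_of b x v)" if g: "in_chart b x v"
  proof -
    define \<mu> where "\<mu> = coords_of b x v"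
    define s t where "s = (if b then 1 / fst \<xi> else 1 / snd \<xi>)" and "t = (if b then 1 / snd \<eta> else - 1 / fst \<eta>)"
    have st: "s \<noteq> 0" "t \<noteq> 0" using g by (auto simp: s_def t_def good)
    have dv: "cnj z * y / (complex_of_real (cmod z))\<^sup>2 = y / z" "y * cnj z / (complex_of_real (cmod z))\<^sup>2 = y / z"
      if "z \<noteq> 0" for y z
      using that complex_norm_square[of z] by (simp_all add: field_simps)
    have sp: "end_spinor b \<mu> = spinor_scale s \<xi>" "begin_spinor b \<mu> = spinor_scale t \<eta>"
      using g c(1,2) unfolding good by (auto simp: \<mu>_def coords_of_def c(3-8) end_spinor_def begin_spinor_def spinor_scale_def s_def t_def dv)
    have dom: "\<mu> \<in> coord_domain"
      using wedge_spinor[of b \<mu>, symmetric] st W unfolding sp wedge_scale by (simp add: coord_domain_def)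
    define r where "r = R * cmod t / cmod s"
    have r: "r > 0" "r * cmod s / cmod t = R" using st R by (simp_all add: r_def)
    have "x = geo_point (end_spinor b \<mu>) (begin_spinor b \<mu>) r" "v = geo_velocity (end_spinor b \<mu>) (begin_spinor b \<mu>) r"
      unfolding sp geodesic_scale[OF st] r(2) by (fact x)+
    then show ?thesis using dom r(1) chart_of_eq[OF dom] unfolding \<mu>_def by blast
  qed
qed

lemma chart_of_flip:
  assumes "\<mu> \<in> coord_domain" "fst \<mu> \<noteq> 0" "snd \<mu> \<noteq> 0"
  shows "(1 / fst \<mu>, 1 / snd \<mu>) \<in> coord_domain" "chart_of (\<not> b) (1 / fst \<mu>, 1 / snd \<mu>) = chart_of b \<mu>"
proof -
  have "1 + 1 / fst \<mu> * cnj (1 / snd \<mu>) = (1 + fst \<mu> * cnj (snd \<mu>)) / (fst \<mu> * cnj (snd \<mu>))"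
    using assms(2,3) by (simp add: field_simps)
  then show "(1 / fst \<mu>, 1 / snd \<mu>) \<in> coord_domain" using assms by (simp add: coord_domain_def)
  show "chart_of (\<not> b) (1 / fst \<mu>, 1 / snd \<mu>) = chart_of b \<mu>"
    using geodesic'_eq_geodesic[of "1 / fst \<mu>" "1 / snd \<mu>"] geodesic'_eq_geodesic[of "fst \<mu>" "snd \<mu>"] assms(2,3)
    by (simp add: chart_of_def chart_def chart'_def)
qed

text \<open>Together with \<open>chart_of_flip\<close> this identifies the transition map between the charts, and it shows that a point and a
  direction lie on one oriented geodesic only.\<close>

lemma chart_of_unique:
  assumes "\<mu> \<in> coord_domain" "(x, v) \<in> chart_of b \<mu>" "\<nu> \<in> coord_domain" "(x, v) \<in> chart_of c \<nu>"
  shows "if b = c then \<mu> = \<nu> else fst \<mu> \<noteq> 0 \<and> snd \<mu> \<noteq> 0 \<and> \<nu> = (1 / fst \<mu>, 1 / snd \<mu>)"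
    and "chart_of b \<mu> = chart_of c \<nu>"
proof -
  show *: "if b = c then \<mu> = \<nu> else fst \<mu> \<noteq> 0 \<and> snd \<mu> \<noteq> 0 \<and> \<nu> = (1 / fst \<mu>, 1 / snd \<mu>)"
  proof (cases "b = c")
    case True
    then show ?thesis using chart_of_coords(2)[OF assms(1,2)] chart_of_coords(2)[OF assms(3,4)] by simp
  next
    case False
    then have c: "c = (\<not> b)" by auto
    show ?thesis using chart_of_coords(3)[OF assms(1,2)] chart_of_coords(1,2)[OF assms(3,4)] unfolding c by simp
  qed
  show "chart_of b \<mu> = chart_of c \<nu>"
  proof (cases "b = c")
    case False
    then have c: "c = (\<not> b)" by auto
    show ?thesis using * chart_of_flip(2)[OF assms(1), of b] unfolding c by auto
  qed (use * in auto)
qed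

lemma chart_of_nonempty:
  assumes "\<mu> \<in> coord_domain" obtains x v where "(x, v) \<in> chart_of b \<mu>"
  using chart_of_eq[OF assms, of b] by (metis (mono_tags, lifting) mem_Collect_eq zero_less_one)

lemma chart_of_eq_iff:
  assumes "\<mu> \<in> coord_domain" "\<nu> \<in> coord_domain" "chart_of b \<mu> = chart_of c \<nu>"
  shows "if b = c then \<mu> = \<nu> else fst \<mu> \<noteq> 0 \<and> snd \<mu> \<noteq> 0 \<and> \<nu> = (1 / fst \<mu>, 1 / snd \<mu>)"
proof -
  obtain x v where "(x, v) \<in> chart_of b \<mu>" using chart_of_nonempty[OF assms(1)] by blast
  then show ?thesis using chart_of_unique(1)[OF assms(1) _ assms(2)] assms(3) by metis
qed

lemma LH3_ex1:
  assumes "x \<in> H3" "norm v = snd x"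
  shows "\<exists>!l. l \<in> LH3 \<and> (x, v) \<in> l"
proof -
  obtain b where "in_chart b x v" using chart_of_coords_of(1)[OF assms] by blast
  from chart_of_coords_of(2)[OF assms this] have "\<exists>l. l \<in> LH3 \<and> (x, v) \<in> l" unfolding LH3_eq by blast
  moreover have "l = l'" if "l \<in> LH3" "(x, v) \<in> l" "l' \<in> LH3" "(x, v) \<in> l'" for l l'
    using that chart_of_unique(2) unfolding LH3_eq by blast
  ultimately show ?thesis by blast
qed

lemma normal_geodesic_props:
  assumes "f m \<in> H3" "hyp_norm (f m) (N m) = 1"
  shows "normal_geodesic f N m \<in> LH3" "(f m, N m) \<in> normal_geodesic f N m"
    and "l \<in> LH3 \<Longrightarrow> (f m, N m) \<in> l \<Longrightarrow> normal_geodesic f N m = l"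
proof -
  have "norm (N m) = snd (f m)"
    using assms by (simp add: hyp_norm_def H3_def field_simps)
  note ex1 = LH3_ex1[OF assms(1) this]
  from theI'[OF ex1] show "normal_geodesic f N m \<in> LH3" "(f m, N m) \<in> normal_geodesic f N m"
    by (simp_all add: normal_geodesic_def)
  show "l \<in> LH3 \<Longrightarrow> (f m, N m) \<in> l \<Longrightarrow> normal_geodesic f N m = l"
    unfolding normal_geodesic_def by (rule the1_equality[OF ex1]) auto
qed

section \<open>Geodesics orthogonal to an axis\<close>

text \<open>An axis is encoded by the coefficients \<open>(p, m, n)\<close> of the binary quadratic form \<open>n z\<^sup>2 + 2 p z - m\<close> whose roots are its
  ends. This covers all axes uniformly, including those with an end at infinity, and forgets the orientation.\<close>

type_synonym quadric = "complex \<times> complex \<times> complex"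

definition polar :: "quadric \<Rightarrow> complex \<times> complex \<Rightarrow> complex \<times> complex \<Rightarrow> complex" where
  "polar P \<xi> \<eta> = (case P of (p, m, n) \<Rightarrow>
     p * (fst \<xi> * snd \<eta> + snd \<xi> * fst \<eta>) - m * (snd \<xi> * snd \<eta>) + n * (fst \<xi> * fst \<eta>))"

definition discr :: "quadric \<Rightarrow> complex" where
  "discr P = (case P of (p, m, n) \<Rightarrow> p\<^sup>2 + m * n)"

text \<open>For \<open>discr P \<noteq> 0\<close>: the geodesic meets the axis of \<open>P\<close> orthogonally.\<close>

definition meets_perp :: "quadric \<Rightarrow> oriented_geodesic \<Rightarrow> bool" where
  "meets_perp P l \<longleftrightarrow> (\<exists>b. \<exists>\<mu>\<in>coord_domain. l = chart_of b \<mu> \<and> polar P (end_spinor b \<mu>) (begin_spinor b \<mu>) = 0)"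

text \<open>The equation \<open>polar P \<xi> \<eta> = 0\<close> in the coordinates \<open>A = \<mu>\<^sub>1\<close>, \<open>B = cnj \<mu>\<^sub>2\<close> of either chart.\<close>

definition graph_eq :: "bool \<Rightarrow> quadric \<Rightarrow> complex \<Rightarrow> complex \<Rightarrow> complex" where
  "graph_eq b P A B = (case P of (p, m, n) \<Rightarrow>
     if b then p * (A * B - 1) + m * B + n * A else p * (1 - A * B) + n * B + m * A)"

lemma polar_spinor: "polar P (end_spinor b \<mu>) (begin_spinor b \<mu>) = - graph_eq b P (fst \<mu>) (cnj (snd \<mu>))"
  by (cases P) (simp add: polar_def end_spinor_def begin_spinor_def graph_eq_def algebra_simps)

lemma meets_perp_chart:
  assumes "\<mu> \<in> coord_domain"
  shows "meets_perp P (chart_of b \<mu>) \<longleftrightarrow> graph_eq b P (fst \<mu>) (cnj (snd \<mu>)) = 0"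
proof
  assume "meets_perp P (chart_of b \<mu>)"
  then obtain c \<nu> where c: "\<nu> \<in> coord_domain" "chart_of b \<mu> = chart_of c \<nu>" "graph_eq c P (fst \<nu>) (cnj (snd \<nu>)) = 0"
    by (auto simp: meets_perp_def polar_spinor)
  show "graph_eq b P (fst \<mu>) (cnj (snd \<mu>)) = 0"
  proof (cases "b = c")
    case True
    then show ?thesis using chart_of_eq_iff[OF assms c(1,2)] c(3) by simp
  next
    case False
    then have nz: "fst \<mu> \<noteq> 0" "snd \<mu> \<noteq> 0" "\<nu> = (1 / fst \<mu>, 1 / snd \<mu>)"
      using chart_of_eq_iff[OF assms c(1,2)] by auto
    have "graph_eq b P (fst \<mu>) (cnj (snd \<mu>)) = fst \<mu> * cnj (snd \<mu>) * graph_eq c P (fst \<nu>) (cnj (snd \<nu>))"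
      using False nz by (cases P) (auto simp: graph_eq_def field_simps)
    then show ?thesis using c(3) by simp
  qed
qed (use assms in \<open>auto simp: meets_perp_def polar_spinor\<close>)

definition axis_quadric :: "complex \<times> complex \<Rightarrow> complex \<times> complex \<Rightarrow> quadric" where
  "axis_quadric \<xi>0 \<eta>0 = (- (fst \<xi>0 * snd \<eta>0 + snd \<xi>0 * fst \<eta>0), - 2 * fst \<xi>0 * fst \<eta>0, 2 * snd \<xi>0 * snd \<eta>0)"

lemma polar_axis_quadric: "polar (axis_quadric \<xi>0 \<eta>0) \<xi> \<eta> = perp_form \<xi>0 \<eta>0 \<xi> \<eta>"
  by (simp add: polar_def axis_quadric_def perp_form_def wedge_def algebra_simps)

lemma discr_axis_quadric: "discr (axis_quadric \<xi>0 \<eta>0) = (wedge \<xi>0 \<eta>0)\<^sup>2"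
  by (simp add: discr_def axis_quadric_def wedge_def algebra_simps power2_eq_square)

text \<open>The roots of the quadratic form. The sign of the square root is chosen such that the forward end is not 0, so that the
  axis has coordinates in the first chart.\<close>

lemma axis_of_quadric:
  assumes "discr P \<noteq> 0"
  obtains \<mu> c where "\<mu> \<in> coord_domain" "c \<noteq> 0"
    "\<And>\<xi> \<eta>. perp_form (end_spinor True \<mu>) (begin_spinor True \<mu>) \<xi> \<eta> = c * polar P \<xi> \<eta>"
proof -
  obtain p m n where P: "P = (p, m, n)" by (cases P)
  define \<mu> c where "\<mu> = (if n = 0 then (- m / (2 * p), 0) else
      let s = (if - p - csqrt (discr P) = 0 then - csqrt (discr P) else csqrt (discr P)) in
      ((p - s) / n, cnj (n / (- p - s))))"
    and "c = (if n = 0 then - 1 / p else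
      let s = (if - p - csqrt (discr P) = 0 then - csqrt (discr P) else csqrt (discr P)) in 2 / (- p - s))"
  show ?thesis
  proof (cases "n = 0")
    case True
    then have p: "p \<noteq> 0" using assms by (auto simp: P discr_def)
    show ?thesis
      by (rule that[of \<mu> c])
         (use p True in \<open>auto simp: \<mu>_def c_def P polar_def perp_form_def wedge_def end_spinor_def begin_spinor_def
            coord_domain_def field_simps\<close>)
  next
    case False
    define s where "s = (if - p - csqrt (discr P) = 0 then - csqrt (discr P) else csqrt (discr P))"
    have s2: "s\<^sup>2 = p\<^sup>2 + m * n" by (simp add: s_def P discr_def)
    have s0: "s \<noteq> 0" using assms by (simp add: s_def)
    have w0: "- p - s \<noteq> 0"
    proof
      assume a: "- p - s = 0"
      then have "- p + csqrt (discr P) = 0" "- p - csqrt (discr P) = 0" unfolding s_def by (auto split: if_splits)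
      then have "2 * csqrt (discr P) = 0" by (simp add: algebra_simps)
      then show False using assms by simp
    qed
    define w where "w = - p - s"
    have mu: "\<mu> = ((p - s) / n, cnj (n / w))" and c: "c = 2 / w"
      using False by (simp_all add: \<mu>_def c_def s_def w_def Let_def)
    have w: "w \<noteq> 0" using w0 by (simp add: w_def)
    have uw: "(p - s) * w = m * n"
      using s2 by (simp add: w_def algebra_simps power2_eq_square)
    show ?thesis
    proof (rule that[of \<mu> c])
      have "1 + (p - s) / n * (n / w) = - 2 * s / w"
      proof -
        have "(p - s) / n * (n / w) = (p - s) / w" using False by simp
        then have "1 + (p - s) / n * (n / w) = (w + (p - s)) / w" using w by (simp only: add_divide_distrib) simp
        also have "w + (p - s) = - 2 * s" by (simp add: w_def)
        finally show ?thesis .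
      qed
      then show "\<mu> \<in> coord_domain" using w s0 by (simp add: coord_domain_def mu)
      show "c \<noteq> 0" using w by (simp add: c)
      fix \<xi> \<eta> :: "complex \<times> complex"
      define x1 x2 y1 y2 where "x1 = fst \<xi>" and "x2 = snd \<xi>" and "y1 = fst \<eta>" and "y2 = snd \<eta>"
      have pw: "p - s = m * n / w" using uw w by (simp add: field_simps)
      have pe: "2 * p = m * n / w - w" using pw by (simp add: w_def algebra_simps)
      have e: "end_spinor True \<mu> = (1, n / w)" "begin_spinor True \<mu> = (- m / w, 1)"
        using False w by (simp_all add: end_spinor_def begin_spinor_def mu pw)
      have "w * w * perp_form (1, n / w) (- m / w, 1) \<xi> \<eta> = w * (2 * p * (x1 * y2 + x2 * y1) - 2 * m * (x2 * y2) + 2 * n * (x1 * y1))"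
        unfolding pe perp_form_def wedge_def x1_def[symmetric] x2_def[symmetric] y1_def[symmetric] y2_def[symmetric]
        using w by (simp add: field_simps)
      also have "\<dots> = w * w * (c * polar P \<xi> \<eta>)"
        using w by (simp add: c P polar_def x1_def x2_def y1_def y2_def algebra_simps)
      finally show "perp_form (end_spinor True \<mu>) (begin_spinor True \<mu>) \<xi> \<eta> = c * polar P \<xi> \<eta>"
        using w by (simp add: e)
    qed
  qed
qed

section \<open>Congruences in coordinates\<close>

text \<open>In the basis \<open>t\<close>, \<open>cnj t\<close> of complex-valued forms on the plane, the symmetry of \<open>h t + p cnj t\<close> says that the
  \<open>t\<close>-coefficient of \<open>p\<close> is conjugate to that of \<open>h\<close>, and the vanishing of the trace with respect to the metric
  \<open>Im (cnj Q t\<^sup>2)\<close> determines the other coefficient of \<open>p\<close>.\<close>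

lemma trace_free_imp_real:
  fixes h1 h2 :: real and p1 p2 t1 t2 Q :: complex
  assumes \<Delta>: "t1 * cnj t2 - t2 * cnj t1 \<noteq> 0"
    and sym: "h1 * t2 + p1 * cnj t2 = h2 * t1 + p2 * cnj t1"
    and tr: "Im (cnj Q * t2 * t2) * (h1 * t1 + p1 * cnj t1) - Im (cnj Q * t1 * t2) * (h1 * t2 + p1 * cnj t2)
       - Im (cnj Q * t1 * t2) * (h2 * t1 + p2 * cnj t1) + Im (cnj Q * t1 * t1) * (h2 * t2 + p2 * cnj t2) = 0"
  shows "Im (p1 * cnj Q) = 0" "Im (p2 * cnj Q) = 0"
proof -
  define d where "d = t1 * cnj t2 - t2 * cnj t1"
  have d: "d \<noteq> 0" using \<Delta> by (simp add: d_def)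
  define h where "h = (h1 * cnj t2 - h2 * cnj t1) / d"
  define k where "k = (h2 * t1 - h1 * t2) / d"
  define b where "b = (p1 * cnj t2 - p2 * cnj t1) / d"
  define g where "g = (p2 * t1 - p1 * t2) / d"
  have cd: "cnj d = - d" by (simp add: d_def)
  have "k = cnj h" unfolding h_def k_def complex_cnj_divide cd using d by (simp add: field_simps)
  then have h: "h1 = h * t1 + cnj h * cnj t1" "h2 = h * t2 + cnj h * cnj t2"
  proof -
    have "h * t1 + k * cnj t1 = h1 * d / d" "h * t2 + k * cnj t2 = h2 * d / d"
      unfolding h_def k_def times_divide_eq_left add_divide_distrib[symmetric] by (simp_all add: d_def algebra_simps)
    then show "h1 = h * t1 + cnj h * cnj t1" "h2 = h * t2 + cnj h * cnj t2"
      using d \<open>k = cnj h\<close> by simp_all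
  qed
  have p: "p1 = b * t1 + g * cnj t1" "p2 = b * t2 + g * cnj t2"
  proof -
    have "b * t1 + g * cnj t1 = p1 * d / d" "b * t2 + g * cnj t2 = p2 * d / d"
      unfolding b_def g_def times_divide_eq_left add_divide_distrib[symmetric] by (simp_all add: d_def algebra_simps)
    then show "p1 = b * t1 + g * cnj t1" "p2 = b * t2 + g * cnj t2" using d by simp_all
  qed
  have "(cnj h - b) * d = 0"
    using sym unfolding h p d_def by (simp add: algebra_simps)
  then have b: "b = cnj h" using d by simp
  have im: "complex_of_real (Im z) = (z - cnj z) / (2 * \<i>)" for z by (simp add: complex_eq_iff)
  have "Im (cnj Q * t2 * t2) * (h1 * t1 + p1 * cnj t1) - Im (cnj Q * t1 * t2) * (h1 * t2 + p1 * cnj t2)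
       - Im (cnj Q * t1 * t2) * (h2 * t1 + p2 * cnj t1) + Im (cnj Q * t1 * t1) * (h2 * t2 + p2 * cnj t2)
      = d\<^sup>2 * (cnj Q * g - Q * h) / (2 * \<i>)"
    unfolding im h p b d_def by (simp add: field_simps power2_eq_square)
  then have "cnj Q * g = Q * h" using tr d by simp
  then have g: "g * cnj Q = cnj (cnj h * cnj Q)" by (simp add: mult.commute)
  have "p1 * cnj Q = cnj h * cnj Q * t1 + cnj (cnj h * cnj Q * t1)" "p2 * cnj Q = cnj h * cnj Q * t2 + cnj (cnj h * cnj Q * t2)"
    unfolding p b distrib_right using g by (simp_all add: mult_ac)
  moreover have "Im (z + cnj z) = 0" for z by simp
  ultimately show "Im (p1 * cnj Q) = 0" "Im (p2 * cnj Q) = 0" by metis+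
qed

lemma linear_R2_zero:
  fixes L :: "R2 \<Rightarrow> 'a::real_vector"
  assumes "linear L" "L (1,0) = 0" "L (0,1) = 0"
  shows "L v = 0"
proof -
  have "v = fst v *\<^sub>R (1,0) + snd v *\<^sub>R (0,1)" by (simp add: prod_eq_iff)
  then have "L v = L (fst v *\<^sub>R (1,0) + snd v *\<^sub>R (0,1))" by (rule arg_cong)
  also have "\<dots> = fst v *\<^sub>R L (1,0) + snd v *\<^sub>R L (0,1)"
    by (simp only: linear_add[OF assms(1)] linear_cmul[OF assms(1)])
  finally show ?thesis using assms by simp
qed

text \<open>A congruence of geodesics in coordinates. The forms \<open>a = dA / D\<close> and \<open>b = dB / D\<close> are the null forms of the holomorphic
  metric, \<open>ca\<close> and \<open>cb\<close> are the components of the covariant second derivative, and \<open>kap\<close> is the connection form.\<close>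

locale C2_coords =
  fixes V :: "R2 set" and F :: "R2 \<Rightarrow> coords"
  assumes openV: "open V" and C2: "C_k_on 2 F V" and dom: "\<And>p. p \<in> V \<Longrightarrow> F p \<in> coord_domain"
begin

definition A :: "R2 \<Rightarrow> complex" where "A p = fst (F p)"
definition B :: "R2 \<Rightarrow> complex" where "B p = cnj (snd (F p))"
definition D :: "R2 \<Rightarrow> complex" where "D p = 1 + A p * B p"
definition dA :: "R2 \<Rightarrow> R2 \<Rightarrow> complex" where "dA p w = fst (frechet_derivative F (at p) w)"
definition dB :: "R2 \<Rightarrow> R2 \<Rightarrow> complex" where "dB p w = cnj (snd (frechet_derivative F (at p) w))"
definition ddA :: "R2 \<Rightarrow> R2 \<Rightarrow> R2 \<Rightarrow> complex" where
  "ddA p v w = fst (frechet_derivative (\<lambda>q. frechet_derivative F (at q) w) (at p) v)"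
definition ddB :: "R2 \<Rightarrow> R2 \<Rightarrow> R2 \<Rightarrow> complex" where
  "ddB p v w = cnj (snd (frechet_derivative (\<lambda>q. frechet_derivative F (at q) w) (at p) v))"

lemma F_has_derivative: "p \<in> V \<Longrightarrow> (F has_derivative frechet_derivative F (at p)) (at p)"
  and dF_has_derivative: "p \<in> V \<Longrightarrow> ((\<lambda>q. frechet_derivative F (at q) w) has_derivative
    frechet_derivative (\<lambda>q. frechet_derivative F (at q) w) (at p)) (at p)"
proof -
  have S: "C_k_on (Suc (Suc 0)) F V" using C2 by (simp only: numeral_2_eq_2)
  then have "C_k_on (Suc 0) (\<lambda>q. frechet_derivative F (at q) w) V"
    unfolding C_k_on.simps(2)[of "Suc 0"] by blast
  with S show "p \<in> V \<Longrightarrow> (F has_derivative frechet_derivative F (at p)) (at p)"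
    "p \<in> V \<Longrightarrow> ((\<lambda>q. frechet_derivative F (at q) w) has_derivative
    frechet_derivative (\<lambda>q. frechet_derivative F (at q) w) (at p)) (at p)"
    using C_k_on_Suc_has_derivative openV by blast+
qed

lemma linear_dF: "p \<in> V \<Longrightarrow> linear (frechet_derivative F (at p))"
  using F_has_derivative has_derivative_linear by blast

lemma D_nz: "p \<in> V \<Longrightarrow> D p \<noteq> 0"
  using dom by (simp add: D_def A_def B_def coord_domain_def)

lemma A_deriv: "p \<in> V \<Longrightarrow> (A has_derivative dA p) (at p)"
  unfolding A_def[abs_def] dA_def[abs_def] by (intro has_derivative_fst F_has_derivative)
lemma B_deriv: "p \<in> V \<Longrightarrow> (B has_derivative dB p) (at p)"
  unfolding B_def[abs_def] dB_def[abs_def] by (intro has_derivative_cnj has_derivative_snd F_has_derivative)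
lemma dA_deriv: "p \<in> V \<Longrightarrow> ((\<lambda>q. dA q w) has_derivative (\<lambda>v. ddA p v w)) (at p)"
  unfolding dA_def[abs_def] ddA_def[abs_def] by (intro has_derivative_fst dF_has_derivative)
lemma dB_deriv: "p \<in> V \<Longrightarrow> ((\<lambda>q. dB q w) has_derivative (\<lambda>v. ddB p v w)) (at p)"
  unfolding dB_def[abs_def] ddB_def[abs_def] by (intro has_derivative_cnj has_derivative_snd dF_has_derivative)

lemma ddA_sym: "p \<in> V \<Longrightarrow> ddA p v w = ddA p w v"
  using second_derivative_symmetric[OF openV _ A_deriv dA_deriv dA_deriv] by metis
lemma ddB_sym: "p \<in> V \<Longrightarrow> ddB p v w = ddB p w v"
  using second_derivative_symmetric[OF openV _ B_deriv dB_deriv dB_deriv] by metis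

lemma linear_dA: "p \<in> V \<Longrightarrow> linear (dA p)" using A_deriv has_derivative_linear by blast
lemma linear_dB: "p \<in> V \<Longrightarrow> linear (dB p)" using B_deriv has_derivative_linear by blast

definition a :: "R2 \<Rightarrow> R2 \<Rightarrow> complex" where "a p w = dA p w / D p"
definition b :: "R2 \<Rightarrow> R2 \<Rightarrow> complex" where "b p w = dB p w / D p"
definition ca :: "R2 \<Rightarrow> R2 \<Rightarrow> R2 \<Rightarrow> complex" where "ca p v w = ddA p v w / D p - 2 * B p * a p v * a p w"
definition cb :: "R2 \<Rightarrow> R2 \<Rightarrow> R2 \<Rightarrow> complex" where "cb p v w = ddB p v w / D p - 2 * A p * b p v * b p w"
definition kap :: "R2 \<Rightarrow> R2 \<Rightarrow> complex" where "kap p w = B p * a p w - A p * b p w"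

lemma dA_a: "p \<in> V \<Longrightarrow> dA p w = a p w * D p" and dB_b: "p \<in> V \<Longrightarrow> dB p w = b p w * D p"
  using D_nz by (simp_all add: a_def b_def)

lemma ca_sym: "p \<in> V \<Longrightarrow> ca p v w = ca p w v" and cb_sym: "p \<in> V \<Longrightarrow> cb p v w = cb p w v"
  by (simp_all add: ca_def cb_def ddA_sym[of p v w] ddB_sym[of p v w] mult_ac)

lemma linear_a: "p \<in> V \<Longrightarrow> linear (a p)" and linear_b: "p \<in> V \<Longrightarrow> linear (b p)"
  using linear_dA[of p] linear_dB[of p] unfolding a_def[abs_def] b_def[abs_def]
  by (simp_all add: linear_iff add_divide_distrib scaleR_conv_of_real)

lemma D_deriv: "p \<in> V \<Longrightarrow> (D has_derivative (\<lambda>v. D p * (B p * a p v + A p * b p v))) (at p)"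
  unfolding D_def[abs_def]
  by (rule has_derivative_eq_rhs, (rule derivative_intros A_deriv B_deriv | assumption)+)
     (simp add: fun_eq_iff dA_a dB_b D_def algebra_simps)

lemma a_deriv: "p \<in> V \<Longrightarrow> ((\<lambda>q. a q w) has_derivative (\<lambda>v. ca p v w + kap p v * a p w)) (at p)"
proof -
  assume p: "p \<in> V"
  have "((\<lambda>q. dA q w / D q) has_derivative (\<lambda>v. (ddA p v w * D p - dA p w * (D p * (B p * a p v + A p * b p v))) / (D p * D p))) (at p)"
    by (rule has_derivative_divide'[OF dA_deriv[OF p] D_deriv[OF p] D_nz[OF p]])
  moreover have "(ddA p v w * D p - dA p w * (D p * (B p * a p v + A p * b p v))) / (D p * D p) = ca p v w + kap p v * a p w" for v
    unfolding dA_a[OF p] ca_def kap_def using D_nz[OF p] by (simp add: field_simps)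
  ultimately show ?thesis by (simp add: a_def)
qed

lemma b_deriv: "p \<in> V \<Longrightarrow> ((\<lambda>q. b q w) has_derivative (\<lambda>v. cb p v w - kap p v * b p w)) (at p)"
proof -
  assume p: "p \<in> V"
  have "((\<lambda>q. dB q w / D q) has_derivative (\<lambda>v. (ddB p v w * D p - dB p w * (D p * (B p * a p v + A p * b p v))) / (D p * D p))) (at p)"
    by (rule has_derivative_divide'[OF dB_deriv[OF p] D_deriv[OF p] D_nz[OF p]])
  moreover have "(ddB p v w * D p - dB p w * (D p * (B p * a p v + A p * b p v))) / (D p * D p) = cb p v w - kap p v * b p w" for v
    unfolding dB_b[OF p] cb_def kap_def using D_nz[OF p] by (simp add: field_simps)
  ultimately show ?thesis by (simp add: b_def)
qed

definition dkap :: "R2 \<Rightarrow> R2 \<Rightarrow> R2 \<Rightarrow> complex" where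
  "dkap p v w = dB p v * a p w + B p * (ca p v w + kap p v * a p w) - (dA p v * b p w + A p * (cb p v w - kap p v * b p w))"

lemma kap_deriv: "p \<in> V \<Longrightarrow> ((\<lambda>q. kap q w) has_derivative (\<lambda>v. dkap p v w)) (at p)"
  unfolding kap_def dkap_def
  by (rule has_derivative_eq_rhs, (rule derivative_intros A_deriv B_deriv a_deriv b_deriv | assumption)+)
     (simp add: fun_eq_iff kap_def algebra_simps)

text \<open>The curvature of the holomorphic metric: \<open>d\<kappa> = - 2 dA \<and> dB / D\<^sup>2\<close>.\<close>

lemma dkap_antisym: "p \<in> V \<Longrightarrow> dkap p v w - dkap p w v = 2 * (a p w * b p v - a p v * b p w)"
  unfolding dkap_def kap_def ca_sym[of p w v] cb_sym[of p w v]
  by (simp add: dA_a dB_b D_def algebra_simps)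

lemma induced_metric_ab:
  "p \<in> V \<Longrightarrow> induced_metric neutral_metric F p v w = Im (a p v * b p w + a p w * b p v)"
  using D_nz[of p] unfolding induced_metric_def neutral_metric_eq_Im a_def b_def dA_def[symmetric] dB_def[symmetric]
    A_def[symmetric] B_def[symmetric] D_def[symmetric]
  by (simp add: power2_eq_square add_divide_distrib)

lemma covariant_second_ab:
  assumes "p \<in> V"
  shows "fst (covariant_second F p v w) = D p * ca p v w" "cnj (snd (covariant_second F p v w)) = D p * cb p v w"
proof -
  have "1 + cnj (fst (F p)) * snd (F p) = cnj (D p)" by (simp add: D_def A_def B_def)
  then show "fst (covariant_second F p v w) = D p * ca p v w" "cnj (snd (covariant_second F p v w)) = D p * cb p v w"
    using D_nz[OF assms] dA_a[OF assms] dB_b[OF assms]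
    unfolding covariant_second_def neutral_christoffel_def ca_def cb_def
    by (simp_all add: ddA_def[symmetric] ddB_def[symmetric] dA_def[symmetric] dB_def[symmetric]
        A_def[symmetric] B_def[symmetric] D_def[symmetric] field_simps)
qed

end

section \<open>Maximal normal congruences\<close>

text \<open>The assumption on \<open>R'\<close> expresses that the surface at position \<open>R\<close> on the geodesics is orthogonal to them, and \<open>inj\<close>
  that it is immersed. Both are derived from these properties in \<open>congruence_patch\<close> below.\<close>

locale maximal_congruence = C2_coords +
  fixes R :: "R2 \<Rightarrow> real" and R' :: "R2 \<Rightarrow> R2 \<Rightarrow> real"
  assumes Rpos: "\<And>p. p \<in> V \<Longrightarrow> R p > 0"
    and R_deriv: "\<And>p. p \<in> V \<Longrightarrow> (R has_derivative R' p) (at p)"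
    and R'_eq: "\<And>p w. p \<in> V \<Longrightarrow> R' p w = R p * Re (kap p w)"
    and inj: "\<And>p w. p \<in> V \<Longrightarrow> R p * cnj (b p w) - a p w / R p = 0 \<Longrightarrow> w = 0"
    and nondeg: "\<And>p. p \<in> V \<Longrightarrow> induced_det neutral_metric F p \<noteq> 0"
    and minimal: "\<And>p. p \<in> V \<Longrightarrow> mean_curvature_vector neutral_metric F p = 0"
begin

abbreviation (input) "e1 \<equiv> (1, 0) :: R2"
abbreviation (input) "e2 \<equiv> (0, 1) :: R2"

text \<open>The forms \<open>\<alpha>\<close>, \<open>\<beta>\<close>, the coframe \<open>\<theta>\<close> and the shape operator applied to it, followed by covariant derivatives.\<close>

definition al :: "R2 \<Rightarrow> R2 \<Rightarrow> complex" where "al p w = - a p w / R p"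
definition be :: "R2 \<Rightarrow> R2 \<Rightarrow> complex" where "be p w = R p * b p w"
definition th :: "R2 \<Rightarrow> R2 \<Rightarrow> complex" where "th p w = al p w + cnj (be p w)"
definition pi' :: "R2 \<Rightarrow> R2 \<Rightarrow> complex" where "pi' p w = al p w - cnj (be p w)"
definition cal :: "R2 \<Rightarrow> R2 \<Rightarrow> R2 \<Rightarrow> complex" where "cal p v w = - ca p v w / R p"
definition cbe :: "R2 \<Rightarrow> R2 \<Rightarrow> R2 \<Rightarrow> complex" where "cbe p v w = R p * cb p v w"

lemma cal_sym: "p \<in> V \<Longrightarrow> cal p v w = cal p w v" and cbe_sym: "p \<in> V \<Longrightarrow> cbe p v w = cbe p w v"
  by (simp_all add: cal_def cbe_def ca_sym[of p v w] cb_sym[of p v w])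

lemma R_deriv_complex: "p \<in> V \<Longrightarrow> ((\<lambda>q. complex_of_real (R q)) has_derivative (\<lambda>v. R p * complex_of_real (Re (kap p v)))) (at p)"
  using has_derivative_of_real[OF R_deriv, of p, where 'a=complex] R'_eq[of p] by simp

lemma al_deriv: "p \<in> V \<Longrightarrow> ((\<lambda>q. al q w) has_derivative (\<lambda>v. cal p v w + \<i> * Im (kap p v) * al p w)) (at p)"
proof -
  assume p: "p \<in> V"
  have r: "complex_of_real (R p) \<noteq> 0" using Rpos[OF p] by simp
  have der: "((\<lambda>q. a q w / of_real (R q)) has_derivative (\<lambda>v. ((ca p v w + kap p v * a p w) * R p - a p w * (R p * complex_of_real (Re (kap p v)))) / (complex_of_real (R p) * complex_of_real (R p)))) (at p)"
    using has_derivative_divide'[OF a_deriv[OF p] R_deriv_complex[OF p] r] by simp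
  have eq: "(\<lambda>q. al q w) = (\<lambda>q. - (a q w / of_real (R q)))" by (simp add: al_def)
  show ?thesis unfolding eq
  proof (rule has_derivative_eq_rhs[OF has_derivative_minus[OF der]], intro ext)
    fix v
    have k: "kap p v = complex_of_real (Re (kap p v)) + \<i> * Im (kap p v)" by (simp add: complex_eq_iff)
    have gen: "- (((c + (x + y) * aa) * r - aa * (r * x)) / (r * r)) = - c / r + y * (- aa / r)" if "r \<noteq> 0" for c x y aa r :: complex
      using that by (simp add: field_simps)
    show "- (((ca p v w + kap p v * a p w) * R p - a p w * (R p * complex_of_real (Re (kap p v)))) / (complex_of_real (R p) * complex_of_real (R p))) = cal p v w + \<i> * Im (kap p v) * al p w"
      unfolding cal_def al_def using gen[OF r, of "ca p v w" "complex_of_real (Re (kap p v))" "\<i> * Im (kap p v)" "a p w"] unfolding k[symmetric] .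
  qed
qed

lemma be_deriv: "p \<in> V \<Longrightarrow> ((\<lambda>q. be q w) has_derivative (\<lambda>v. cbe p v w - \<i> * Im (kap p v) * be p w)) (at p)"
proof -
  assume p: "p \<in> V"
  from has_derivative_mult[OF R_deriv_complex[OF p] b_deriv[OF p]]
  show ?thesis unfolding be_def
  proof (rule has_derivative_eq_rhs, intro ext)
    fix v
    have k: "kap p v = complex_of_real (Re (kap p v)) + \<i> * Im (kap p v)" by (simp add: complex_eq_iff)
    have gen: "r * (c - (x + y) * aa) + (r * x) * aa = r * c - y * (r * aa)" for c x y aa r :: complex
      by (simp add: algebra_simps)
    show "R p * (cb p v w - kap p v * b p w) + R p * complex_of_real (Re (kap p v)) * b p w = cbe p v w - \<i> * Im (kap p v) * (R p * b p w)"
      unfolding cbe_def using gen[of "R p" "cb p v w" "complex_of_real (Re (kap p v))" "\<i> * Im (kap p v)" "b p w"] unfolding k[symmetric] .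
  qed
qed

lemma th_deriv: "p \<in> V \<Longrightarrow> ((\<lambda>q. th q w) has_derivative (\<lambda>v. (cal p v w + cnj (cbe p v w)) + \<i> * Im (kap p v) * th p w)) (at p)"
  unfolding th_def
  by (rule has_derivative_eq_rhs[OF has_derivative_add[OF al_deriv has_derivative_cnj[OF be_deriv]]])
     (auto simp: fun_eq_iff algebra_simps)

lemma pi_deriv: "p \<in> V \<Longrightarrow> ((\<lambda>q. pi' q w) has_derivative (\<lambda>v. (cal p v w - cnj (cbe p v w)) + \<i> * Im (kap p v) * pi' p w)) (at p)"
  unfolding pi'_def
  by (rule has_derivative_eq_rhs[OF has_derivative_diff[OF al_deriv has_derivative_cnj[OF be_deriv]]])
     (auto simp: fun_eq_iff algebra_simps)

lemma linear_al: "p \<in> V \<Longrightarrow> linear (al p)" and linear_be: "p \<in> V \<Longrightarrow> linear (be p)"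
  using linear_a[of p] linear_b[of p] unfolding al_def[abs_def] be_def[abs_def]
  by (simp_all add: linear_iff add_divide_distrib diff_divide_distrib scaleR_conv_of_real algebra_simps)

lemma linear_th: "p \<in> V \<Longrightarrow> linear (th p)" and linear_pi: "p \<in> V \<Longrightarrow> linear (pi' p)"
  using linear_al[of p] linear_be[of p] unfolding th_def[abs_def] pi'_def[abs_def]
  by (simp_all add: linear_iff scaleR_conv_of_real algebra_simps)

lemma th_inj: "p \<in> V \<Longrightarrow> th p w = 0 \<Longrightarrow> w = 0"
  using inj[of p w] by (simp add: th_def al_def be_def)

lemma ab_albe: "p \<in> V \<Longrightarrow> a p v * b p w = - (al p v * be p w)"
  using Rpos[of p] by (simp add: al_def be_def)

text \<open>The real part of \<open>\<kappa>\<close> is exact with potential \<open>log R\<close>. Hence the real part of its curvature vanishes, which says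
  that the symplectic form vanishes on the congruence.\<close>

lemma lagrangian: "p \<in> V \<Longrightarrow> Re (a p v * b p w - a p w * b p v) = 0"
proof -
  assume p: "p \<in> V"
  have ln: "((\<lambda>q. ln (R q)) has_derivative (\<lambda>w. Re (kap q w))) (at q)" if "q \<in> V" for q
    by (rule has_derivative_eq_rhs[OF has_derivative_ln[OF Rpos[OF that] R_deriv[OF that]]])
       (use Rpos[OF that] in \<open>auto simp: fun_eq_iff R'_eq[OF that]\<close>)
  have "Re (dkap p w v) = Re (dkap p v w)"
    using second_derivative_symmetric[OF openV p ln has_derivative_Re[OF kap_deriv[OF p]] has_derivative_Re[OF kap_deriv[OF p]]] .
  then have "Re (dkap p v w - dkap p w v) = 0" by simp
  then show ?thesis unfolding dkap_antisym[OF p] by simp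
qed

text \<open>The shape operator, decomposed into its complex linear part \<open>H\<close> and its complex antilinear part \<open>Q\<close> by Cramer's
  rule: the principal curvatures are \<open>H \<plusminus> |Q|\<close>, and \<open>H\<close> is real since the shape operator is symmetric.\<close>

definition Del :: "R2 \<Rightarrow> complex" where "Del p = th p e1 * cnj (th p e2) - th p e2 * cnj (th p e1)"
definition H :: "R2 \<Rightarrow> complex" where "H p = (pi' p e1 * cnj (th p e2) - pi' p e2 * cnj (th p e1)) / Del p"
definition Q :: "R2 \<Rightarrow> complex" where "Q p = (pi' p e2 * th p e1 - pi' p e1 * th p e2) / Del p"

lemma Del_nz: "p \<in> V \<Longrightarrow> Del p \<noteq> 0"
proof
  assume p: "p \<in> V" and z: "Del p = 0"
  have "Im (th p e1 * cnj (th p e2)) = 0" using arg_cong[OF z[unfolded Del_def], of Im] by (simp add: algebra_simps)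
  then have r: "Re (th p e1) * Im (th p e2) = Im (th p e1) * Re (th p e2)" by (simp add: algebra_simps)
  have lin: "th p (x *\<^sub>R e1 + y *\<^sub>R e2) = x *\<^sub>R th p e1 + y *\<^sub>R th p e2" for x y
    by (simp only: linear_add[OF linear_th[OF p]] linear_cmul[OF linear_th[OF p]])
  have "th p (Re (th p e2) *\<^sub>R e1 + (- Re (th p e1)) *\<^sub>R e2) = 0" "th p (Im (th p e2) *\<^sub>R e1 + (- Im (th p e1)) *\<^sub>R e2) = 0"
    unfolding lin using r by (simp_all add: complex_eq_iff mult.commute)
  from th_inj[OF p this(1)] th_inj[OF p this(2)] have "th p e1 = 0" by (simp add: complex_eq_iff zero_prod_def)
  from th_inj[OF p this] show False by (simp add: zero_prod_def)
qed

lemma pi_eq: "p \<in> V \<Longrightarrow> pi' p w = H p * th p w + Q p * cnj (th p w)"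
proof -
  assume p: "p \<in> V"
  have e: "pi' p e1 = H p * th p e1 + Q p * cnj (th p e1)" "pi' p e2 = H p * th p e2 + Q p * cnj (th p e2)"
  proof -
    have "(H p * th p e1 + Q p * cnj (th p e1)) * Del p = pi' p e1 * Del p"
      "(H p * th p e2 + Q p * cnj (th p e2)) * Del p = pi' p e2 * Del p"
    proof -
      have HQ: "H p * Del p = pi' p e1 * cnj (th p e2) - pi' p e2 * cnj (th p e1)" "Q p * Del p = pi' p e2 * th p e1 - pi' p e1 * th p e2"
        using Del_nz[OF p] by (simp_all add: H_def Q_def)
      have ex: "(H p * x + Q p * y) * Del p = (H p * Del p) * x + (Q p * Del p) * y" for x y by (simp add: algebra_simps)
      show "(H p * th p e1 + Q p * cnj (th p e1)) * Del p = pi' p e1 * Del p"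
        "(H p * th p e2 + Q p * cnj (th p e2)) * Del p = pi' p e2 * Del p"
        unfolding ex HQ by (simp_all add: Del_def algebra_simps)
    qed
    then show "pi' p e1 = H p * th p e1 + Q p * cnj (th p e1)" "pi' p e2 = H p * th p e2 + Q p * cnj (th p e2)"
      using Del_nz[OF p] by simp_all
  qed
  have "linear (\<lambda>w. pi' p w - (H p * th p w + Q p * cnj (th p w)))"
    using linear_th[OF p] linear_pi[OF p]
    by (simp add: linear_iff scaleR_conv_of_real algebra_simps)
  from linear_R2_zero[OF this] e show ?thesis by simp
qed

lemma al_eq: "p \<in> V \<Longrightarrow> al p w = ((1 + H p) * th p w + Q p * cnj (th p w)) / 2"
  and be_eq: "p \<in> V \<Longrightarrow> be p w = cnj ((1 - H p) * th p w - Q p * cnj (th p w)) / 2"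
proof -
  assume p: "p \<in> V"
  have "al p w = (th p w + pi' p w) / 2" "be p w = cnj (th p w - pi' p w) / 2" by (simp_all add: th_def pi'_def)
  then show "al p w = ((1 + H p) * th p w + Q p * cnj (th p w)) / 2" "be p w = cnj ((1 - H p) * th p w - Q p * cnj (th p w)) / 2"
    unfolding pi_eq[OF p] by (simp_all add: algebra_simps)
qed

lemma H_real: "p \<in> V \<Longrightarrow> cnj (H p) = H p"
proof -
  assume p: "p \<in> V"
  define N where "N = pi' p e1 * cnj (th p e2) - pi' p e2 * cnj (th p e1)"
  have "N + cnj N = 2 * of_real (Re N)" by (simp add: complex_eq_iff)
  also have "Re N = 2 * Re (al p e1 * be p e2 - al p e2 * be p e1)"
    by (simp add: N_def pi'_def th_def algebra_simps)
  also have "\<dots> = 0" using lagrangian[OF p, of e1 e2] unfolding ab_albe[OF p] by simp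
  finally have "cnj N = - N" by (simp add: add_eq_0_iff)
  moreover have "cnj (Del p) = - Del p" by (simp add: Del_def)
  ultimately show ?thesis unfolding H_def N_def[symmetric] by simp
qed

text \<open>The null directions of the induced metric are those with \<open>\<theta>\<^sup>2\<close> a real multiple of \<open>Q\<close>: the principal directions.\<close>

lemma metric_Q: "p \<in> V \<Longrightarrow> induced_metric neutral_metric F p v w = Im (cnj (Q p) * th p v * th p w)"
proof -
  assume p: "p \<in> V"
  define h where "h = Re (H p)"
  have h: "H p = complex_of_real h" using H_real[OF p] by (simp add: h_def complex_eq_iff)
  define X where "X = (1 - H p * H p - Q p * cnj (Q p)) * (th p v * cnj (th p w) + th p w * cnj (th p v))"
  define Z where "Z = cnj (Q p) * th p v * th p w"
  have "4 * (al p v * be p w + al p w * be p v) = X - 2 * (1 + H p) * Z + 2 * (1 - H p) * cnj Z"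
    unfolding al_eq[OF p] be_eq[OF p] X_def Z_def using H_real[OF p] by (simp add: field_simps)
  moreover have "cnj X = X" using H_real[OF p] by (simp add: X_def algebra_simps)
  then have "Im X = 0" by (simp add: complex_eq_iff)
  ultimately have "Im (4 * (al p v * be p w + al p w * be p v)) = - 4 * Im Z"
    by (simp only: h) (simp add: algebra_simps)
  then have "Im (4 * (al p v * be p w + al p w * be p v)) = - 4 * Im (cnj (Q p) * th p v * th p w)"
    by (simp only: Z_def)
  then show ?thesis unfolding induced_metric_ab[OF p] ab_albe[OF p] by simp
qed

lemma Q_nz: "p \<in> V \<Longrightarrow> Q p \<noteq> 0"
  using nondeg[of p] by (auto simp: induced_det_def metric_Q)

lemma H_differentiable: "p \<in> V \<Longrightarrow> H differentiable (at p)" and Q_differentiable: "p \<in> V \<Longrightarrow> Q differentiable (at p)"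
proof -
  assume p: "p \<in> V"
  have d: "(\<lambda>q. th q w) differentiable (at p)" "(\<lambda>q. cnj (th q w)) differentiable (at p)" "(\<lambda>q. pi' q w) differentiable (at p)" for w
    using th_deriv[OF p] pi_deriv[OF p] has_derivative_cnj[OF th_deriv[OF p]] unfolding differentiable_def by blast+
  show "H differentiable (at p)" "Q differentiable (at p)"
    using Del_nz[OF p] unfolding H_def[abs_def] Q_def[abs_def] Del_def[abs_def] by (auto intro!: d derivative_intros)
qed

definition dH :: "R2 \<Rightarrow> R2 \<Rightarrow> complex" where "dH p = frechet_derivative H (at p)"
definition dQ :: "R2 \<Rightarrow> R2 \<Rightarrow> complex" where "dQ p = frechet_derivative Q (at p)"

lemma H_deriv: "p \<in> V \<Longrightarrow> (H has_derivative dH p) (at p)" and Q_deriv: "p \<in> V \<Longrightarrow> (Q has_derivative dQ p) (at p)"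
  unfolding dH_def dQ_def using H_differentiable Q_differentiable by (simp_all add: frechet_derivative_works)

lemma dH_real: "p \<in> V \<Longrightarrow> dH p v = complex_of_real (Re (dH p v))"
proof -
  assume p: "p \<in> V"
  have "((\<lambda>q. cnj (H q)) has_derivative dH p) (at p)"
    by (rule has_derivative_transform_within_open[OF H_deriv[OF p] openV p]) (simp add: H_real)
  from has_derivative_unique[OF this has_derivative_cnj[OF H_deriv[OF p]]]
  have "dH p v = cnj (dH p v)" by (rule fun_cong)
  then show ?thesis by (simp add: complex_eq_iff)
qed

text \<open>This linear combination of covariant derivatives vanishes on tangent vectors of the congruence.\<close>

definition Lf :: "R2 \<Rightarrow> R2 \<Rightarrow> R2 \<Rightarrow> complex" where
  "Lf p v w = (cal p v w - cnj (cbe p v w)) - H p * (cal p v w + cnj (cbe p v w)) - Q p * cnj (cal p v w + cnj (cbe p v w))"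

text \<open>The covariant derivative of \<open>Q\<close>, a section of the square of the tangent bundle of the surface.\<close>

definition nQ :: "R2 \<Rightarrow> R2 \<Rightarrow> complex" where "nQ p v = dQ p v - 2 * \<i> * Im (kap p v) * Q p"

text \<open>Differentiating \<open>pi_eq\<close>. The symmetry of the right-hand side is the Codazzi equation.\<close>

lemma Lf_eq: "p \<in> V \<Longrightarrow> Lf p v w = dH p v * th p w + nQ p v * cnj (th p w)"
proof -
  assume p: "p \<in> V"
  have 1: "((\<lambda>q. pi' q w) has_derivative (\<lambda>v. H p * ((cal p v w + cnj (cbe p v w)) + \<i> * Im (kap p v) * th p w) + dH p v * th p w
     + (Q p * cnj ((cal p v w + cnj (cbe p v w)) + \<i> * Im (kap p v) * th p w) + dQ p v * cnj (th p w)))) (at p)"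
    by (rule has_derivative_transform_within_open[OF has_derivative_add[OF
          has_derivative_mult[OF H_deriv[OF p] th_deriv[OF p]]
          has_derivative_mult[OF Q_deriv[OF p] has_derivative_cnj[OF th_deriv[OF p]]]] openV p])
       (simp add: pi_eq)
  from fun_cong[OF has_derivative_unique[OF 1 pi_deriv[OF p]], of v]
  show ?thesis unfolding Lf_def nQ_def pi_eq[OF p] by (simp add: algebra_simps)
qed

lemma Lf_sym: "p \<in> V \<Longrightarrow> Lf p v w = Lf p w v"
  by (simp add: Lf_def cal_sym[of p v w] cbe_sym[of p v w])

lemma trace_zero:
  assumes p: "p \<in> V"
  defines "g \<equiv> induced_metric neutral_metric F p"
  shows "g e2 e2 * Lf p e1 e1 - g e1 e2 * Lf p e1 e2 - g e1 e2 * Lf p e2 e1 + g e1 e1 * Lf p e2 e2 = 0"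
proof -
  define W where "W = covariant_second F p"
  obtain u where u: "g e2 e2 *\<^sub>R W e1 e1 - g e1 e2 *\<^sub>R W e1 e2 - g e1 e2 *\<^sub>R W e2 e1 + g e1 e1 *\<^sub>R W e2 e2
      = frechet_derivative F (at p) u"
    using mean_curvature_zero_imp_tangent[OF dom[OF p] linear_dF[OF p] nondeg[OF p] minimal[OF p]] unfolding g_def W_def by blast
  define S where "S c = of_real (g e2 e2) * c e1 e1 - of_real (g e1 e2) * c e1 e2 - of_real (g e1 e2) * c e2 e1 + of_real (g e1 e1) * c e2 e2"
    for c :: "R2 \<Rightarrow> R2 \<Rightarrow> complex"
  have D: "D p \<noteq> 0" using D_nz[OF p] .
  have r: "complex_of_real (R p) \<noteq> 0" using Rpos[OF p] by simp
  have "D p * S (ca p) = D p * a p u"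
    using arg_cong[OF u, of fst] unfolding S_def dA_def[symmetric] dA_a[OF p] W_def
    by (simp add: covariant_second_ab[OF p] scaleR_conv_of_real algebra_simps)
  then have "S (ca p) = a p u" using D by simp
  moreover have "S (cal p) = - S (ca p) / R p"
    by (simp add: S_def cal_def algebra_simps add_divide_distrib diff_divide_distrib)
  ultimately have 1: "S (cal p) = al p u" by (simp add: al_def)
  have "D p * S (cb p) = D p * b p u"
    using arg_cong[OF u, of "\<lambda>x. cnj (snd x)"] unfolding S_def dB_def[symmetric] dB_b[OF p] W_def
    by (simp add: covariant_second_ab[OF p] scaleR_conv_of_real algebra_simps)
  then have "S (cb p) = b p u" using D by simp
  moreover have "S (cbe p) = R p * S (cb p)" by (simp add: S_def cbe_def algebra_simps)
  ultimately have 2: "S (cbe p) = be p u" by (simp add: be_def)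
  have "S (Lf p) = (S (cal p) - cnj (S (cbe p))) - H p * (S (cal p) + cnj (S (cbe p))) - Q p * cnj (S (cal p) + cnj (S (cbe p)))"
    by (simp add: S_def Lf_def algebra_simps)
  also have "\<dots> = pi' p u - H p * th p u - Q p * cnj (th p u)" unfolding 1 2 by (simp add: pi'_def th_def)
  also have "\<dots> = 0" by (simp add: pi_eq[OF p])
  finally show ?thesis by (simp add: S_def)
qed

lemma linear_kap: "p \<in> V \<Longrightarrow> linear (kap p)"
  using linear_a[of p] linear_b[of p] unfolding kap_def[abs_def]
  by (simp add: linear_iff scaleR_conv_of_real algebra_simps)

text \<open>The argument of \<open>Q\<close> is parallel: the principal directions have no geodesic curvature.\<close>

lemma nQ_real: "p \<in> V \<Longrightarrow> Im (nQ p v * cnj (Q p)) = 0"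
proof -
  assume p: "p \<in> V"
  have "Im (nQ p e1 * cnj (Q p)) = 0 \<and> Im (nQ p e2 * cnj (Q p)) = 0"
    using trace_free_imp_real[of "th p e1" "th p e2" "Re (dH p e1)" "nQ p e1" "Re (dH p e2)" "nQ p e2" "Q p"]
      Del_nz[OF p, unfolded Del_def] Lf_sym[OF p, of e1 e2] trace_zero[OF p]
    unfolding Lf_eq[OF p] metric_Q[OF p] dH_real[OF p, symmetric] by blast
  moreover have "linear (\<lambda>v. Im (nQ p v * cnj (Q p)))"
    using has_derivative_linear[OF Q_deriv[OF p]] linear_kap[OF p]
    by (simp add: linear_iff nQ_def algebra_simps)
  ultimately show ?thesis using linear_R2_zero[of "\<lambda>v. Im (nQ p v * cnj (Q p))"] by blast
qed

end

context maximal_congruence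
begin

text \<open>The square of the frame gauge in which the principal directions are the real and the imaginary axis.\<close>

definition Y0 :: "R2 \<Rightarrow> complex" where "Y0 p = of_real ((R p)\<^sup>2) * (Q p / of_real (cmod (Q p)))"

lemma Y0_nz: "p \<in> V \<Longrightarrow> Y0 p \<noteq> 0"
  using Q_nz[of p] Rpos[of p] by (simp add: Y0_def)

text \<open>The absolute value of \<open>Y0\<close> is \<open>R\<^sup>2\<close>, whose logarithmic derivative is \<open>2 Re \<kappa>\<close>; the logarithmic derivative of its phase
  is \<open>2 Im \<kappa>\<close> by \<open>nQ_real\<close>.\<close>

lemma Y0_deriv: "p \<in> V \<Longrightarrow> (Y0 has_derivative (\<lambda>v. 2 * kap p v * Y0 p)) (at p)"
proof -
  assume p: "p \<in> V"
  define n where "n = cmod (Q p)"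
  have n: "n \<noteq> 0" using Q_nz[OF p] by (simp add: n_def)
  have dn: "((\<lambda>q. cmod (Q q)) has_derivative (\<lambda>v. Re (dQ p v * cnj (Q p)) / n)) (at p)"
    by (rule has_derivative_eq_rhs[OF has_derivative_compose[OF Q_deriv[OF p] has_derivative_norm[OF Q_nz[OF p]]]])
       (simp add: fun_eq_iff inner_complex_def sgn_div_norm n_def divide_inverse algebra_simps)
  have dn': "((\<lambda>q. complex_of_real (cmod (Q q))) has_derivative (\<lambda>v. of_real (Re (dQ p v * cnj (Q p)) / n))) (at p)"
    by (rule has_derivative_of_real[OF dn])
  have dR: "((\<lambda>q. complex_of_real ((R q)\<^sup>2)) has_derivative (\<lambda>v. of_real (2 * (R p)\<^sup>2 * Re (kap p v)))) (at p)"
    by (rule has_derivative_eq_rhs[OF has_derivative_of_real[OF has_derivative_power[OF R_deriv[OF p], of 2]]])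
       (simp add: fun_eq_iff R'_eq[OF p] power2_eq_square)
  have dq: "((\<lambda>q. Q q / of_real (cmod (Q q))) has_derivative
     (\<lambda>v. (dQ p v * of_real n - Q p * of_real (Re (dQ p v * cnj (Q p)) / n)) / (of_real n * of_real n))) (at p)"
    using has_derivative_divide'[OF Q_deriv[OF p] dn'] n unfolding n_def[symmetric] by simp
  show ?thesis unfolding Y0_def[abs_def]
  proof (rule has_derivative_eq_rhs[OF has_derivative_mult[OF dR dq]], intro ext, unfold n_def[symmetric])
    fix v
    define rho where "rho = Re (dQ p v * cnj (Q p))"
    have "Im (dQ p v * cnj (Q p)) = 2 * Im (kap p v) * n\<^sup>2"
    proof -
      have "nQ p v * cnj (Q p) = dQ p v * cnj (Q p) - 2 * \<i> * Im (kap p v) * (Q p * cnj (Q p))"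
        by (simp add: nQ_def algebra_simps)
      also have "Q p * cnj (Q p) = of_real (n\<^sup>2)" unfolding n_def by (rule complex_norm_square[symmetric])
      finally show ?thesis using nQ_real[OF p, of v] by simp
    qed
    then have u: "dQ p v * cnj (Q p) = of_real rho + 2 * \<i> * Im (kap p v) * of_real (n\<^sup>2)"
      by (simp add: complex_eq_iff rho_def)
    have qq: "cnj (Q p) * Q p = of_real (n\<^sup>2)" unfolding n_def complex_norm_square by (rule mult.commute)
    have nc: "complex_of_real n \<noteq> 0" using n by simp
    have "dQ p v * of_real (n\<^sup>2) = (dQ p v * cnj (Q p)) * Q p" unfolding qq[symmetric] by (simp only: mult.assoc)
    then have U: "dQ p v = (of_real rho / of_real (n\<^sup>2) + 2 * \<i> * Im (kap p v)) * Q p"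
      unfolding u using nc by (simp add: field_simps)
    have K: "kap p v = of_real (Re (kap p v)) + \<i> * Im (kap p v)" by (simp add: complex_eq_iff)
    have gen: "r * ((((rh / (m * m) + 2 * y) * c) * m - c * (rh / m)) / (m * m)) + 2 * r * x * (c / m) = 2 * (x + y) * (r * (c / m))"
      if "m \<noteq> 0" for r rh m x y c :: complex
      using that by (simp add: field_simps)
    show "of_real ((R p)\<^sup>2) * ((dQ p v * of_real n - Q p * of_real (Re (dQ p v * cnj (Q p)) / n)) / (of_real n * of_real n))
        + of_real (2 * (R p)\<^sup>2 * Re (kap p v)) * (Q p / of_real n)
      = 2 * kap p v * (of_real ((R p)\<^sup>2) * (Q p / of_real n))"
      unfolding rho_def[symmetric]
      using gen[OF nc, of "of_real ((R p)\<^sup>2)" "of_real rho" "\<i> * Im (kap p v)" "Q p" "of_real (Re (kap p v))"]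
      unfolding K[symmetric] U by (simp add: power2_eq_square mult.assoc)
  qed
qed

text \<open>By \<open>Y0_deriv\<close> the form \<open>\<kappa>\<close> is a logarithmic derivative, so its curvature vanishes altogether.\<close>

lemma complex_curve: "p \<in> V \<Longrightarrow> a p v * b p w = a p w * b p v"
proof -
  assume p: "p \<in> V"
  have d: "((\<lambda>q. 2 * kap q w * Y0 q) has_derivative (\<lambda>v. 2 * kap p w * (2 * kap p v * Y0 p) + 2 * dkap p v w * Y0 p)) (at p)" for w
    by (rule has_derivative_mult[OF has_derivative_mult_right[OF kap_deriv[OF p]] Y0_deriv[OF p]])
  from second_derivative_symmetric[OF openV p Y0_deriv d d]
  have "2 * kap p v * (2 * kap p w * Y0 p) + 2 * dkap p w v * Y0 p = 2 * kap p w * (2 * kap p v * Y0 p) + 2 * dkap p v w * Y0 p" .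
  then have "(dkap p v w - dkap p w v) * Y0 p = 0" by (auto simp: algebra_simps)
  then show ?thesis using Y0_nz[OF p] unfolding dkap_antisym[OF p] by simp
qed

text \<open>The product of the principal curvatures is 1: the surface is flat.\<close>

lemma H_square: "p \<in> V \<Longrightarrow> H p * H p = 1 + Q p * cnj (Q p)"
proof -
  assume p: "p \<in> V"
  have "4 * (al p e1 * be p e2 - al p e2 * be p e1) = (1 - H p * H p + Q p * cnj (Q p)) * Del p"
    unfolding al_eq[OF p] be_eq[OF p] Del_def using H_real[OF p] by (simp add: field_simps)
  moreover have "al p e1 * be p e2 - al p e2 * be p e1 = 0"
    using complex_curve[OF p, of e1 e2] unfolding ab_albe[OF p] by simp
  ultimately have "(1 - H p * H p + Q p * cnj (Q p)) * Del p = 0" by (simp only: mult_zero_right)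
  then have "1 - H p * H p + Q p * cnj (Q p) = 0" using Del_nz[OF p] by simp
  then show ?thesis by (simp add: algebra_simps)
qed

lemma H_nz: "p \<in> V \<Longrightarrow> 1 - H p \<noteq> 0"
  using H_square[of p] Q_nz[of p] by auto

text \<open>The quotient of \<open>\<alpha>\<close> and \<open>\<beta>\<close> in the gauge of \<open>Y0\<close>; it is real because of \<open>H_square\<close>.\<close>

definition ratio :: "R2 \<Rightarrow> real" where "ratio p = cmod (Q p) / (1 - Re (H p))"
definition Y :: "R2 \<Rightarrow> complex" where "Y p = of_real (ratio p) * Y0 p"

lemma H_Re: "p \<in> V \<Longrightarrow> complex_of_real (Re (H p)) = H p"
  using H_real[of p] by (simp add: complex_eq_iff)

lemma Y_nz: "p \<in> V \<Longrightarrow> Y p \<noteq> 0"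
  using Y0_nz[of p] Q_nz[of p] H_nz[of p] H_Re[of p] by (auto simp: Y_def ratio_def complex_eq_iff)

lemma dA_dB: "p \<in> V \<Longrightarrow> dA p w = - Y p * dB p w"
proof -
  assume p: "p \<in> V"
  have al2: "2 * al p w = (1 + H p) * th p w + Q p * cnj (th p w)" unfolding al_eq[OF p] by simp
  have be2: "2 * be p w = (1 - H p) * cnj (th p w) - cnj (Q p) * th p w" unfolding be_eq[OF p] using H_real[OF p] by simp
  have "2 * (al p w * (1 - H p)) = (2 * al p w) * (1 - H p)" by simp
  also have "\<dots> = (1 - H p * H p) * th p w + Q p * (1 - H p) * cnj (th p w)"
    unfolding al2 by (simp add: algebra_simps)
  also have "\<dots> = Q p * (2 * be p w)"
    unfolding H_square[OF p] be2 by (simp add: algebra_simps)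
  also have "\<dots> = 2 * (Q p * be p w)" by simp
  finally have "al p w * (1 - H p) = Q p * be p w" by simp
  then have 1: "a p w * (1 - H p) = - of_real ((R p)\<^sup>2) * Q p * b p w"
    using Rpos[OF p] by (simp add: al_def be_def field_simps power2_eq_square)
  have YH: "Y p * (1 - H p) = of_real ((R p)\<^sup>2) * Q p"
  proof -
    have "complex_of_real (ratio p) = of_real (cmod (Q p)) / (1 - H p)" by (simp add: ratio_def H_Re[OF p])
    then show ?thesis using Q_nz[OF p] H_nz[OF p] by (simp add: Y_def Y0_def)
  qed
  have "(- Y p * b p w) * (1 - H p) = - (Y p * (1 - H p)) * b p w" by (simp add: algebra_simps)
  then have "a p w * (1 - H p) = (- Y p * b p w) * (1 - H p)" unfolding 1 YH by (simp only: mult_minus_left)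
  then have "a p w = - Y p * b p w" using H_nz[OF p] mult_right_cancel by blast
  then show ?thesis by (simp add: dA_a[OF p] dB_b[OF p])
qed

lemma dB_inj: "p \<in> V \<Longrightarrow> dB p w = 0 \<Longrightarrow> w = 0"
  using inj[of p w] dA_dB[of p w] by (simp add: a_def b_def)

lemma dA_inj: "p \<in> V \<Longrightarrow> dA p w = 0 \<Longrightarrow> w = 0"
  using dB_inj[of p w] dA_dB[of p w] Y_nz[of p] by simp

text \<open>Taking the exterior derivative of \<open>dA = - Y dB\<close> leaves \<open>dq \<and> dB = 0\<close> for the real function \<open>q = ratio\<close>.
  Since \<open>dB\<close> is injective, \<open>dq\<close> vanishes.\<close>

lemma ratio_deriv: "p \<in> V \<Longrightarrow> (ratio has_derivative (\<lambda>v. 0)) (at p)"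
proof -
  assume p: "p \<in> V"
  have "(\<lambda>q. cmod (Q q)) differentiable (at p)"
    using has_derivative_compose[OF Q_deriv[OF p] has_derivative_norm[OF Q_nz[OF p]]] unfolding differentiable_def by blast
  moreover have "(\<lambda>q. Re (H q)) differentiable (at p)"
    using has_derivative_Re[OF H_deriv[OF p]] unfolding differentiable_def by blast
  moreover have "1 - Re (H p) \<noteq> 0" using H_nz[OF p] H_Re[OF p] by (auto simp: complex_eq_iff)
  ultimately have "ratio differentiable (at p)" unfolding ratio_def[abs_def]
    by (intro differentiable_divide differentiable_diff differentiable_const) auto
  then obtain dq where dq: "(ratio has_derivative dq) (at p)" unfolding differentiable_def by blast
  have dY: "(Y has_derivative (\<lambda>v. of_real (ratio p) * (2 * kap p v * Y0 p) + of_real (dq v) * Y0 p)) (at p)"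
    unfolding Y_def[abs_def] by (rule has_derivative_mult[OF has_derivative_of_real[OF dq] Y0_deriv[OF p]])
  have e: "ddA p v w = - Y p * ddB p v w - (of_real (ratio p) * (2 * kap p v * Y0 p) + of_real (dq v) * Y0 p) * dB p w" for v w
  proof -
    have "((\<lambda>q. dA q w) has_derivative (\<lambda>v. - Y p * ddB p v w + - (of_real (ratio p) * (2 * kap p v * Y0 p) + of_real (dq v) * Y0 p) * dB p w)) (at p)"
      by (rule has_derivative_transform_within_open[OF has_derivative_mult[OF has_derivative_minus[OF dY] dB_deriv[OF p]] openV p])
         (simp add: dA_dB)
    from fun_cong[OF has_derivative_unique[OF dA_deriv[OF p] this], of v] show ?thesis by (simp add: algebra_simps)
  qed
  have s: "of_real (dq v) * dB p w = of_real (dq w) * dB p v" for v w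
  proof -
    have K: "kap p v * dB p w = kap p w * dB p v"
      using complex_curve[OF p, of v w] by (simp add: kap_def dB_b[OF p] algebra_simps)
    have E: "of_real (ratio p) * (2 * kap p v * Y0 p) * dB p w + of_real (dq v) * Y0 p * dB p w
       = of_real (ratio p) * (2 * kap p w * Y0 p) * dB p v + of_real (dq w) * Y0 p * dB p v"
      using e[of v w] e[of w v] ddA_sym[OF p, of v w] ddB_sym[OF p, of v w] by (simp add: algebra_simps)
    have ex: "Y0 p * (of_real (dq v') * dB p w') = (of_real (ratio p) * (2 * kap p v' * Y0 p) * dB p w' + of_real (dq v') * Y0 p * dB p w')
       - 2 * of_real (ratio p) * Y0 p * (kap p v' * dB p w')" for v' w'
      by (simp add: algebra_simps)
    have "Y0 p * (of_real (dq v) * dB p w) = Y0 p * (of_real (dq w) * dB p v)"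
      unfolding ex E K ..
    then show ?thesis using Y0_nz[OF p] by simp
  qed
  interpret dq: linear dq using dq by (rule has_derivative_linear)
  have "dq v = 0" for v
  proof (rule ccontr)
    assume v: "dq v \<noteq> 0"
    define u where "u = (- dq e2) *\<^sub>R e1 + dq e1 *\<^sub>R e2"
    have "dq u = 0" by (simp only: u_def dq.add dq.scale) simp
    then have "dB p u = 0" using s[of v u] v by simp
    then have "u = 0" by (rule dB_inj[OF p])
    then have "dq e1 = 0" "dq e2 = 0" by (simp_all add: u_def zero_prod_def)
    then show False using linear_R2_zero[OF dq.linear_axioms, of v] v by simp
  qed
  then have "dq = (\<lambda>v. 0)" by (rule ext)
  with dq show ?thesis by simp
qed

lemma Y_deriv: "p \<in> V \<Longrightarrow> (Y has_derivative (\<lambda>v. 2 * kap p v * Y p)) (at p)"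
  unfolding Y_def[abs_def]
  by (rule has_derivative_eq_rhs[OF has_derivative_mult[OF has_derivative_of_real[OF ratio_deriv] Y0_deriv]])
     (auto simp: fun_eq_iff)

section \<open>The axis of a maximal congruence\<close>

text \<open>The complex geodesic through \<open>(A, B)\<close> with tangent direction \<open>(- Y, 1)\<close>: the solution, unique up to scaling, of the
  equation \<open>p (A B - 1) + m B + n A = 0\<close> and its derivative.\<close>

definition local_axis :: "R2 \<Rightarrow> quadric" where
  "local_axis p = (A p + Y p * B p, Y p - (A p)\<^sup>2, 1 - Y p * (B p)\<^sup>2)"

lemma local_axis_discr: "p \<in> V \<Longrightarrow> discr (local_axis p) = Y p * (D p)\<^sup>2"
  by (simp add: local_axis_def discr_def D_def algebra_simps power2_eq_square)

lemma local_axis_discr_nz: "p \<in> V \<Longrightarrow> discr (local_axis p) \<noteq> 0"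
  using Y_nz[of p] D_nz[of p] by (simp add: local_axis_discr)

lemma local_axis_eq: "graph_eq True (local_axis p) (A p) (B p) = 0"
  by (simp add: local_axis_def graph_eq_def algebra_simps power2_eq_square)

text \<open>Differentiating the equation of the graph along the congruence, whose tangent plane is the complex line of \<open>(- Y, 1)\<close>,
  gives a second linear equation for the coefficients.\<close>

lemma local_axis_unique:
  assumes p: "p \<in> V" and U: "open U" "p \<in> U" "U \<subseteq> V" and P: "\<And>q. q \<in> U \<Longrightarrow> graph_eq True P (A q) (B q) = 0"
  obtains c where "P = (case local_axis p of (x, y, z) \<Rightarrow> (c * x, c * y, c * z))"
proof -
  obtain x y z where Pe: "P = (x, y, z)" by (cases P)
  have "((\<lambda>q. x * (A q * B q - 1) + y * B q + z * A q) has_derivative (\<lambda>w. x * (A p * dB p w + dA p w * B p) + y * dB p w + z * dA p w)) (at p)"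
    by (rule has_derivative_eq_rhs, (rule derivative_intros A_deriv B_deriv p)+) simp
  moreover have "((\<lambda>q. x * (A q * B q - 1) + y * B q + z * A q) has_derivative (\<lambda>w. 0)) (at p)"
    by (rule has_derivative_transform_within_open[OF has_derivative_const U(1,2)]) (use P in \<open>simp add: Pe graph_eq_def\<close>)
  ultimately have "x * (A p * dB p w + dA p w * B p) + y * dB p w + z * dA p w = 0" for w
    using has_derivative_unique by (metis (no_types, lifting))
  then have "(x * (A p - Y p * B p) + y - z * Y p) * dB p e1 = 0"
    unfolding dA_dB[OF p] by (simp add: algebra_simps)
  moreover have "dB p e1 \<noteq> 0" using dB_inj[OF p, of e1] by (auto simp: zero_prod_def)
  ultimately have 2: "x * (A p - Y p * B p) + y - z * Y p = 0" by simp
  have 1: "x * (A p * B p - 1) + y * B p + z * A p = 0" using P[OF U(2)] by (simp add: Pe graph_eq_def)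
  have y: "y = z * Y p - x * (A p - Y p * B p)" using 2 by (simp add: algebra_simps)
  have e: "z * (A p + Y p * B p) = x * (1 - Y p * (B p)\<^sup>2)"
    using 1 unfolding y by (simp add: algebra_simps power2_eq_square)
  show ?thesis
  proof (cases "A p + Y p * B p = 0")
    case True
    have "1 - Y p * (B p)\<^sup>2 = D p"
    proof -
      have "1 - Y p * (B p)\<^sup>2 = 1 + A p * B p - (A p + Y p * B p) * B p" by (simp add: algebra_simps power2_eq_square)
      then show ?thesis using True by (simp add: D_def)
    qed
    then have x: "x = 0" and n: "1 - Y p * (B p)\<^sup>2 \<noteq> 0" using e True D_nz[OF p] by simp_all
    have "Y p - (A p)\<^sup>2 = Y p * (1 - Y p * (B p)\<^sup>2)"
    proof -
      have "Y p - (A p)\<^sup>2 - Y p * (1 - Y p * (B p)\<^sup>2) = - (A p + Y p * B p) * (A p - Y p * B p)"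
        by (simp add: algebra_simps power2_eq_square)
      then show ?thesis using True by simp
    qed
    then show ?thesis
      using n by (intro that[of "z / (1 - Y p * (B p)\<^sup>2)"]) (simp add: Pe local_axis_def True x y)
  next
    case False
    define c where "c = x / (A p + Y p * B p)"
    have x: "x = c * (A p + Y p * B p)" using False by (simp add: c_def)
    have z: "z = c * (1 - Y p * (B p)\<^sup>2)" using e False by (simp add: c_def field_simps)
    show ?thesis
      by (rule that[of c]) (simp add: Pe local_axis_def x z y algebra_simps power2_eq_square)
  qed
qed

text \<open>All coefficients have the same logarithmic derivative, so their ratios are constant.\<close>

lemma local_axis_derivs:
  assumes p: "p \<in> V"
  defines "\<tau> \<equiv> (\<lambda>w. - 2 * Y p * B p * b p w)"
  shows "((\<lambda>q. A q + Y q * B q) has_derivative (\<lambda>w. \<tau> w * (A p + Y p * B p))) (at p)"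
    "((\<lambda>q. Y q - (A q)\<^sup>2) has_derivative (\<lambda>w. \<tau> w * (Y p - (A p)\<^sup>2))) (at p)"
    "((\<lambda>q. 1 - Y q * (B q)\<^sup>2) has_derivative (\<lambda>w. \<tau> w * (1 - Y p * (B p)\<^sup>2))) (at p)"
    "((\<lambda>q. Y q * (D q)\<^sup>2) has_derivative (\<lambda>w. 2 * \<tau> w * (Y p * (D p)\<^sup>2))) (at p)"
proof -
  have a: "a p w = - Y p * b p w" for w using dA_dB[OF p, of w] D_nz[OF p] by (simp add: a_def b_def)
  note facts = A_deriv[OF p] B_deriv[OF p] Y_deriv[OF p] D_deriv[OF p]
  show "((\<lambda>q. A q + Y q * B q) has_derivative (\<lambda>w. \<tau> w * (A p + Y p * B p))) (at p)"
    by (rule has_derivative_eq_rhs, (rule facts derivative_intros)+)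
       (simp add: fun_eq_iff \<tau>_def kap_def dA_a[OF p] dB_b[OF p] a D_def algebra_simps)
  show "((\<lambda>q. Y q - (A q)\<^sup>2) has_derivative (\<lambda>w. \<tau> w * (Y p - (A p)\<^sup>2))) (at p)"
    by (rule has_derivative_eq_rhs, (rule facts derivative_intros)+)
       (simp add: fun_eq_iff \<tau>_def kap_def dA_a[OF p] dB_b[OF p] a D_def algebra_simps power2_eq_square)
  show "((\<lambda>q. 1 - Y q * (B q)\<^sup>2) has_derivative (\<lambda>w. \<tau> w * (1 - Y p * (B p)\<^sup>2))) (at p)"
    by (rule has_derivative_eq_rhs, (rule facts derivative_intros)+)
       (simp add: fun_eq_iff \<tau>_def kap_def dA_a[OF p] dB_b[OF p] a D_def algebra_simps power2_eq_square)
  show "((\<lambda>q. Y q * (D q)\<^sup>2) has_derivative (\<lambda>w. 2 * \<tau> w * (Y p * (D p)\<^sup>2))) (at p)"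
    by (rule has_derivative_eq_rhs, (rule facts derivative_intros)+)
       (simp add: fun_eq_iff \<tau>_def kap_def dA_a[OF p] dB_b[OF p] a D_def algebra_simps power2_eq_square)
qed

text \<open>The square of a function with the logarithmic derivative of the coefficients is a constant multiple of the discriminant,
  which has no zeros. On the cross products of the coefficients at two points this replaces the division by a
  coefficient that may vanish.\<close>

lemma local_axis_proportional:
  assumes conn: "connected V" and p: "p \<in> V" "p0 \<in> V"
    and f: "\<And>q. q \<in> V \<Longrightarrow> (f has_derivative (\<lambda>w. (- 2 * Y q * B q * b q w) * f q)) (at q)" and "f p0 = 0"
  shows "f p = 0"
proof -
  define G where "G q = Y q * (D q)\<^sup>2" for q
  have G: "G q \<noteq> 0" if "q \<in> V" for q using Y_nz[OF that] D_nz[OF that] by (simp add: G_def)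
  have "((\<lambda>q. (f q * f q) / G q) has_derivative (\<lambda>w. 0)) (at q)" if q: "q \<in> V" for q
  proof -
    have dG: "(G has_derivative (\<lambda>w. 2 * (- 2 * Y q * B q * b q w) * G q)) (at q)"
      unfolding G_def[abs_def] by (rule local_axis_derivs(4)[OF q])
    show ?thesis
      by (rule has_derivative_eq_rhs[OF has_derivative_divide'[OF has_derivative_mult[OF f[OF q] f[OF q]] dG G[OF q]]])
         (use G[OF q] in \<open>simp add: fun_eq_iff algebra_simps\<close>)
  qed
  from has_derivative_zero_unique_connected[OF openV conn this p]
  have "f p * f p / G p = f p0 * f p0 / G p0" .
  then show ?thesis using \<open>f p0 = 0\<close> G[OF p(1)] by simp
qed

lemma on_graph:
  assumes conn: "connected V" and p: "p \<in> V" "p0 \<in> V"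
  shows "graph_eq True (local_axis p0) (A p) (B p) = 0"
proof -
  define x y z where "x q = A q + Y q * B q" and "y q = Y q - (A q)\<^sup>2" and "z q = 1 - Y q * (B q)\<^sup>2" for q
  have lin: "u * g p - v * h p = 0" if z: "u * g p0 - v * h p0 = 0"
    and g: "\<And>q. q \<in> V \<Longrightarrow> (g has_derivative (\<lambda>w. (- 2 * Y q * B q * b q w) * g q)) (at q)"
    and h: "\<And>q. q \<in> V \<Longrightarrow> (h has_derivative (\<lambda>w. (- 2 * Y q * B q * b q w) * h q)) (at q)" for u v g h
  proof (rule local_axis_proportional[OF conn p, of "\<lambda>q. u * g q - v * h q"])
    show "((\<lambda>q. u * g q - v * h q) has_derivative (\<lambda>w. (- 2 * Y q * B q * b q w) * (u * g q - v * h q))) (at q)" if q: "q \<in> V" for q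
      by (rule has_derivative_eq_rhs[OF has_derivative_diff[OF has_derivative_mult_right[OF g[OF q]] has_derivative_mult_right[OF h[OF q]]]])
         (simp add: fun_eq_iff algebra_simps)
  qed (use z in simp)
  have d: "(x has_derivative (\<lambda>w. (- 2 * Y q * B q * b q w) * x q)) (at q)"
    "(y has_derivative (\<lambda>w. (- 2 * Y q * B q * b q w) * y q)) (at q)"
    "(z has_derivative (\<lambda>w. (- 2 * Y q * B q * b q w) * z q)) (at q)" if "q \<in> V" for q
    using local_axis_derivs[OF that] unfolding x_def[abs_def] y_def[abs_def] z_def[abs_def] by blast+
  have c: "x p0 * y p - y p0 * x p = 0" "x p0 * z p - z p0 * x p = 0" "y p0 * z p - z p0 * y p = 0"
    using lin[of "x p0" y "y p0" x, OF _ d(2) d(1)] lin[of "x p0" z "z p0" x, OF _ d(3) d(1)] lin[of "y p0" z "z p0" y, OF _ d(3) d(2)]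
    by (simp_all add: mult.commute)
  define r where "r = graph_eq True (local_axis p0) (A p) (B p)"
  have r: "r = x p0 * (A p * B p - 1) + y p0 * B p + z p0 * A p"
    by (simp add: r_def graph_eq_def local_axis_def x_def y_def z_def)
  have s: "x p * (A p * B p - 1) + y p * B p + z p * A p = 0"
    using local_axis_eq[of p] by (simp add: graph_eq_def local_axis_def x_def y_def z_def)
  have "r * x p = x p0 * (x p * (A p * B p - 1) + y p * B p + z p * A p) - (x p0 * y p - y p0 * x p) * B p - (x p0 * z p - z p0 * x p) * A p"
    "r * y p = y p0 * (x p * (A p * B p - 1) + y p * B p + z p * A p) + (x p0 * y p - y p0 * x p) * (A p * B p - 1) - (y p0 * z p - z p0 * y p) * A p"
    "r * z p = z p0 * (x p * (A p * B p - 1) + y p * B p + z p * A p) + (x p0 * z p - z p0 * x p) * (A p * B p - 1) + (y p0 * z p - z p0 * y p) * B p"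
    unfolding r by (simp_all add: algebra_simps)
  then have "r * x p = 0" "r * y p = 0" "r * z p = 0" unfolding s c by simp_all
  moreover have "x p \<noteq> 0 \<or> y p \<noteq> 0"
    using local_axis_discr_nz[OF p(1)] by (auto simp: discr_def local_axis_def x_def y_def)
  ultimately show ?thesis by (auto simp: r_def)
qed

end

section \<open>Congruences orthogonal to an axis\<close>

lemma linear_R2_independent:
  fixes L :: "R2 \<Rightarrow> complex"
  assumes lin: "linear L" and inj: "\<And>w. L w = 0 \<Longrightarrow> w = 0"
  shows "Im (cnj (L (1,0)) * L (0,1)) \<noteq> 0" "surj L"
proof -
  define l1 l2 where "l1 = L (1,0)" and "l2 = L (0,1)"
  have ex: "L (x *\<^sub>R (1,0) + y *\<^sub>R (0,1)) = x *\<^sub>R l1 + y *\<^sub>R l2" for x y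
    by (simp only: linear_add[OF lin] linear_cmul[OF lin] l1_def l2_def)
  show *: "Im (cnj (L (1,0)) * L (0,1)) \<noteq> 0"
  proof
    assume "Im (cnj (L (1,0)) * L (0,1)) = 0"
    then have r: "Re l1 * Im l2 = Im l1 * Re l2" by (simp add: l1_def l2_def algebra_simps)
    have "L (Re l2 *\<^sub>R (1,0) + (- Re l1) *\<^sub>R (0,1)) = 0" "L (Im l2 *\<^sub>R (1,0) + (- Im l1) *\<^sub>R (0,1)) = 0"
      unfolding ex using r by (simp_all add: complex_eq_iff mult.commute)
    from inj[OF this(1)] inj[OF this(2)] have "l1 = 0" by (simp add: complex_eq_iff zero_prod_def)
    from inj[OF this[unfolded l1_def]] show False by (simp add: zero_prod_def)
  qed
  define d where "d = Re l1 * Im l2 - Im l1 * Re l2"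
  have d: "d \<noteq> 0" using * by (simp add: d_def l1_def l2_def)
  show "surj L"
  proof (rule surjI)
    fix z
    define x y where "x = Re z * Im l2 - Im z * Re l2" and "y = Re l1 * Im z - Im l1 * Re z"
    have "x *\<^sub>R l1 + y *\<^sub>R l2 = d *\<^sub>R z"
      by (simp add: complex_eq_iff x_def y_def d_def algebra_simps)
    moreover have "(x / d) *\<^sub>R l1 + (y / d) *\<^sub>R l2 = (1 / d) *\<^sub>R (x *\<^sub>R l1 + y *\<^sub>R l2)"
      by (simp add: scaleR_add_right)
    ultimately have "(x / d) *\<^sub>R l1 + (y / d) *\<^sub>R l2 = z" using d by simp
    then show "L (((Re z * Im l2 - Im z * Re l2) / d) *\<^sub>R (1,0) + ((Re l1 * Im z - Im l1 * Re z) / d) *\<^sub>R (0,1)) = z"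
      unfolding ex x_def y_def .
  qed
qed

context C2_coords
begin

text \<open>On a Moebius graph \<open>dB = \<mu> dA\<close> with \<open>\<mu> \<noteq> 0\<close>, and differentiating once more shows that the covariant second derivative is
  proportional to \<open>(1, \<mu>)\<close> over the complex numbers. The tangent planes are the complex lines spanned by \<open>(1, \<mu>)\<close>, so
  the second fundamental form vanishes.\<close>

lemma graph_imp_maximal:
  assumes graph: "\<And>q. q \<in> V \<Longrightarrow> graph_eq True P (A q) (B q) = 0" and disc: "discr P \<noteq> 0"
    and inj: "\<And>q w. q \<in> V \<Longrightarrow> dA q w = 0 \<Longrightarrow> dB q w = 0 \<Longrightarrow> w = 0" and p: "p \<in> V"
  shows "induced_det neutral_metric F p \<noteq> 0" "mean_curvature_vector neutral_metric F p = 0"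
proof -
  obtain x m n where P: "P = (x, m, n)" by (cases P)
  have g: "x * (A q * B q - 1) + m * B q + n * A q = 0" if "q \<in> V" for q
    using graph[OF that] by (simp add: P graph_eq_def)
  have dg: "(m + x * A q) * dB q w + (n + x * B q) * dA q w = 0" if q: "q \<in> V" for q w
  proof -
    have "((\<lambda>q. x * (A q * B q - 1) + m * B q + n * A q) has_derivative (\<lambda>w. (m + x * A q) * dB q w + (n + x * B q) * dA q w)) (at q)"
      by (rule has_derivative_eq_rhs, (rule derivative_intros A_deriv B_deriv q)+) (simp add: fun_eq_iff algebra_simps)
    moreover have "((\<lambda>q. x * (A q * B q - 1) + m * B q + n * A q) has_derivative (\<lambda>w. 0)) (at q)"
      by (rule has_derivative_transform_within_open[OF has_derivative_const openV q]) (simp add: g)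
    ultimately show ?thesis using has_derivative_unique by (metis (no_types, lifting))
  qed
  have ddg: "(m + x * A p) * ddB p v w + x * dA p v * dB p w + (n + x * B p) * ddA p v w + x * dB p v * dA p w = 0" for v w
  proof -
    have "((\<lambda>q. (m + x * A q) * dB q w + (n + x * B q) * dA q w) has_derivative
       (\<lambda>v. (m + x * A p) * ddB p v w + x * dA p v * dB p w + (n + x * B p) * ddA p v w + x * dB p v * dA p w)) (at p)"
      by (rule has_derivative_eq_rhs, (rule derivative_intros A_deriv B_deriv dA_deriv dB_deriv p)+) (simp add: fun_eq_iff algebra_simps)
    moreover have "((\<lambda>q. (m + x * A q) * dB q w + (n + x * B q) * dA q w) has_derivative (\<lambda>w. 0)) (at p)"
      by (rule has_derivative_transform_within_open[OF has_derivative_const openV p]) (simp add: dg)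
    ultimately show ?thesis using has_derivative_unique by (metis (no_types, lifting))
  qed
  define k d where "k = m + x * A p" and "d = n + x * B p"
  have "d * k = discr P"
  proof -
    have "d * k - discr P = x * (x * (A p * B p - 1) + m * B p + n * A p)"
      by (simp add: d_def k_def P discr_def algebra_simps power2_eq_square)
    then show ?thesis using g[OF p] by simp
  qed
  then have k: "k \<noteq> 0" and d: "d \<noteq> 0" using disc by auto
  define \<mu> where "\<mu> = - d / k"
  have \<mu>: "\<mu> \<noteq> 0" "k * \<mu> = - d" using k d by (simp_all add: \<mu>_def)
  have dB: "dB p w = \<mu> * dA p w" for w
  proof -
    have "k * dB p w = - (d * dA p w)" using dg[OF p, of w] unfolding k_def d_def by (simp only: add_eq_0_iff2)
    then show ?thesis using k by (simp add: \<mu>_def field_simps)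
  qed
  then have b: "b p w = \<mu> * a p w" for w by (simp add: a_def b_def)
  have D: "D p \<noteq> 0" by (rule D_nz[OF p])
  have ddB: "ddB p v w = \<mu> * ddA p v w - 2 * x * \<mu> * (D p)\<^sup>2 * a p v * a p w / k" for v w
  proof -
    have "k * ddB p v w = - d * ddA p v w - 2 * x * \<mu> * dA p v * dA p w"
      using ddg[of v w] unfolding dB by (simp add: k_def[symmetric] d_def[symmetric] algebra_simps add_eq_0_iff2) (metis (no_types, lifting) add.commute add.assoc add_eq_0_iff2 minus_add_distrib diff_conv_add_uminus)
    also have "\<dots> = k * (\<mu> * ddA p v w - 2 * x * \<mu> * (D p)\<^sup>2 * a p v * a p w / k)"
      unfolding \<mu>(2)[symmetric] using k by (simp add: dA_a[OF p] right_diff_distrib power2_eq_square)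
    finally show ?thesis using k by simp
  qed
  have cb: "cb p v w = \<mu> * ca p v w" for v w
  proof -
    have "k * (- 2 * x * D p / k - 2 * A p * \<mu> + 2 * B p) = - 2 * x * D p - 2 * A p * (k * \<mu>) + 2 * B p * k"
      using k by (simp add: algebra_simps)
    also have "\<dots> = 2 * (x * (A p * B p - 1) + m * B p + n * A p)"
      unfolding \<mu>(2) unfolding d_def k_def D_def by (simp add: algebra_simps)
    also have "\<dots> = 0" using g[OF p] by simp
    finally have z: "- 2 * x * D p / k - 2 * A p * \<mu> + 2 * B p = 0" using k by simp
    have "cb p v w - \<mu> * ca p v w = \<mu> * a p v * a p w * (- 2 * x * D p / k - 2 * A p * \<mu> + 2 * B p)"
      unfolding cb_def ca_def ddB b using D by (simp add: field_simps power2_eq_square)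
    then show ?thesis unfolding z by simp
  qed
  have injA: "w = 0" if "dA p w = 0" for w using inj[OF p that] that dB by simp
  note ind = linear_R2_independent[OF linear_dA[OF p] injA]
  have range: "covariant_second F p v w \<in> range (frechet_derivative F (at p))" for v w
  proof -
    obtain u where u: "dA p u = D p * ca p v w" using ind(2) by (metis surjD)
    then have "dB p u = D p * cb p v w" by (simp add: dB cb)
    then have "covariant_second F p v w = frechet_derivative F (at p) u"
      using u covariant_second_ab[OF p, of v w] unfolding dA_def dB_def
      by (metis complex_cnj_cancel_iff prod_eqI)
    then show ?thesis by blast
  qed
  have ia: "Im (cnj (a p (1,0)) * a p (0,1)) \<noteq> 0"
  proof -
    have "cnj (dA p (1,0)) * dA p (0,1) = (cnj (a p (1,0)) * a p (0,1)) * (D p * cnj (D p))"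
      by (simp add: dA_a[OF p] algebra_simps)
    also have "D p * cnj (D p) = of_real ((cmod (D p))\<^sup>2)" by (rule complex_norm_square[symmetric])
    finally show ?thesis using ind(1) by auto
  qed
  show det: "induced_det neutral_metric F p \<noteq> 0"
  proof -
    define s where "s = a p (1,0)"
    define t where "t = a p (0,1)"
    have "induced_det neutral_metric F p = Im (2 * \<mu> * (s * s)) * Im (2 * \<mu> * (t * t)) - (Im (2 * \<mu> * (s * t)))\<^sup>2"
      unfolding induced_det_def induced_metric_ab[OF p] b s_def t_def by (simp add: algebra_simps)
    also have "\<dots> = - 4 * (cmod \<mu>)\<^sup>2 * (Im (cnj s * t))\<^sup>2"
      unfolding cmod_power2 by (simp add: algebra_simps power2_eq_square)
    finally show ?thesis using ia \<mu>(1) by (simp add: s_def t_def)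
  qed
  show "mean_curvature_vector neutral_metric F p = 0"
    by (rule mean_curvature_zero_if_tangent[OF dom[OF p] linear_dF[OF p] det range])
qed

end

text \<open>A parametrised surface \<open>g\<close> with normal field \<open>n\<close> and the coordinates of its normal geodesics in one of the charts.\<close>

locale congruence_patch = C2_coords +
  fixes c :: bool and g n :: "R2 \<Rightarrow> half_space" and g' :: "R2 \<Rightarrow> R2 \<Rightarrow> half_space"
  assumes g_deriv: "\<And>p. p \<in> V \<Longrightarrow> (g has_derivative g' p) (at p)"
    and g_inj: "\<And>p w. p \<in> V \<Longrightarrow> g' p w = 0 \<Longrightarrow> w = 0"
    and orth: "\<And>p w. p \<in> V \<Longrightarrow> n p \<bullet> g' p w = 0"
    and on_chart: "\<And>p. p \<in> V \<Longrightarrow> (g p, n p) \<in> chart_of c (F p)"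
begin

definition xi :: "R2 \<Rightarrow> complex \<times> complex" where "xi p = end_spinor c (F p)"
definition eta :: "R2 \<Rightarrow> complex \<times> complex" where "eta p = begin_spinor c (F p)"
text \<open>The position on the geodesic, recovered from the Busemann function of the backward end.\<close>

definition R :: "R2 \<Rightarrow> real" where "R p = horo (eta p) (g p) / cmod (D p)"

lemma wedge_D: "wedge (xi p) (eta p) = D p"
  by (simp add: xi_def eta_def wedge_spinor D_def A_def B_def)

lemma R_props:
  assumes "p \<in> V"
  shows "R p > 0" "g p = geo_point (xi p) (eta p) (R p)" "n p = geo_velocity (xi p) (eta p) (R p)"
proof -
  obtain r where r: "r > 0" "g p = geo_point (xi p) (eta p) r" "n p = geo_velocity (xi p) (eta p) r"
    using on_chart[OF assms] unfolding chart_of_eq[OF dom[OF assms]] xi_def eta_def by blast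
  have W: "wedge (xi p) (eta p) \<noteq> 0" using D_nz[OF assms] by (simp add: wedge_D)
  have "cmod (wedge (eta p) (xi p)) = cmod (D p)"
  proof -
    have "wedge (eta p) (xi p) = - wedge (xi p) (eta p)" by (simp add: wedge_def)
    then show ?thesis by (simp add: wedge_D)
  qed
  moreover have "wedge (eta p) (eta p) = 0" by (simp add: wedge_def)
  ultimately have "horo (eta p) (g p) = r * cmod (D p)"
    unfolding r(2) horo_geo_point[OF W r(1)] using D_nz[OF assms] by (simp add: wedge_D power2_eq_square)
  then have "R p = r" using D_nz[OF assms] by (simp add: R_def)
  then show "R p > 0" "g p = geo_point (xi p) (eta p) (R p)" "n p = geo_velocity (xi p) (eta p) (R p)" using r by simp_all
qed

definition xi' :: "R2 \<Rightarrow> R2 \<Rightarrow> complex \<times> complex" where "xi' p w = (if c then (0, dB p w) else (dB p w, 0))"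
definition eta' :: "R2 \<Rightarrow> R2 \<Rightarrow> complex \<times> complex" where "eta' p w = (if c then (- dA p w, 0) else (0, dA p w))"

lemma xi_deriv: "p \<in> V \<Longrightarrow> (xi has_derivative xi' p) (at p)"
  and eta_deriv: "p \<in> V \<Longrightarrow> (eta has_derivative eta' p) (at p)"
proof -
  assume p: "p \<in> V"
  have "xi = (\<lambda>q. if c then (1, B q) else (B q, 1))" "eta = (\<lambda>q. if c then (- A q, 1) else (- 1, A q))"
    by (auto simp: fun_eq_iff xi_def eta_def end_spinor_def begin_spinor_def A_def B_def)
  then show "(xi has_derivative xi' p) (at p)" "(eta has_derivative eta' p) (at p)"
    unfolding xi'_def[abs_def] eta'_def[abs_def]
    by (cases c; simp; intro has_derivative_Pair has_derivative_minus has_derivative_const A_deriv B_deriv p)+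
qed

lemma R_differentiable: "p \<in> V \<Longrightarrow> R differentiable (at p)"
proof -
  assume p: "p \<in> V"
  have t: "snd (g p) \<noteq> 0"
    using geo_point_in_H3[of "xi p" "eta p" "R p"] D_nz[OF p] R_props[OF p] by (simp add: wedge_D H3_def)
  have f: "((\<lambda>q. fst (eta q)) has_derivative (\<lambda>w. fst (eta' p w))) (at p)" "((\<lambda>q. snd (eta q)) has_derivative (\<lambda>w. snd (eta' p w))) (at p)"
    "((\<lambda>q. fst (g q)) has_derivative (\<lambda>w. fst (g' p w))) (at p)" "((\<lambda>q. snd (g q)) has_derivative (\<lambda>w. snd (g' p w))) (at p)"
    by (intro has_derivative_fst has_derivative_snd eta_deriv g_deriv p)+
  have m: "(\<lambda>q. h1 q * h2 q) differentiable (at p)" if "h1 differentiable (at p)" "h2 differentiable (at p)" for h1 h2 :: "R2 \<Rightarrow> complex"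
    using that by simp
  have RI: "(\<lambda>q. Re (h q)) differentiable (at p)" "(\<lambda>q. Im (h q)) differentiable (at p)" "(\<lambda>q. cnj (h q)) differentiable (at p)"
    if "h differentiable (at p)" for h
    using that has_derivative_Re has_derivative_Im has_derivative_cnj unfolding differentiable_def by blast+
  have fd: "(\<lambda>q. fst (eta q)) differentiable (at p)" "(\<lambda>q. snd (eta q)) differentiable (at p)"
    "(\<lambda>q. fst (g q)) differentiable (at p)" "(\<lambda>q. snd (g q)) differentiable (at p)"
    using f unfolding differentiable_def by blast+
  have cD: "(\<lambda>q. cmod (D q)) differentiable (at p)"
    using has_derivative_compose[OF D_deriv[OF p] has_derivative_norm[OF D_nz[OF p]]] unfolding differentiable_def by blast
  show ?thesis
    unfolding R_def[abs_def] horo_def cmod_power2[of "fst _"] cmod_power2[of "snd _"]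
    by (intro differentiable_divide differentiable_add differentiable_diff differentiable_mult differentiable_power RI m fd cD differentiable_const)
       (use t D_nz[OF p] in auto)
qed

definition R' :: "R2 \<Rightarrow> R2 \<Rightarrow> real" where "R' p = frechet_derivative R (at p)"

lemma R_deriv: "p \<in> V \<Longrightarrow> (R has_derivative R' p) (at p)"
  using R_differentiable by (simp add: R'_def frechet_derivative_works)

text \<open>Orthogonality kills the component along the geodesic in \<open>geo_point_has_derivative\<close>.\<close>

lemma g'_eq:
  assumes p: "p \<in> V"
  shows "R' p w = R p * Re (kap p w)"
    "g' p w = geo_normal (xi p) (eta p) (R p) (if c then R p * cnj (b p w) - a p w / R p else - (R p * cnj (b p w) - a p w / R p))"
proof -
  have W: "wedge (xi p) (eta p) \<noteq> 0" using D_nz[OF p] by (simp add: wedge_D)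
  note Rp = R_props[OF p]
  define e where "e w = R' p w / R p + Re ((wedge (xi' p w) (eta p) - wedge (xi p) (eta' p w)) / wedge (xi p) (eta p))" for w
  define \<theta> where "\<theta> w = R p * cnj (wedge (xi p) (xi' p w) / wedge (xi p) (eta p)) + wedge (eta' p w) (eta p) / wedge (xi p) (eta p) / R p" for w
  have "(g has_derivative (\<lambda>w. e w *\<^sub>R geo_velocity (xi p) (eta p) (R p) + geo_normal (xi p) (eta p) (R p) (\<theta> w))) (at p)"
    unfolding e_def \<theta>_def
    by (rule has_derivative_transform_within_open[OF geo_point_has_derivative[OF xi_deriv[OF p] eta_deriv[OF p] R_deriv[OF p] W Rp(1)] openV p])
       (simp add: R_props(2))
  from fun_cong[OF has_derivative_unique[OF g_deriv[OF p] this], of w]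
  have gw: "g' p w = e w *\<^sub>R geo_velocity (xi p) (eta p) (R p) + geo_normal (xi p) (eta p) (R p) (\<theta> w)" .
  have "0 = n p \<bullet> g' p w" using orth[OF p] by simp
  also have "\<dots> = e w * (snd (g p))\<^sup>2"
    unfolding gw Rp(3) inner_add_right inner_scaleR_right geo_frame_inner[OF W Rp(1)] using Rp(2) by simp
  finally have e0: "e w = 0" using geo_point_in_H3[OF W Rp(1)] Rp(2) by (simp add: H3_def)
  have s: "(wedge (xi' p w) (eta p) - wedge (xi p) (eta' p w)) / wedge (xi p) (eta p) = - kap p w"
    unfolding wedge_D kap_def a_def b_def using D_nz[OF p]
    by (simp add: wedge_def xi'_def eta'_def xi_def eta_def end_spinor_def begin_spinor_def A_def[symmetric] B_def[symmetric] diff_divide_distrib algebra_simps)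
  show "R' p w = R p * Re (kap p w)" using e0 Rp(1) unfolding e_def s by (simp add: field_simps)
  have "\<theta> w = (if c then R p * cnj (b p w) - a p w / R p else - (R p * cnj (b p w) - a p w / R p))"
    unfolding \<theta>_def wedge_D a_def b_def
    by (simp add: wedge_def xi'_def eta'_def xi_def eta_def end_spinor_def begin_spinor_def A_def[symmetric] B_def[symmetric])
  then show "g' p w = geo_normal (xi p) (eta p) (R p) (if c then R p * cnj (b p w) - a p w / R p else - (R p * cnj (b p w) - a p w / R p))"
    unfolding gw e0 by simp
qed

lemma theta_inj: "p \<in> V \<Longrightarrow> R p * cnj (b p w) - a p w / R p = 0 \<Longrightarrow> w = 0"
proof -
  assume p: "p \<in> V" and z: "R p * cnj (b p w) - a p w / R p = 0"
  have "g' p w = geo_normal (xi p) (eta p) (R p) 0" unfolding g'_eq(2)[OF p] z by simp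
  then have "g' p w = 0" by (simp add: geo_normal_def zero_prod_def)
  then show "w = 0" by (rule g_inj[OF p])
qed

lemma dF_inj: "p \<in> V \<Longrightarrow> dA p w = 0 \<Longrightarrow> dB p w = 0 \<Longrightarrow> w = 0"
  using theta_inj[of p w] by (simp add: a_def b_def)

lemma maximal_congruenceI:
  assumes "\<And>p. p \<in> V \<Longrightarrow> induced_det neutral_metric F p \<noteq> 0"
    and "\<And>p. p \<in> V \<Longrightarrow> mean_curvature_vector neutral_metric F p = 0"
  shows "maximal_congruence V F R R'"
  by unfold_locales (use assms R_props(1) R_deriv g'_eq(1) theta_inj in auto)

end

section \<open>Smoothness of the normal field\<close>

definition hcross :: "half_space \<Rightarrow> half_space \<Rightarrow> half_space" where
  "hcross x y = (of_real (Im (fst x) * snd y - snd x * Im (fst y)) + \<i> * of_real (snd x * Re (fst y) - Re (fst x) * snd y),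
     Re (fst x) * Im (fst y) - Im (fst x) * Re (fst y))"

lemma inner_half_space_Re_Im: "(x::half_space) \<bullet> y = Re (fst x) * Re (fst y) + Im (fst x) * Im (fst y) + snd x * snd y"
  by (simp add: inner_half_space)

lemma half_space_eq_iff: "(x::half_space) = y \<longleftrightarrow> Re (fst x) = Re (fst y) \<and> Im (fst x) = Im (fst y) \<and> snd x = snd y"
  by (auto simp: prod_eq_iff complex_eq_iff)

lemma norm_hcross: "hcross x y \<bullet> hcross x y = (x \<bullet> x) * (y \<bullet> y) - (x \<bullet> y)\<^sup>2"
  unfolding inner_half_space_Re_Im hcross_def by simp algebra

lemma perp_parallel_hcross:
  assumes "n \<bullet> x = 0" "n \<bullet> y = 0"
  shows "(hcross x y \<bullet> hcross x y) *\<^sub>R n = (n \<bullet> hcross x y) *\<^sub>R hcross x y"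
  using assms unfolding half_space_eq_iff inner_half_space_Re_Im hcross_def
  by (simp; intro conjI; algebra)

lemma hcross_nonzero:
  assumes "\<And>s t. s *\<^sub>R x + t *\<^sub>R y = 0 \<Longrightarrow> s = 0 \<and> t = 0"
  shows "hcross x y \<noteq> 0"
proof
  assume "hcross x y = 0"
  then have e: "(x \<bullet> x) * (y \<bullet> y) = (x \<bullet> y)\<^sup>2" using norm_hcross[of x y] by simp
  define v where "v = (- (x \<bullet> y)) *\<^sub>R x + (x \<bullet> x) *\<^sub>R y"
  have "v \<bullet> v = (x \<bullet> x) * ((x \<bullet> x) * (y \<bullet> y) - (x \<bullet> y)\<^sup>2)"
    by (simp add: v_def inner_add_left inner_add_right inner_diff_left inner_diff_right inner_commute[of y x] algebra_simps power2_eq_square)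
  then have "v = 0" using e by simp
  then have "x \<bullet> x = 0" using assms unfolding v_def by blast
  then have "1 *\<^sub>R x + 0 *\<^sub>R y = 0" by simp
  then show False using assms by fastforce
qed

lemma C_k_on_hcross:
  assumes "open S" "C_k_on k x S" "C_k_on k y S"
  shows "C_k_on k (\<lambda>p. hcross (x p) (y p)) S"
  unfolding hcross_def
  by (intro C_k_on_Pair C_k_on_add C_k_on_diff C_k_on_mult C_k_on_of_real C_k_on_const C_k_on_Re C_k_on_Im C_k_on_fst C_k_on_snd assms)

text \<open>The normal is the normalised vector product of the coordinate vector fields up to a sign, and the sign is locally constant
  by continuity. One derivative is lost.\<close>

lemma unit_normal_C_k:
  fixes g :: "R2 \<Rightarrow> half_space"
  assumes V: "open V" "connected V" and g: "C_k_on (Suc k) g V"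
    and H3: "\<And>p. p \<in> V \<Longrightarrow> g p \<in> H3"
    and inj: "\<And>p. p \<in> V \<Longrightarrow> inj (frechet_derivative g (at p))"
    and cont: "continuous_on V n" and unit: "\<And>p. p \<in> V \<Longrightarrow> norm (n p) = snd (g p)"
    and orth: "\<And>p v. p \<in> V \<Longrightarrow> n p \<bullet> frechet_derivative g (at p) v = 0"
  shows "C_k_on k n V"
proof (cases "V = {}")
  case True
  then show ?thesis by (intro C_k_on_cong[OF V(1) C_k_on_const[OF V(1)]]) auto
next
  case False
  define x where "x p = frechet_derivative g (at p) (1,0)" for p
  define y where "y p = frechet_derivative g (at p) (0,1)" for p
  define w where "w p = hcross (x p) (y p)" for p
  have xy: "C_k_on k x V" "C_k_on k y V" using g by (simp_all add: x_def[abs_def] y_def[abs_def])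
  have w: "C_k_on k w V" unfolding w_def[abs_def] by (intro C_k_on_hcross V xy)
  have w0: "w p \<noteq> 0" if p: "p \<in> V" for p
    unfolding w_def
  proof (rule hcross_nonzero)
    fix s t assume "s *\<^sub>R x p + t *\<^sub>R y p = 0"
    moreover have lin: "linear (frechet_derivative g (at p))"
      using C_k_on_Suc_has_derivative[OF g V(1) p] has_derivative_linear by blast
    ultimately have "frechet_derivative g (at p) (s *\<^sub>R (1,0) + t *\<^sub>R (0,1)) = 0"
      by (simp only: linear_add[OF lin] linear_cmul[OF lin] x_def y_def)
    then have "s *\<^sub>R (1,0) + t *\<^sub>R (0,1::real) = (0::R2)"
      using inj[OF p] lin linear_injective_0 by blast
    then show "s = 0 \<and> t = 0" by (simp add: zero_prod_def)
  qed
  have t: "snd (g p) > 0" if "p \<in> V" for p using H3[OF that] by (simp add: H3_def)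
  have nw: "(w p \<bullet> w p) *\<^sub>R n p = (n p \<bullet> w p) *\<^sub>R w p" if p: "p \<in> V" for p
    unfolding w_def by (rule perp_parallel_hcross) (simp_all add: x_def y_def orth[OF p])
  define s where "s p = (n p \<bullet> w p) / (snd (g p) * sqrt (w p \<bullet> w p))" for p
  have s2: "s p = 1 \<or> s p = - 1" if p: "p \<in> V" for p
  proof -
    have ww: "w p \<bullet> w p > 0" using w0[OF p] by simp
    have "(w p \<bullet> w p) * (n p \<bullet> n p) = (n p \<bullet> w p) * (n p \<bullet> w p)"
      using arg_cong[OF nw[OF p], of "\<lambda>z. n p \<bullet> z"] by simp
    moreover have "n p \<bullet> n p = (snd (g p))\<^sup>2" using unit[OF p] by (simp add: dot_square_norm)
    ultimately have e: "(snd (g p) * sqrt (w p \<bullet> w p))\<^sup>2 = (n p \<bullet> w p)\<^sup>2"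
      using ww by (simp add: power_mult_distrib) (simp add: power2_eq_square mult.commute)
    have "snd (g p) * sqrt (w p \<bullet> w p) \<noteq> 0" using ww t[OF p] by simp
    then have "(s p)\<^sup>2 = 1" unfolding s_def power_divide e[symmetric] by simp
    then show ?thesis by (simp add: power2_eq_1_iff)
  qed
  have gc: "continuous_on V g" "continuous_on V w"
    using C_k_on_le[OF V(1) g, of 0] C_k_on_le[OF V(1) w, of 0] by simp_all
  have "continuous_on V s"
    unfolding s_def using w0 t by (intro continuous_intros gc cont) (auto simp: less_imp_neq[symmetric])
  then have "connected (s ` V)" using V(2) connected_continuous_image by blast
  moreover have "s ` V \<subseteq> {1, - 1}" using s2 by auto
  then have "finite (s ` V)" by (rule finite_subset) simp
  ultimately obtain s0 where s0: "\<And>p. p \<in> V \<Longrightarrow> s p = s0"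
    using connected_finite_iff_sing False by (metis image_eqI image_is_empty singletonD)
  have "n p = (s0 * snd (g p) / sqrt (w p \<bullet> w p)) *\<^sub>R w p" if p: "p \<in> V" for p
  proof -
    have ww: "w p \<bullet> w p > 0" using w0[OF p] by simp
    have "n p = ((n p \<bullet> w p) / (w p \<bullet> w p)) *\<^sub>R w p"
      using nw[OF p] ww by (metis (no_types, lifting) divide_inverse less_irrefl mult.commute scaleR_one scaleR_scaleR right_inverse)
    moreover have "(n p \<bullet> w p) / (w p \<bullet> w p) = s0 * snd (g p) / sqrt (w p \<bullet> w p)"
      unfolding s0[OF p, symmetric] s_def using ww t[OF p] by (simp add: field_simps)
    ultimately show ?thesis by simp
  qed
  moreover have "C_k_on k (\<lambda>p. (s0 * snd (g p) / sqrt (w p \<bullet> w p)) *\<^sub>R w p) V"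
    using w0 by (intro C_k_on_scaleR C_k_on_divide C_k_on_mult C_k_on_const C_k_on_sqrt C_k_on_inner C_k_on_snd w V(1)
        C_k_on_Suc_imp[OF V(1) g]) auto
  ultimately show ?thesis using C_k_on_cong[OF V(1)] by (metis (no_types, lifting))
qed

lemma C_k_on_coords_of:
  fixes x v :: "'a::euclidean_space \<Rightarrow> half_space"
  assumes S: "open S" and x: "C_k_on k x S" and v: "C_k_on k v S"
    and good: "\<And>p. p \<in> S \<Longrightarrow> in_chart b (x p) (v p)"
  shows "C_k_on k (\<lambda>p. coords_of b (x p) (v p)) S"
proof -
  have cm: "(cmod z)\<^sup>2 = z \<bullet> z" "Re (cnj z * w) = z \<bullet> w" for z w
    by (simp_all add: dot_square_norm inner_complex_def)
  have m: "C_k_on k (\<lambda>p. mat11 (x p) (u p)) S" "C_k_on k (\<lambda>p. mat12 (x p) (u p)) S" "C_k_on k (\<lambda>p. mat22 (x p) (u p)) S"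
    if u: "C_k_on k u S" for u :: "'a \<Rightarrow> half_space"
    unfolding mat11_def mat12_def mat22_def cm power2_eq_square[of "snd _"]
    by (intro C_k_on_add C_k_on_diff C_k_on_mult C_k_on_of_real C_k_on_const C_k_on_inner C_k_on_fst C_k_on_snd S x u)+
  have mv: "C_k_on k (\<lambda>p. - v p) S" by (intro C_k_on_minus S v)
  show ?thesis
  proof (cases b)
    case True
    show ?thesis
      unfolding coords_of_def using good True
      by simp (intro C_k_on_Pair C_k_on_divide C_k_on_minus C_k_on_of_real m S v mv; auto simp: in_chart_def)
  next
    case False
    show ?thesis
      unfolding coords_of_def using good False
      by simp (intro C_k_on_Pair C_k_on_divide C_k_on_minus C_k_on_cnj C_k_on_of_real m S v mv; auto simp: in_chart_def)
  qed
qed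

section \<open>Immersed surfaces\<close>

locale immersed_surface =
  fixes M :: "'m::topological_space set" and f N :: "'m \<Rightarrow> half_space"
  assumes surf: "oriented_immersed_surface M f N"
begin

abbreviation \<sigma> :: "'m \<Rightarrow> oriented_geodesic" where "\<sigma> \<equiv> normal_geodesic f N"

lemma f_H3: "m \<in> M \<Longrightarrow> f m \<in> H3" and unit_N: "m \<in> M \<Longrightarrow> hyp_norm (f m) (N m) = 1"
  using surf by (auto simp: oriented_immersed_surface_def)

lemma norm_N: "m \<in> M \<Longrightarrow> norm (N m) = snd (f m)"
  using f_H3[of m] unit_N[of m] by (simp add: hyp_norm_def H3_def field_simps)

lemma connM: "connected M" and M_nonempty: "M \<noteq> {}"
  using surf by (auto simp: oriented_immersed_surface_def)

lemma \<sigma>_props: "m \<in> M \<Longrightarrow> \<sigma> m \<in> LH3" "m \<in> M \<Longrightarrow> (f m, N m) \<in> \<sigma> m"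
  "m \<in> M \<Longrightarrow> l \<in> LH3 \<Longrightarrow> (f m, N m) \<in> l \<Longrightarrow> \<sigma> m = l"
  using normal_geodesic_props[where f = f and N = N, OF f_H3 unit_N] by auto

lemma local_params_restrict:
  assumes VP: "(V, \<phi>) \<in> local_params M f" and U: "open U" "U \<subseteq> V"
  shows "(U, \<phi>) \<in> local_params M f"
proof -
  from VP obtain \<psi> where V: "open V" "openin (top_of_set M) (\<phi> ` V)" "homeomorphism V (\<phi> ` V) \<phi> \<psi>"
    "C_k_on 3 (f \<circ> \<phi>) V" "\<forall>p\<in>V. inj (frechet_derivative (f \<circ> \<phi>) (at p))"
    unfolding local_params_def by blast
  have "openin (top_of_set V) U" using U by (simp add: openin_open_eq V(1))
  then have "openin (top_of_set (\<phi> ` V)) (\<phi> ` U)" using homeomorphism_imp_open_map[OF V(3)] by blast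
  then have "openin (top_of_set M) (\<phi> ` U)" using V(2) openin_trans by blast
  moreover have "homeomorphism U (\<phi> ` U) \<phi> \<psi>"
    using homeomorphism_of_subsets[OF V(3) U(2), of "\<phi> ` U" "\<phi> ` U"] U(2) by blast
  ultimately show ?thesis
    using U V(4,5) C_k_on_subset unfolding local_params_def by blast
qed

lemma local_param_props:
  assumes VP: "(V, \<phi>) \<in> local_params M f"
  shows "open V" "openin (top_of_set M) (\<phi> ` V)" "continuous_on V \<phi>" "C_k_on 3 (f \<circ> \<phi>) V"
    "\<And>p. p \<in> V \<Longrightarrow> inj (frechet_derivative (f \<circ> \<phi>) (at p))"
    "\<And>p. p \<in> V \<Longrightarrow> \<phi> p \<in> M"
    "\<And>p. p \<in> V \<Longrightarrow> ((f \<circ> \<phi>) has_derivative frechet_derivative (f \<circ> \<phi>) (at p)) (at p)"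
    "\<And>p w. p \<in> V \<Longrightarrow> (N \<circ> \<phi>) p \<bullet> frechet_derivative (f \<circ> \<phi>) (at p) w = 0"
    "\<And>p w. p \<in> V \<Longrightarrow> frechet_derivative (f \<circ> \<phi>) (at p) w = 0 \<Longrightarrow> w = 0"
    "continuous_on V (N \<circ> \<phi>)"
proof -
  from VP show V: "open V" "openin (top_of_set M) (\<phi> ` V)" "C_k_on 3 (f \<circ> \<phi>) V"
    "\<And>p. p \<in> V \<Longrightarrow> inj (frechet_derivative (f \<circ> \<phi>) (at p))"
    unfolding local_params_def by auto
  from VP show c: "continuous_on V \<phi>" unfolding local_params_def homeomorphism_def by auto
  show m: "\<phi> p \<in> M" if "p \<in> V" for p using V(2) that openin_imp_subset by blast
  show d: "((f \<circ> \<phi>) has_derivative frechet_derivative (f \<circ> \<phi>) (at p)) (at p)" if "p \<in> V" for p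
    using C_k_on_Suc_has_derivative[of 2 "f \<circ> \<phi>" V p] V that by (simp add: numeral_3_eq_3 numeral_2_eq_2)
  show "(N \<circ> \<phi>) p \<bullet> frechet_derivative (f \<circ> \<phi>) (at p) w = 0" if "p \<in> V" for p w
    using surf VP that unfolding oriented_immersed_surface_def by fastforce
  show "w = 0" if "p \<in> V" "frechet_derivative (f \<circ> \<phi>) (at p) w = 0" for p w
    using V(4)[OF that(1)] has_derivative_linear[OF d[OF that(1)]] that(2) linear_injective_0 by blast
  have "continuous_on M N" using surf by (simp add: oriented_immersed_surface_def)
  moreover have "\<phi> ` V \<subseteq> M" using m by blast
  ultimately have "continuous_on (\<phi> ` V) N" by (rule continuous_on_subset)
  with c show "continuous_on V (N \<circ> \<phi>)" by (rule continuous_on_compose)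
qed

definition normal_patch :: "R2 set \<Rightarrow> (R2 \<Rightarrow> 'm) \<Rightarrow> bool \<Rightarrow> (R2 \<Rightarrow> coords) \<Rightarrow> bool" where
  "normal_patch V \<phi> c F \<longleftrightarrow> (V, \<phi>) \<in> local_params M f \<and> connected V \<and>
     congruence_patch V F c (f \<circ> \<phi>) (N \<circ> \<phi>) (\<lambda>p. frechet_derivative (f \<circ> \<phi>) (at p)) \<and>
     (\<forall>p\<in>V. chart_of c (F p) = \<sigma> (\<phi> p))"

lemma normal_patchI:
  assumes VP: "(V, \<phi>) \<in> local_params M f" and "connected V" and F: "C_k_on 2 F V"
    and dom: "\<And>p. p \<in> V \<Longrightarrow> F p \<in> coord_domain" and ch: "\<And>p. p \<in> V \<Longrightarrow> chart_of c (F p) = \<sigma> (\<phi> p)"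
  shows "normal_patch V \<phi> c F"
proof -
  note P = local_param_props[OF VP]
  have "congruence_patch V F c (f \<circ> \<phi>) (N \<circ> \<phi>) (\<lambda>p. frechet_derivative (f \<circ> \<phi>) (at p))"
  proof unfold_locales
    show "((f \<circ> \<phi>) p, (N \<circ> \<phi>) p) \<in> chart_of c (F p)" if "p \<in> V" for p
      using \<sigma>_props(2)[OF P(6)[OF that]] ch[OF that] by simp
  qed (use P F dom in auto)
  then show ?thesis using VP \<open>connected V\<close> ch by (simp add: normal_patch_def)
qed

lemma normal_patch_ex:
  assumes "m \<in> M"
  obtains V \<phi> c F p where "normal_patch V \<phi> c F" "p \<in> V" "\<phi> p = m"
proof -
  obtain V0 \<phi> where VP: "(V0, \<phi>) \<in> local_params M f" "m \<in> \<phi> ` V0"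
    using surf assms unfolding oriented_immersed_surface_def by blast
  then obtain p where p: "p \<in> V0" "\<phi> p = m" by blast
  note P = local_param_props[OF VP(1)]
  define g n where "g = f \<circ> \<phi>" and "n = N \<circ> \<phi>"
  obtain c where c: "in_chart c (g p) (n p)"
    using chart_of_coords_of(1)[OF f_H3 norm_N, OF assms assms] p(2) unfolding g_def n_def by auto
  define G where "G = {q \<in> V0. in_chart c (g q) (n q)}"
  have gc: "continuous_on V0 g" using C_k_on_le[OF P(1,4), of 0] by (simp add: g_def)
  have mc: "continuous_on V0 (\<lambda>q. mat11 (g q) (u q))" "continuous_on V0 (\<lambda>q. mat22 (g q) (u q))"
    if "continuous_on V0 u" for u :: "R2 \<Rightarrow> half_space"
    unfolding mat11_def mat22_def by (intro continuous_intros gc that)+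
  have nc: "continuous_on V0 n" "continuous_on V0 (\<lambda>q. - n q)" using P(10) by (simp_all add: n_def continuous_on_minus)
  have "open G"
  proof -
    have o: "open {q \<in> V0. h q \<noteq> 0}" if "continuous_on V0 h" for h :: "R2 \<Rightarrow> real"
    proof -
      have "{q \<in> V0. h q \<noteq> 0} = V0 \<inter> h -` (- {0})" by auto
      then show ?thesis using continuous_open_preimage[OF that P(1) open_Compl[OF closed_singleton]] by simp
    qed
    have "G = (if c then {q \<in> V0. mat11 (g q) (n q) \<noteq> 0} \<inter> {q \<in> V0. mat22 (g q) (- n q) \<noteq> 0}
       else {q \<in> V0. mat22 (g q) (n q) \<noteq> 0} \<inter> {q \<in> V0. mat11 (g q) (- n q) \<noteq> 0})"
      by (auto simp: G_def in_chart_def)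
    then show ?thesis using o mc nc by (auto intro!: open_Int)
  qed
  moreover have "p \<in> G" using p c by (simp add: G_def)
  ultimately obtain r where r: "r > 0" "ball p r \<subseteq> G" using openE by blast
  define V where "V = ball p r"
  have V: "open V" "connected V" "V \<subseteq> V0" "p \<in> V" using r by (auto simp: V_def G_def)
  have VP': "(V, \<phi>) \<in> local_params M f" by (rule local_params_restrict[OF VP(1) V(1,3)])
  note P' = local_param_props[OF VP']
  have good: "in_chart c (g q) (n q)" if "q \<in> V" for q using r(2) that by (auto simp: V_def G_def)
  have gH: "g q \<in> H3" "norm (n q) = snd (g q)" if "q \<in> V" for q
    using f_H3[OF P'(6)[OF that]] norm_N[OF P'(6)[OF that]] by (simp_all add: g_def n_def)
  have C3: "C_k_on (Suc 2) g V" using P'(4) by (simp add: g_def numeral_3_eq_3 numeral_2_eq_2)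
  have nC: "C_k_on 2 n V"
    by (rule unit_normal_C_k[OF V(1,2) C3]) (use gH P'(5,8,10) in \<open>auto simp: g_def n_def\<close>)
  define F where "F q = coords_of c (g q) (n q)" for q
  have FC: "C_k_on 2 F V"
    unfolding F_def by (intro C_k_on_coords_of V(1) nC good C_k_on_Suc_imp[OF V(1) C3])
  have "normal_patch V \<phi> c F"
  proof (rule normal_patchI[OF VP' V(2) FC])
    fix q assume q: "q \<in> V"
    note cc = chart_of_coords_of(2)[OF gH[OF q] good[OF q]]
    show "F q \<in> coord_domain" using cc by (simp add: F_def)
    have "chart_of c (F q) \<in> LH3" using cc unfolding LH3_eq F_def by blast
    then show "chart_of c (F q) = \<sigma> (\<phi> q)"
      using \<sigma>_props(3)[OF P'(6)[OF q], of "chart_of c (F q)"] cc by (simp add: F_def g_def n_def)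
  qed
  then show ?thesis using that V(4) p(2) by blast
qed

end

section \<open>Surfaces orthogonal to an axis\<close>

text \<open>The second chart differs from the first by the exchange of 0 and \<open>\<infinity>\<close> on the boundary sphere, which acts on quadratic
  forms in this way.\<close>

definition flip_quadric :: "bool \<Rightarrow> quadric \<Rightarrow> quadric" where
  "flip_quadric c P = (case P of (p, m, n) \<Rightarrow> if c then (p, m, n) else (- p, n, m))"

definition scale_quadric :: "complex \<Rightarrow> quadric \<Rightarrow> quadric" where
  "scale_quadric s P = (case P of (p, m, n) \<Rightarrow> (s * p, s * m, s * n))"

lemma graph_eq_flip: "graph_eq c P A B = graph_eq True (flip_quadric c P) A B"
  by (cases P) (auto simp: graph_eq_def flip_quadric_def algebra_simps)

lemma flip_flip: "flip_quadric c (flip_quadric c P) = P"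
  by (cases P) (auto simp: flip_quadric_def)

lemma discr_flip: "discr (flip_quadric c P) = discr P"
  by (cases P) (auto simp: discr_def flip_quadric_def algebra_simps)

lemma flip_scale: "flip_quadric c (scale_quadric s P) = scale_quadric s (flip_quadric c P)"
  by (cases P) (auto simp: flip_quadric_def scale_quadric_def)

lemma discr_scale: "discr (scale_quadric s P) = s\<^sup>2 * discr P"
  by (cases P) (auto simp: discr_def scale_quadric_def algebra_simps power2_eq_square)

lemma graph_eq_scale: "graph_eq c (scale_quadric s P) A B = s * graph_eq c P A B"
  by (cases P) (auto simp: graph_eq_def scale_quadric_def algebra_simps)

lemma scale_scale: "scale_quadric s (scale_quadric t P) = scale_quadric (s * t) P"
  by (cases P) (auto simp: scale_quadric_def)

lemma scale_one: "scale_quadric 1 P = P"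
  by (cases P) (auto simp: scale_quadric_def)

lemma meets_perp_scale: "meets_perp P l \<Longrightarrow> meets_perp (scale_quadric s P) l"
  unfolding meets_perp_def polar_spinor by (metis graph_eq_scale minus_zero mult_zero_right neg_equal_0_iff_equal)

lemma openin_subtopologyI:
  assumes "S \<subseteq> G" "\<And>x. x \<in> S \<Longrightarrow> \<exists>T. open T \<and> x \<in> T \<and> G \<inter> T \<subseteq> S"
  shows "openin (top_of_set G) S"
proof -
  obtain T where T: "\<And>x. x \<in> S \<Longrightarrow> open (T x) \<and> x \<in> T x \<and> G \<inter> T x \<subseteq> S"
    using assms(2) by metis
  have "S = G \<inter> (\<Union>x\<in>S. T x)" using T assms(1) by blast
  moreover have "open (\<Union>x\<in>S. T x)" using T by blast
  ultimately show ?thesis unfolding openin_open by blast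
qed

context congruence_patch
begin

lemma meets_perp_iff: "p \<in> V \<Longrightarrow> meets_perp P (chart_of c (F p)) \<longleftrightarrow> graph_eq True (flip_quadric c P) (A p) (B p) = 0"
  using meets_perp_chart[OF dom] graph_eq_flip by (simp add: A_def B_def)

lemma polar_patch: "p \<in> V \<Longrightarrow> meets_perp P (chart_of c (F p)) \<longleftrightarrow> polar P (xi p) (eta p) = 0"
  using meets_perp_chart[OF dom] by (simp add: xi_def eta_def polar_spinor)

lemma linear_theta:
  assumes "p \<in> V" shows "linear (\<lambda>w. R p * cnj (b p w) - a p w / R p)"
proof -
  note lin = linear_a[OF assms] linear_b[OF assms]
  show ?thesis
  proof (rule linearI)
    have 1: "r * cnj (u + v) - (x + y) / r = (r * cnj u - x / r) + (r * cnj v - y / r)" for r u v x y :: complex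
      by (simp add: distrib_left add_divide_distrib)
    have 2: "r * cnj (s *\<^sub>R u) - (s *\<^sub>R x) / r = s *\<^sub>R (r * cnj u - x / r)" for r u x :: complex and s :: real
      by (simp add: scaleR_conv_of_real right_diff_distrib)
    show "R p * cnj (b p (v + w)) - a p (v + w) / R p = (R p * cnj (b p v) - a p v / R p) + (R p * cnj (b p w) - a p w / R p)" for v w
      unfolding linear_add[OF lin(1)] linear_add[OF lin(2)] by (rule 1)
    show "R p * cnj (b p (s *\<^sub>R w)) - a p (s *\<^sub>R w) / R p = s *\<^sub>R (R p * cnj (b p w) - a p w / R p)" for s w
      unfolding linear_cmul[OF lin(1)] linear_cmul[OF lin(2)] by (rule 2)
  qed
qed

lemma geo_normal_in_range:
  assumes p: "p \<in> V" shows "\<exists>w. g' p w = geo_normal (xi p) (eta p) (R p) \<theta>"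
proof -
  have "surj (\<lambda>w. R p * cnj (b p w) - a p w / R p)"
    by (rule linear_R2_independent(2)[OF linear_theta[OF p] theta_inj[OF p]])
  from surjD[OF this, of "if c then \<theta> else - \<theta>"]
  obtain w where "R p * cnj (b p w) - a p w / R p = (if c then \<theta> else - \<theta>)" by auto
  then have "g' p w = geo_normal (xi p) (eta p) (R p) \<theta>" unfolding g'_eq(2)[OF p] by (cases c) auto
  then show ?thesis ..
qed

end

context immersed_surface
begin

lemma meets_perp_imp_maximal:
  assumes "discr P \<noteq> 0" "\<And>m. m \<in> M \<Longrightarrow> meets_perp P (\<sigma> m)"
  shows "maximal_surface M (local_params M f) \<sigma>"
  unfolding maximal_surface_def
proof
  fix m assume "m \<in> M"
  then obtain V \<phi> c F p where np: "normal_patch V \<phi> c F" and p: "p \<in> V" "\<phi> p = m"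
    using normal_patch_ex by blast
  then interpret congruence_patch V F c "f \<circ> \<phi>" "N \<circ> \<phi>" "\<lambda>p. frechet_derivative (f \<circ> \<phi>) (at p)"
    by (simp add: normal_patch_def)
  have VP: "(V, \<phi>) \<in> local_params M f" and ch: "\<And>q. q \<in> V \<Longrightarrow> chart_of c (F q) = \<sigma> (\<phi> q)"
    using np by (auto simp: normal_patch_def)
  have gr: "graph_eq True (flip_quadric c P) (A q) (B q) = 0" if q: "q \<in> V" for q
    using assms(2)[OF local_param_props(6)[OF VP q]] meets_perp_iff[OF q] ch[OF q] by simp
  have d: "discr (flip_quadric c P) \<noteq> 0" using assms(1) by (simp add: discr_flip)
  have mx: "induced_det neutral_metric F q \<noteq> 0 \<and> mean_curvature_vector neutral_metric F q = 0" if q: "q \<in> V" for q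
    using graph_imp_maximal[OF gr d _ q] dF_inj by blast
  have "chart_of c \<in> {chart, chart'}" by (simp add: chart_of_def)
  moreover have "C_k_on 2 F V \<and> (\<forall>q\<in>V. F q \<in> coord_domain \<and> chart_of c (F q) = \<sigma> (\<phi> q) \<and>
      induced_det neutral_metric F q \<noteq> 0 \<and> mean_curvature_vector neutral_metric F q = 0)"
    using C2 dom ch mx by blast
  ultimately show "\<exists>(V, \<phi>)\<in>local_params M f. m \<in> \<phi> ` V \<and>
        (\<exists>c\<in>{chart, chart'}. \<exists>F. C_k_on 2 F V \<and>
           (\<forall>p\<in>V. F p \<in> coord_domain \<and> c (F p) = \<sigma> (\<phi> p) \<and>
              induced_det neutral_metric F p \<noteq> 0 \<and> mean_curvature_vector neutral_metric F p = 0))"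
    using VP p by blast
qed

text \<open>The relation between distance and orthogonality: off the axis, the gradient of the form does not vanish, and it is parallel
  to the normal of the surface if and only if the normal meets the axis orthogonally.\<close>

lemma axis_form_deriv_zero:
  assumes np: "normal_patch V \<phi> c F" and p: "p \<in> V" and D: "(axis_form \<xi>0 \<eta>0 has_derivative D) (at (f (\<phi> p)))"
  shows "meets_perp (axis_quadric \<xi>0 \<eta>0) (\<sigma> (\<phi> p)) \<Longrightarrow> D (frechet_derivative (f \<circ> \<phi>) (at p) w) = 0"
    and "meets_perp (axis_quadric \<xi>0 \<eta>0) (\<sigma> (\<phi> p)) \<Longrightarrow> D (N (\<phi> p)) = 0 \<Longrightarrow> axis_form \<xi>0 \<eta>0 (f (\<phi> p)) = (cmod (wedge \<xi>0 \<eta>0))\<^sup>2"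
    and "(\<And>w. D (frechet_derivative (f \<circ> \<phi>) (at p) w) = 0) \<Longrightarrow> axis_form \<xi>0 \<eta>0 (f (\<phi> p)) \<noteq> (cmod (wedge \<xi>0 \<eta>0))\<^sup>2 \<Longrightarrow>
      meets_perp (axis_quadric \<xi>0 \<eta>0) (\<sigma> (\<phi> p))"
proof -
  interpret congruence_patch V F c "f \<circ> \<phi>" "N \<circ> \<phi>" "\<lambda>p. frechet_derivative (f \<circ> \<phi>) (at p)"
    using np by (simp add: normal_patch_def)
  have ch: "chart_of c (F p) = \<sigma> (\<phi> p)" using np p by (auto simp: normal_patch_def)
  have W: "wedge (xi p) (eta p) \<noteq> 0" using D_nz[OF p] by (simp add: wedge_D)
  note Rp = R_props[OF p]
  have fp: "f (\<phi> p) = geo_point (xi p) (eta p) (R p)" "N (\<phi> p) = geo_velocity (xi p) (eta p) (R p)" using Rp(2,3) by simp_all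
  note D' = D[unfolded fp]
  have mp: "meets_perp (axis_quadric \<xi>0 \<eta>0) (\<sigma> (\<phi> p)) \<longleftrightarrow> perp_form \<xi>0 \<eta>0 (xi p) (eta p) = 0"
    using polar_patch[OF p] ch by (simp add: polar_axis_quadric)
  show "meets_perp (axis_quadric \<xi>0 \<eta>0) (\<sigma> (\<phi> p)) \<Longrightarrow> D (frechet_derivative (f \<circ> \<phi>) (at p) w) = 0"
    unfolding mp g'_eq(2)[OF p] by (rule axis_form_perp_imp[OF W Rp(1) D'])
  show "meets_perp (axis_quadric \<xi>0 \<eta>0) (\<sigma> (\<phi> p)) \<Longrightarrow> D (N (\<phi> p)) = 0 \<Longrightarrow> axis_form \<xi>0 \<eta>0 (f (\<phi> p)) = (cmod (wedge \<xi>0 \<eta>0))\<^sup>2"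
    unfolding mp fp by (rule axis_form_critical_vel[OF W Rp(1) D'])
  show "meets_perp (axis_quadric \<xi>0 \<eta>0) (\<sigma> (\<phi> p))"
    if z: "\<And>w. D (frechet_derivative (f \<circ> \<phi>) (at p) w) = 0" and ne: "axis_form \<xi>0 \<eta>0 (f (\<phi> p)) \<noteq> (cmod (wedge \<xi>0 \<eta>0))\<^sup>2"
  proof -
    have "D (geo_normal (xi p) (eta p) (R p) \<theta>) = 0" for \<theta>
      using geo_normal_in_range[OF p, of \<theta>] z by metis
    from axis_form_critical[OF W Rp(1) D' this] ne show ?thesis unfolding mp fp by blast
  qed
qed

lemma tube_imp_meets_perp:
  assumes l: "l = chart_of b \<mu>" "\<mu> \<in> coord_domain" and "\<rho> > 0" and sub: "f ` M \<subseteq> equidistant_tube l \<rho>"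
  defines "P \<equiv> axis_quadric (end_spinor b \<mu>) (begin_spinor b \<mu>)"
  shows "discr P \<noteq> 0" "m \<in> M \<Longrightarrow> meets_perp P (\<sigma> m)"
proof -
  define \<xi>0 \<eta>0 where "\<xi>0 = end_spinor b \<mu>" and "\<eta>0 = begin_spinor b \<mu>"
  have W: "wedge \<xi>0 \<eta>0 \<noteq> 0" using wedge_spinor_nonzero[OF l(2)] by (simp add: \<xi>0_def \<eta>0_def)
  then show "discr P \<noteq> 0" by (simp add: P_def discr_axis_quadric \<xi>0_def \<eta>0_def)
  have "fst ` l = {geo_point \<xi>0 \<eta>0 R |R. R > 0}"
    unfolding l(1) chart_of_eq[OF l(2)] \<xi>0_def \<eta>0_def by force
  note tube = equidistant_tube_axis_form[OF W this \<open>\<rho> > 0\<close>]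
  define K where "K = (cosh \<rho> * cmod (wedge \<xi>0 \<eta>0))\<^sup>2"
  have K: "axis_form \<xi>0 \<eta>0 (f m) = K" if "m \<in> M" for m
    using sub that unfolding tube K_def by blast
  have "cosh \<rho> > 1" using \<open>\<rho> > 0\<close> cosh_real_strict_mono[of 0 \<rho>] by simp
  then have "K \<noteq> (cmod (wedge \<xi>0 \<eta>0))\<^sup>2"
    using W \<open>\<rho> > 0\<close> by (simp add: K_def power_mult_distrib power2_eq_1_iff)
  show "meets_perp P (\<sigma> m)" if m: "m \<in> M"
  proof -
    obtain V \<phi> c F p where np: "normal_patch V \<phi> c F" and p: "p \<in> V" "\<phi> p = m"
      using normal_patch_ex[OF m] by blast
    then have VP: "(V, \<phi>) \<in> local_params M f" by (auto simp: normal_patch_def)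
    note PP = local_param_props[OF VP]
    obtain D where D: "(axis_form \<xi>0 \<eta>0 has_derivative D) (at (f (\<phi> p)))"
      using axis_form_differentiable[OF f_H3[OF PP(6)[OF p(1)]]] unfolding differentiable_def by blast
    have "((\<lambda>q. axis_form \<xi>0 \<eta>0 ((f \<circ> \<phi>) q)) has_derivative (\<lambda>w. D (frechet_derivative (f \<circ> \<phi>) (at p) w))) (at p)"
      using has_derivative_compose[OF PP(7)[OF p(1)], of "axis_form \<xi>0 \<eta>0"] D by simp
    moreover have "((\<lambda>q. axis_form \<xi>0 \<eta>0 ((f \<circ> \<phi>) q)) has_derivative (\<lambda>w. 0)) (at p)"
      by (rule has_derivative_transform_within_open[OF has_derivative_const PP(1) p(1)]) (simp add: K PP(6))
    ultimately have "D (frechet_derivative (f \<circ> \<phi>) (at p) w) = 0" for w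
      using has_derivative_unique by (metis (no_types, lifting))
    from axis_form_deriv_zero(3)[OF np p(1) D this] K[OF m] \<open>K \<noteq> _\<close> p(2)
    show ?thesis by (simp add: P_def \<xi>0_def \<eta>0_def)
  qed
qed

definition maximal_patch :: "R2 set \<Rightarrow> (R2 \<Rightarrow> 'm) \<Rightarrow> bool \<Rightarrow> (R2 \<Rightarrow> coords) \<Rightarrow> bool" where
  "maximal_patch V \<phi> c F \<longleftrightarrow> normal_patch V \<phi> c F \<and>
    (\<forall>p\<in>V. induced_det neutral_metric F p \<noteq> 0 \<and> mean_curvature_vector neutral_metric F p = 0)"

lemma maximal_patch_ex:
  assumes "maximal_surface M (local_params M f) \<sigma>" "m \<in> M"
  obtains V \<phi> c F p where "maximal_patch V \<phi> c F" "p \<in> V" "\<phi> p = m"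
proof -
  obtain V0 \<phi> ch F where VP: "(V0, \<phi>) \<in> local_params M f" "m \<in> \<phi> ` V0" and ch: "ch \<in> {chart, chart'}"
    and F: "C_k_on 2 F V0" "\<forall>p\<in>V0. F p \<in> coord_domain \<and> ch (F p) = \<sigma> (\<phi> p) \<and>
              induced_det neutral_metric F p \<noteq> 0 \<and> mean_curvature_vector neutral_metric F p = 0"
    using assms unfolding maximal_surface_def by blast
  obtain c where c: "ch = chart_of c" using ch by (metis chart_of_def insert_iff singletonD)
  obtain p where p: "p \<in> V0" "\<phi> p = m" using VP(2) by blast
  obtain r where r: "r > 0" "ball p r \<subseteq> V0" using local_param_props(1)[OF VP(1)] p(1) openE by blast
  have "normal_patch (ball p r) \<phi> c F"
    by (rule normal_patchI) (use local_params_restrict[OF VP(1) open_ball r(2)] C_k_on_subset[OF F(1) r(2)] F(2) c r(2) in auto)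
  then have "maximal_patch (ball p r) \<phi> c F" using F(2) r(2) by (auto simp: maximal_patch_def)
  then show ?thesis using that[of "ball p r" \<phi> c F p] r(1) p(2) by simp
qed

text \<open>The axes that work near \<open>m\<close>. In contrast to the axis of a parametrised piece this depends on the point only, so that
  connectedness can be applied.\<close>

definition axis_at :: "'m \<Rightarrow> quadric set" where
  "axis_at m = {P. discr P \<noteq> 0 \<and> (\<exists>U. openin (top_of_set M) U \<and> m \<in> U \<and> (\<forall>m'\<in>U. meets_perp P (\<sigma> m')))}"

lemma maximal_patch_axis:
  assumes mp: "maximal_patch V \<phi> c F"
  shows "\<exists>P. discr P \<noteq> 0 \<and> (\<forall>q\<in>V. axis_at (\<phi> q) = {scale_quadric s P |s. s \<noteq> 0})"
proof (cases "V = {}")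
  case True
  then show ?thesis by (intro exI[of _ "(1, 0, 0)"]) (auto simp: discr_def)
next
  case False
  then obtain p where p: "p \<in> V" by blast
  have np: "normal_patch V \<phi> c F" using mp by (simp add: maximal_patch_def)
  interpret cp: congruence_patch V F c "f \<circ> \<phi>" "N \<circ> \<phi>" "\<lambda>p. frechet_derivative (f \<circ> \<phi>) (at p)"
    using np by (simp add: normal_patch_def)
  interpret mc: maximal_congruence V F cp.R cp.R'
    using mp by (intro cp.maximal_congruenceI) (auto simp: maximal_patch_def)
  have VP: "(V, \<phi>) \<in> local_params M f" and conn: "connected V" and ch: "\<And>q. q \<in> V \<Longrightarrow> chart_of c (F q) = \<sigma> (\<phi> q)"
    using np by (auto simp: normal_patch_def)
  note PP = local_param_props[OF VP]
  define P where "P = flip_quadric c (mc.local_axis p)"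
  have d: "discr P \<noteq> 0" using mc.local_axis_discr_nz[OF p] by (simp add: P_def discr_flip)
  have me: "meets_perp P (\<sigma> (\<phi> q))" if q: "q \<in> V" for q
    using mc.on_graph[OF conn q p] cp.meets_perp_iff[OF q] ch[OF q] by (simp add: P_def flip_flip)
  have "axis_at (\<phi> q) = {scale_quadric s P |s. s \<noteq> 0}" if q: "q \<in> V" for q
  proof -
    have uni: "\<exists>s. Q = scale_quadric s (flip_quadric c (mc.local_axis q))" if Q: "Q \<in> axis_at (\<phi> q)" for Q
    proof -
      obtain U where U: "openin (top_of_set M) U" "\<phi> q \<in> U" "\<forall>m'\<in>U. meets_perp Q (\<sigma> m')"
        using Q by (auto simp: axis_at_def)
      obtain O' where O': "open O'" "U = M \<inter> O'" using U(1) openin_open by blast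
      define T where "T = V \<inter> \<phi> -` O'"
      have T: "open T" "q \<in> T" "T \<subseteq> V"
        using continuous_open_preimage[OF PP(3,1) O'(1)] q U(2) O'(2) by (auto simp: T_def)
      have "graph_eq True (flip_quadric c Q) (cp.A x) (cp.B x) = 0" if "x \<in> T" for x
      proof -
        have x: "x \<in> V" "\<phi> x \<in> U" using that PP(6) O'(2) by (auto simp: T_def)
        then have "meets_perp Q (\<sigma> (\<phi> x))" using U(3) by blast
        then show ?thesis using cp.meets_perp_iff[OF x(1)] ch[OF x(1)] by simp
      qed
      from mc.local_axis_unique[OF q T this] obtain s where "flip_quadric c Q = scale_quadric s (mc.local_axis q)"
        unfolding scale_quadric_def by metis
      then have "Q = scale_quadric s (flip_quadric c (mc.local_axis q))" by (metis flip_flip flip_scale)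
      then show ?thesis ..
    qed
    have PV: "P \<in> axis_at (\<phi> q)"
      unfolding axis_at_def using d me PP(2) q by blast
    then obtain t where t: "P = scale_quadric t (flip_quadric c (mc.local_axis q))" using uni by blast
    have t0: "t \<noteq> 0" using d by (auto simp: t discr_scale)
    show ?thesis
    proof (intro set_eqI iffI)
      fix Q assume Q: "Q \<in> axis_at (\<phi> q)"
      then obtain s where s: "Q = scale_quadric s (flip_quadric c (mc.local_axis q))" using uni by blast
      have "s \<noteq> 0" using Q by (auto simp: s discr_scale axis_at_def)
      moreover have "Q = scale_quadric (s / t) P" using t0 by (simp add: s t scale_scale)
      ultimately show "Q \<in> {scale_quadric s P |s. s \<noteq> 0}" using t0 by (metis (mono_tags, lifting) divide_eq_0_iff mem_Collect_eq)
    next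
      fix Q assume "Q \<in> {scale_quadric s P |s. s \<noteq> 0}"
      then obtain s where s: "s \<noteq> 0" "Q = scale_quadric s P" by blast
      obtain U where "openin (top_of_set M) U" "\<phi> q \<in> U" "\<forall>m'\<in>U. meets_perp P (\<sigma> m')"
        using PV by (auto simp: axis_at_def)
      moreover from this have "\<forall>m'\<in>U. meets_perp Q (\<sigma> m')" using meets_perp_scale unfolding s(2) by blast
      moreover have "discr Q \<noteq> 0" using s d by (simp add: discr_scale)
      ultimately show "Q \<in> axis_at (\<phi> q)" unfolding axis_at_def by blast
    qed
  qed
  then show ?thesis using d by blast
qed

lemma maximal_imp_meets_perp:
  assumes mx: "maximal_surface M (local_params M f) \<sigma>"
  obtains P where "discr P \<noteq> 0" "\<And>m. m \<in> M \<Longrightarrow> meets_perp P (\<sigma> m)"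
proof -
  obtain m0 where m0: "m0 \<in> M" using M_nonempty by blast
  have lc: "\<forall>a\<in>M. eventually (\<lambda>b. axis_at a = axis_at b) (at a within M)"
  proof
    fix a assume "a \<in> M"
    then obtain V \<phi> c F p where mp: "maximal_patch V \<phi> c F" and p: "p \<in> V" "\<phi> p = a"
      using maximal_patch_ex[OF mx] by blast
    have VP: "(V, \<phi>) \<in> local_params M f" using mp by (auto simp: maximal_patch_def normal_patch_def)
    obtain O' where O': "open O'" "\<phi> ` V = M \<inter> O'" using local_param_props(2)[OF VP] openin_open by blast
    obtain P where P: "\<And>q. q \<in> V \<Longrightarrow> axis_at (\<phi> q) = {scale_quadric s P |s. s \<noteq> 0}"
      using maximal_patch_axis[OF mp] by blast
    show "eventually (\<lambda>b. axis_at a = axis_at b) (at a within M)"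
      unfolding eventually_at_topological
    proof (intro exI[of _ O'] conjI ballI impI)
      show "a \<in> O'" using O'(2) p by blast
      fix b assume "b \<in> O'" "b \<noteq> a" "b \<in> M"
      then obtain q where "q \<in> V" "b = \<phi> q" using O'(2) by blast
      then show "axis_at a = axis_at b" using P[of q] P[OF p(1)] p(2) by simp
    qed (rule O'(1))
  qed
  have const: "axis_at m = axis_at m0" if "m \<in> M" for m
    using connected_local_const[OF connM that m0 lc] .
  obtain V \<phi> c F p where mp: "maximal_patch V \<phi> c F" and p: "p \<in> V" "\<phi> p = m0"
    using maximal_patch_ex[OF mx m0] by blast
  obtain P where P: "discr P \<noteq> 0" "axis_at (\<phi> p) = {scale_quadric s P |s. s \<noteq> 0}"
    using maximal_patch_axis[OF mp] p(1) by blast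
  have "P = scale_quadric 1 P" by (simp add: scale_one)
  then have "P \<in> {scale_quadric s P |s. s \<noteq> 0}" by (metis (mono_tags, lifting) mem_Collect_eq zero_neq_one)
  then have "P \<in> axis_at m0" using P(2) p(2) by simp
  then have "meets_perp P (\<sigma> m)" if "m \<in> M" for m using const[OF that] by (auto simp: axis_at_def)
  then show ?thesis using that P(1) by blast
qed

end

lemma open_H3: "open H3"
  unfolding H3_def by (intro open_Collect_less continuous_intros)

lemma C_k_on_ident: "open S \<Longrightarrow> C_k_on k (\<lambda>x. x) S"
  by (cases k) (auto intro!: C_k_on_SucI[where f' = "\<lambda>x v. v"] C_k_on_const simp del: C_k_on.simps(2))

lemma C_k_on_axis_form: "C_k_on k (axis_form \<xi> \<eta>) H3"
proof -
  have q: "C_k_on k (horo s) H3" for s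
  proof -
    have cm: "(cmod z)\<^sup>2 = z \<bullet> z" for z by (simp add: dot_square_norm)
    show ?thesis
      unfolding horo_def[abs_def] cm[of "fst _"] power2_eq_square[of "snd _"]
      by (intro C_k_on_divide C_k_on_add C_k_on_diff C_k_on_mult C_k_on_Re C_k_on_inner C_k_on_const C_k_on_fst C_k_on_snd C_k_on_ident open_H3)
         (auto simp: H3_def)
  qed
  show ?thesis unfolding axis_form_def[abs_def] by (intro C_k_on_mult q open_H3)
qed

section \<open>Tubes and graphs\<close>

lemma on_axis:
  assumes W: "wedge \<xi> \<eta> \<noteq> 0" and x: "x \<in> H3" and ax: "axis_form \<xi> \<eta> x = (cmod (wedge \<xi> \<eta>))\<^sup>2"
  shows "\<exists>R>0. x = geo_point \<xi> \<eta> R"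
proof -
  define u v where "u = horo \<xi> x" and "v = horo \<eta> x"
  have "\<xi> \<noteq> 0" "\<eta> \<noteq> 0" using W by (auto simp: wedge_def zero_prod_def)
  then have uv: "u > 0" "v > 0" using horo_pos[OF x] by (auto simp: u_def v_def)
  define w where "w = cmod (wedge \<xi> \<eta>)"
  have w: "w > 0" "u * v = w\<^sup>2" using W ax by (simp_all add: w_def axis_form_def u_def v_def)
  define R where "R = w / u"
  have R: "R > 0" using uv w by (simp add: R_def)
  have "R * u + v / R = 2 * w"
    using uv w by (simp add: R_def field_simps power2_eq_square)
  then have "hyp_dist x (geo_point \<xi> \<eta> R) = arcosh 1"
    unfolding hyp_dist_geo_point[OF W R x] u_def[symmetric] v_def[symmetric] w_def[symmetric] using w by simp
  then have z: "arcosh (1 + (dist x (geo_point \<xi> \<eta> R))\<^sup>2 / (2 * snd x * snd (geo_point \<xi> \<eta> R))) = 0"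
    by (simp add: hyp_dist_def)
  have t: "snd x > 0" "snd (geo_point \<xi> \<eta> R) > 0" using x geo_point_in_H3[OF W R] by (simp_all add: H3_def)
  then have "1 + (dist x (geo_point \<xi> \<eta> R))\<^sup>2 / (2 * snd x * snd (geo_point \<xi> \<eta> R)) \<ge> 1" by simp
  then have "1 + (dist x (geo_point \<xi> \<eta> R))\<^sup>2 / (2 * snd x * snd (geo_point \<xi> \<eta> R)) = 1"
    using z arcosh_eq_0_iff_real by blast
  then have "x = geo_point \<xi> \<eta> R" using t by simp
  then show ?thesis using R by blast
qed

lemma linear_inj_imp_surj_3:
  fixes L :: "R2 \<times> real \<Rightarrow> half_space"
  assumes "linear L" "inj L"
  shows "surj L"
proof -
  have "dim (range L) = dim (UNIV :: (R2 \<times> real) set)"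
    using dim_image_eq[of L UNIV] assms by simp
  then have "dim (range L) = DIM(half_space)" by simp
  then have "span (range L) = UNIV" using dim_eq_full by blast
  then show ?thesis using linear_subspace_image[OF assms(1) subspace_UNIV] by (simp add: span_eq_iff[THEN iffD2])
qed

lemma graph_eq_unique:
  assumes "discr P \<noteq> 0" "graph_eq True P a b = 0" "graph_eq True P a b' = 0"
  shows "b = b'"
proof -
  obtain p m n where P: "P = (p, m, n)" by (cases P)
  have e: "p * (a * b - 1) + m * b + n * a = 0" "p * (a * b' - 1) + m * b' + n * a = 0"
    using assms(2,3) by (simp_all add: P graph_eq_def)
  have "(m + p * a) * (b - b') = 0" 
  proof -
    have "(m + p * a) * (b - b') = (p * (a * b - 1) + m * b + n * a) - (p * (a * b' - 1) + m * b' + n * a)"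
      by (simp add: algebra_simps)
    then show ?thesis unfolding e by simp
  qed
  moreover have "m + p * a \<noteq> 0"
  proof
    assume z: "m + p * a = 0"
    have "p - n * a = (m + p * a) * b" 
    proof -
      have "p - n * a - (m + p * a) * b = - (p * (a * b - 1) + m * b + n * a)" by (simp add: algebra_simps)
      then show ?thesis unfolding e by simp
    qed
    then have "p = n * a" using z by simp
    moreover have "m = - p * a" using z by (simp add: add_eq_0_iff2)
    ultimately have "discr P = 0" by (simp add: P discr_def power2_eq_square)
    then show False using assms(1) by simp
  qed
  ultimately show ?thesis by simp
qed

context immersed_surface
begin

lemma axis_form_const:
  assumes mp: "\<And>m. m \<in> M \<Longrightarrow> meets_perp (axis_quadric \<xi>0 \<eta>0) (\<sigma> m)" and m: "m \<in> M" "m' \<in> M"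
  shows "axis_form \<xi>0 \<eta>0 (f m) = axis_form \<xi>0 \<eta>0 (f m')"
proof (rule connected_local_const[OF connM m], intro ballI)
  fix a assume "a \<in> M"
  then obtain V \<phi> c F p where np: "normal_patch V \<phi> c F" and p: "p \<in> V" "\<phi> p = a"
    using normal_patch_ex by blast
  then have VP: "(V, \<phi>) \<in> local_params M f" and conn: "connected V" by (auto simp: normal_patch_def)
  note PP = local_param_props[OF VP]
  have "((\<lambda>q. axis_form \<xi>0 \<eta>0 (f (\<phi> q))) has_derivative (\<lambda>w. 0)) (at q)" if q: "q \<in> V" for q
  proof -
    obtain D where D: "(axis_form \<xi>0 \<eta>0 has_derivative D) (at (f (\<phi> q)))"
      using axis_form_differentiable[OF f_H3[OF PP(6)[OF q]]] unfolding differentiable_def by blast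
    have "((\<lambda>q. axis_form \<xi>0 \<eta>0 ((f \<circ> \<phi>) q)) has_derivative (\<lambda>w. D (frechet_derivative (f \<circ> \<phi>) (at q) w))) (at q)"
      using has_derivative_compose[OF PP(7)[OF q], of "axis_form \<xi>0 \<eta>0"] D by simp
    then show ?thesis using axis_form_deriv_zero(1)[OF np q D mp[OF PP(6)[OF q]]] by simp
  qed
  from has_derivative_zero_unique_connected[OF PP(1) conn this p(1)]
  have c: "axis_form \<xi>0 \<eta>0 (f a) = axis_form \<xi>0 \<eta>0 (f (\<phi> q))" if "q \<in> V" for q using that p(2) by metis
  obtain O' where O': "open O'" "\<phi> ` V = M \<inter> O'" using PP(2) openin_open by blast
  show "eventually (\<lambda>b. axis_form \<xi>0 \<eta>0 (f a) = axis_form \<xi>0 \<eta>0 (f b)) (at a within M)"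
    unfolding eventually_at_topological
  proof (intro exI[of _ O'] conjI ballI impI)
    show "a \<in> O'" using O'(2) p by blast
    fix b assume "b \<in> O'" "b \<noteq> a" "b \<in> M"
    then obtain q where "q \<in> V" "b = \<phi> q" using O'(2) by blast
    then show "axis_form \<xi>0 \<eta>0 (f a) = axis_form \<xi>0 \<eta>0 (f b)" using c by simp
  qed (rule O'(1))
qed

text \<open>Otherwise the surface would be mapped into a curve.\<close>

lemma not_on_axis:
  assumes W: "wedge \<xi>0 \<eta>0 \<noteq> 0"
  shows "\<exists>m\<in>M. axis_form \<xi>0 \<eta>0 (f m) \<noteq> (cmod (wedge \<xi>0 \<eta>0))\<^sup>2"
proof (rule ccontr)
  assume c: "\<not> ?thesis"
  obtain m where "m \<in> M" using M_nonempty by blast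
  then obtain V \<phi> p where VP: "(V, \<phi>) \<in> local_params M f" and p: "p \<in> V"
    using surf unfolding oriented_immersed_surface_def by blast
  note PP = local_param_props[OF VP]
  define r where "r q = horo \<eta>0 ((f \<circ> \<phi>) q) / cmod (wedge \<xi>0 \<eta>0)" for q
  have on: "r q > 0 \<and> (f \<circ> \<phi>) q = geo_point \<xi>0 \<eta>0 (r q)" if q: "q \<in> V" for q
  proof -
    obtain R where R: "R > 0" "f (\<phi> q) = geo_point \<xi>0 \<eta>0 R"
      using on_axis[OF W f_H3[OF PP(6)[OF q]]] c PP(6)[OF q] by blast
    have "cmod (wedge \<eta>0 \<xi>0) = cmod (wedge \<xi>0 \<eta>0)"
    proof -
      have "wedge \<eta>0 \<xi>0 = - wedge \<xi>0 \<eta>0" by (simp add: wedge_def)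
      then show ?thesis by simp
    qed
    moreover have "wedge \<eta>0 \<eta>0 = 0" by (simp add: wedge_def)
    ultimately have "r q = R" using W by (simp add: r_def R(2) horo_geo_point[OF W R(1)] power2_eq_square)
    then show ?thesis using R by simp
  qed
  have "(horo \<eta>0) differentiable (at ((f \<circ> \<phi>) p))" using horo_differentiable f_H3[OF PP(6)[OF p]] by simp
  then obtain D where "(horo \<eta>0 has_derivative D) (at ((f \<circ> \<phi>) p))" unfolding differentiable_def by blast
  from has_derivative_compose[OF PP(7)[OF p] this]
  have "(\<lambda>q. horo \<eta>0 ((f \<circ> \<phi>) q)) differentiable (at p)" unfolding differentiable_def by blast
  then have "r differentiable (at p)" unfolding r_def[abs_def] using W by simp
  then obtain r' where r': "(r has_derivative r') (at p)" unfolding differentiable_def by blast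
  have w0: "wedge 0 s = 0" "wedge s 0 = 0" for s by (simp_all add: wedge_def)
  have g0: "geo_normal \<xi>0 \<eta>0 R 0 = 0" for R by (simp add: geo_normal_def zero_prod_def)
  have "((\<lambda>q. geo_point \<xi>0 \<eta>0 (r q)) has_derivative (\<lambda>w. (r' w / r p) *\<^sub>R geo_velocity \<xi>0 \<eta>0 (r p))) (at p)"
    using geo_point_has_derivative[OF has_derivative_const has_derivative_const r' W] on[OF p] by (simp add: w0 g0)
  then have "((f \<circ> \<phi>) has_derivative (\<lambda>w. (r' w / r p) *\<^sub>R geo_velocity \<xi>0 \<eta>0 (r p))) (at p)"
    by (rule has_derivative_transform_within_open[OF _ PP(1) p]) (use on in simp)
  then have d: "frechet_derivative (f \<circ> \<phi>) (at p) = (\<lambda>w. (r' w / r p) *\<^sub>R geo_velocity \<xi>0 \<eta>0 (r p))"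
    using frechet_derivative_at by metis
  interpret r': linear r' using r' by (rule has_derivative_linear)
  define u :: R2 where "u = (- r' (0,1)) *\<^sub>R (1,0) + r' (1,0) *\<^sub>R (0,1::real)"
  have "r' u = 0" by (simp only: u_def r'.add r'.scale) simp
  then have "u = 0" using PP(9)[OF p, of u] by (simp add: d)
  then have "r' (1,0) = 0" by (simp add: u_def zero_prod_def)
  then have "(1,0) = (0::R2)" using PP(9)[OF p, of "(1,0)"] by (simp add: d)
  then show False by (simp add: zero_prod_def)
qed

text \<open>Moving the surface by multiples of a fixed vector \<open>e\<close>, the normal at the given point, fills a neighbourhood of this point.
  The distance from the axis is strictly monotone in direction \<open>e\<close> near the point, so the level set consists of
  points that are not moved.\<close>

lemma level_set_open:
  assumes mp: "\<And>m. m \<in> M \<Longrightarrow> meets_perp (axis_quadric \<xi>0 \<eta>0) (\<sigma> m)"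
    and K: "\<And>m. m \<in> M \<Longrightarrow> axis_form \<xi>0 \<eta>0 (f m) = K" "K \<noteq> (cmod (wedge \<xi>0 \<eta>0))\<^sup>2"
  shows "openin (top_of_set {x \<in> H3. axis_form \<xi>0 \<eta>0 x = K}) (f ` M)"
proof (rule openin_subtopologyI)
  show "f ` M \<subseteq> {x \<in> H3. axis_form \<xi>0 \<eta>0 x = K}" using f_H3 K(1) by blast
  fix x0 assume "x0 \<in> f ` M"
  then obtain m where m: "m \<in> M" "x0 = f m" by blast
  obtain V \<phi> c F p where np: "normal_patch V \<phi> c F" and p: "p \<in> V" "\<phi> p = m"
    using normal_patch_ex[OF m(1)] by blast
  then have VP: "(V, \<phi>) \<in> local_params M f" by (auto simp: normal_patch_def)
  note PP = local_param_props[OF VP]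
  define h where "h = axis_form \<xi>0 \<eta>0"
  define dh where "dh x = frechet_derivative h (at x)" for x
  have hd: "(h has_derivative dh x) (at x)" if "x \<in> H3" for x
    using C_k_on_Suc_has_derivative[OF C_k_on_axis_form open_H3 that] by (simp add: h_def dh_def)
  define e where "e = N m"
  have cont: "continuous_on H3 (\<lambda>x. dh x e)"
    using C_k_on_axis_form[of "Suc 0" \<xi>0 \<eta>0] unfolding C_k_on.simps h_def dh_def by blast
  have x0: "x0 \<in> H3" using f_H3 m by simp
  have e: "e \<noteq> 0" using norm_N[OF m(1)] x0 m(2) by (auto simp: e_def H3_def)
  have "dh x0 e \<noteq> 0"
    using axis_form_deriv_zero(2)[OF np p(1), of \<xi>0 \<eta>0 "dh x0"] hd[OF x0] mp[OF m(1)] K m p(2)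
    by (auto simp: h_def e_def)
  moreover have "open (H3 \<inter> (\<lambda>x. dh x e) -` (- {0}))"
    by (rule continuous_open_preimage[OF cont open_H3 open_Compl[OF closed_singleton]])
  ultimately obtain d where d: "d > 0" "ball x0 d \<subseteq> H3 \<inter> (\<lambda>x. dh x e) -` (- {0})"
    using openE[of "H3 \<inter> (\<lambda>x. dh x e) -` (- {0})" x0] x0 by blast
  define g where "g = f \<circ> \<phi>"
  define g' where "g' = frechet_derivative (f \<circ> \<phi>) (at p)"
  define \<Phi> where "\<Phi> z = g (fst z) + snd z *\<^sub>R e" for z :: "R2 \<times> real"
  define S where "S = V \<times> (UNIV :: real set)"
  have S: "open S" unfolding S_def by (intro open_Times PP(1) open_UNIV)
  have gc: "continuous_on V g" using C_k_on_le[OF PP(1,4), of 0] by (simp add: g_def)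
  have gf: "continuous_on S (\<lambda>z. g (fst z))"
    unfolding S_def by (rule continuous_on_compose2[OF gc continuous_on_fst[OF continuous_on_id]]) auto
  then have \<Phi>c: "continuous_on S \<Phi>" unfolding \<Phi>_def by (intro continuous_intros)
  define T where "T = (S \<inter> (\<lambda>z. g (fst z)) -` ball x0 d) \<inter> (S \<inter> \<Phi> -` ball x0 d)"
  have T: "open T" unfolding T_def
    by (intro open_Int continuous_open_preimage gf \<Phi>c S open_ball)
  have pT: "(p, 0) \<in> T" using p m d(1) by (simp add: T_def S_def \<Phi>_def g_def)
  have gd: "((\<lambda>z. g (fst z)) has_derivative (\<lambda>z. g' (fst z))) (at (p, 0::real))"
  proof -
    have "((\<lambda>z. fst z) has_derivative (\<lambda>z. fst z)) (at (p, 0::real))" by (intro derivative_intros)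
    from has_derivative_compose[OF this, of g g'] PP(7)[OF p(1)] show ?thesis by (simp add: g_def g'_def)
  qed
  have \<Phi>d: "(\<Phi> has_derivative (\<lambda>z. g' (fst z) + snd z *\<^sub>R e)) (at (p, 0))"
    unfolding \<Phi>_def
    by (intro has_derivative_add gd) (auto intro!: derivative_eq_intros)
  define L where "L z = g' (fst z) + snd z *\<^sub>R e" for z :: "R2 \<times> real"
  have linL: "linear L" using \<Phi>d has_derivative_linear unfolding L_def[abs_def] by blast
  have "inj L"
    unfolding linear_injective_0[OF linL]
  proof (intro allI impI)
    fix z assume z: "L z = 0"
    have "e \<bullet> g' (fst z) = 0" using PP(8)[OF p(1)] p(2) by (simp add: e_def g'_def)
    then have "snd z * (e \<bullet> e) = e \<bullet> L z" by (simp add: L_def inner_add_right)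
    then have "snd z = 0" using z e by simp
    moreover from this have "g' (fst z) = 0" using z by (simp add: L_def)
    then have "fst z = 0" using PP(9)[OF p(1)] by (simp add: g'_def)
    ultimately show "z = 0" by (simp add: prod_eq_iff)
  qed
  then obtain L' where L': "linear L'" "L \<circ> L' = id"
    using linear_surjective_right_inverse[OF linL linear_inj_imp_surj_3[OF linL]] by blast
  have "\<Phi> (p, 0) \<in> interior (\<Phi> ` T)"
  proof (rule sussmann_open_mapping[OF S \<Phi>c _ \<Phi>d[folded L_def[abs_def]] _ L'(2)])
    show "(p, 0) \<in> S" "T \<subseteq> S" using p by (auto simp: S_def T_def)
    show "bounded_linear L'" using L'(1) linear_conv_bounded_linear by blast
    show "(p, 0) \<in> interior T" using T pT by (simp add: interior_open)
  qed
  moreover have "\<Phi> (p, 0) = x0" using p(2) m by (simp add: \<Phi>_def g_def)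
  moreover have "{x \<in> H3. axis_form \<xi>0 \<eta>0 x = K} \<inter> interior (\<Phi> ` T) \<subseteq> f ` M"
  proof
    fix x assume x: "x \<in> {x \<in> H3. axis_form \<xi>0 \<eta>0 x = K} \<inter> interior (\<Phi> ` T)"
    then obtain q s where qs: "(q, s) \<in> T" "x = \<Phi> (q, s)" using interior_subset by fastforce
    have q: "q \<in> V" "g q \<in> ball x0 d" "x \<in> ball x0 d" using qs by (auto simp: T_def S_def)
    have xs: "x = g q + s *\<^sub>R e" using qs by (simp add: \<Phi>_def)
    have hx: "h x = K" "h (g q) = K" using x K(1)[OF PP(6)[OF q(1)]] by (simp_all add: h_def g_def)
    have "s = 0"
    proof (rule ccontr)
      assume s: "s \<noteq> 0"
      define y where "y \<tau> = g q + \<tau> *\<^sub>R (s *\<^sub>R e)" for \<tau> :: real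
      have yb: "y \<tau> \<in> ball x0 d" if "0 \<le> \<tau>" "\<tau> \<le> 1" for \<tau>
      proof -
        have "y \<tau> = (1 - \<tau>) *\<^sub>R g q + \<tau> *\<^sub>R x" by (simp add: y_def xs algebra_simps)
        then show ?thesis using convexD_alt[OF convex_ball q(2,3), of \<tau>] that by simp
      qed
      have yd: "((\<lambda>\<tau>. h (y \<tau>)) has_derivative (\<lambda>u. dh (y \<tau>) (u *\<^sub>R (s *\<^sub>R e)))) (at \<tau> within {0..1})"
        if "0 \<le> \<tau>" "\<tau> \<le> 1" for \<tau>
      proof -
        have "(y has_derivative (\<lambda>u. u *\<^sub>R (s *\<^sub>R e))) (at \<tau> within {0..1})"
          unfolding y_def[abs_def] by (auto intro!: derivative_eq_intros)
        moreover have "(h has_derivative dh (y \<tau>)) (at (y \<tau>))" using hd yb[OF that] d(2) by blast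
        ultimately show ?thesis by (rule has_derivative_compose)
      qed
      obtain \<tau> where \<tau>: "\<tau> \<in> {0<..<1}" "h (y 1) - h (y 0) = dh (y \<tau>) ((1 - 0) *\<^sub>R (s *\<^sub>R e))"
        using mvt_simple[of 0 1 "\<lambda>\<tau>. h (y \<tau>)" "\<lambda>\<tau> u. dh (y \<tau>) (u *\<^sub>R (s *\<^sub>R e))", OF _ yd] by auto
      have yt: "y \<tau> \<in> ball x0 d" using yb \<tau>(1) by simp
      then have "linear (dh (y \<tau>))" using hd d(2) has_derivative_linear by blast
      then have "dh (y \<tau>) (s *\<^sub>R e) = s * dh (y \<tau>) e" by (simp add: linear_cmul)
      moreover have "y 1 = x" "y 0 = g q" by (simp_all add: y_def xs)
      ultimately have "s * dh (y \<tau>) e = 0" using \<tau>(2) hx by simp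
      moreover have "dh (y \<tau>) e \<noteq> 0" using yt d(2) by blast
      ultimately show False using s by simp
    qed
    then show "x \<in> f ` M" using xs PP(6)[OF q(1)] by (simp add: g_def)
  qed
  ultimately show "\<exists>T. open T \<and> x0 \<in> T \<and> {x \<in> H3. axis_form \<xi>0 \<eta>0 x = K} \<inter> T \<subseteq> f ` M"
    using open_interior by metis
qed

lemma meets_perp_imp_tube:
  assumes disc: "discr P \<noteq> 0" and mpP: "\<And>m. m \<in> M \<Longrightarrow> meets_perp P (\<sigma> m)"
  shows "\<exists>l\<in>LH3. \<exists>\<rho>>0. openin (top_of_set (equidistant_tube l \<rho>)) (f ` M)"
proof -
  obtain \<mu> s where \<mu>: "\<mu> \<in> coord_domain" "s \<noteq> 0"
    "\<And>\<xi> \<eta>. perp_form (end_spinor True \<mu>) (begin_spinor True \<mu>) \<xi> \<eta> = s * polar P \<xi> \<eta>"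
    using axis_of_quadric[OF disc] by blast
  define \<xi>0 \<eta>0 where "\<xi>0 = end_spinor True \<mu>" and "\<eta>0 = begin_spinor True \<mu>"
  define l where "l = chart_of True \<mu>"
  have W: "wedge \<xi>0 \<eta>0 \<noteq> 0" using wedge_spinor_nonzero[OF \<mu>(1)] by (simp add: \<xi>0_def \<eta>0_def)
  have mp: "meets_perp (axis_quadric \<xi>0 \<eta>0) (\<sigma> m)" if m: "m \<in> M" for m
  proof -
    obtain b \<nu> where \<nu>: "\<nu> \<in> coord_domain" "\<sigma> m = chart_of b \<nu>" "polar P (end_spinor b \<nu>) (begin_spinor b \<nu>) = 0"
      using mpP[OF m] unfolding meets_perp_def by blast
    then have "polar (axis_quadric \<xi>0 \<eta>0) (end_spinor b \<nu>) (begin_spinor b \<nu>) = 0"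
      unfolding polar_axis_quadric \<xi>0_def \<eta>0_def \<mu>(3) by simp
    then show ?thesis using \<nu>(1,2) unfolding meets_perp_def by blast
  qed
  obtain m0 where m0: "m0 \<in> M" using M_nonempty by blast
  define K where "K = axis_form \<xi>0 \<eta>0 (f m0)"
  have K: "axis_form \<xi>0 \<eta>0 (f m) = K" if "m \<in> M" for m
    unfolding K_def by (rule axis_form_const[OF mp that m0])
  have K1: "K \<noteq> (cmod (wedge \<xi>0 \<eta>0))\<^sup>2" using not_on_axis[OF W] K by auto
  have l: "fst ` l = {geo_point \<xi>0 \<eta>0 R |R. R > 0}"
    unfolding l_def chart_of_eq[OF \<mu>(1)] \<xi>0_def \<eta>0_def by force
  define \<rho> where "\<rho> = (INF y \<in> {geo_point \<xi>0 \<eta>0 R |R. R > 0}. hyp_dist (f m0) y)"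
  have \<rho>: "\<rho> \<ge> 0" "cosh \<rho> = sqrt K / cmod (wedge \<xi>0 \<eta>0)"
    using INF_hyp_dist_axis[OF W f_H3[OF m0]] by (simp_all add: \<rho>_def K_def)
  have "K \<ge> 0"
  proof -
    have "\<xi>0 \<noteq> 0" "\<eta>0 \<noteq> 0" using W by (auto simp: wedge_def zero_prod_def)
    then show ?thesis using horo_pos[OF f_H3[OF m0]] by (simp add: K_def axis_form_def less_imp_le)
  qed
  then have K2: "K = (cosh \<rho> * cmod (wedge \<xi>0 \<eta>0))\<^sup>2" using W unfolding \<rho>(2) by simp
  then have "\<rho> \<noteq> 0" using K1 by auto
  then have "\<rho> > 0" using \<rho>(1) by simp
  moreover have "equidistant_tube l \<rho> = {x \<in> H3. axis_form \<xi>0 \<eta>0 x = K}"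
    unfolding K2 by (rule equidistant_tube_axis_form[OF W l \<open>\<rho> > 0\<close>])
  moreover have "openin (top_of_set {x \<in> H3. axis_form \<xi>0 \<eta>0 x = K}) (f ` M)"
    by (rule level_set_open[OF mp K K1])
  moreover have "l \<in> LH3" unfolding LH3_eq l_def using \<mu>(1) by blast
  ultimately show ?thesis by metis
qed

text \<open>The first coordinate is a local diffeomorphism from the surface to the plane, and on the graph it determines the second
  coordinate. Points with coordinates in both charts may have been parametrised in the second one.\<close>

lemma coord_image_open:
  assumes mx: "maximal_surface M (local_params M f) \<sigma>" and disc: "discr P \<noteq> 0"
    and mpP: "\<And>m. m \<in> M \<Longrightarrow> meets_perp P (\<sigma> m)"
  shows "openin (top_of_set {\<mu> \<in> coord_domain. graph_eq True P (fst \<mu>) (cnj (snd \<mu>)) = 0}) (coord_image (\<sigma> ` M))"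
proof (rule openin_subtopologyI)
  have ch: "chart = chart_of True" by (simp add: chart_of_def)
  show "coord_image (\<sigma> ` M) \<subseteq> {\<mu> \<in> coord_domain. graph_eq True P (fst \<mu>) (cnj (snd \<mu>)) = 0}"
  proof
    fix \<mu> assume "\<mu> \<in> coord_image (\<sigma> ` M)"
    then obtain m where m: "\<mu> \<in> coord_domain" "m \<in> M" "chart_of True \<mu> = \<sigma> m" by (auto simp: coord_image_def ch)
    then show "\<mu> \<in> {\<mu> \<in> coord_domain. graph_eq True P (fst \<mu>) (cnj (snd \<mu>)) = 0}"
      using meets_perp_chart[OF m(1), of P True] mpP[OF m(2)] by simp
  qed
  fix \<mu>0 assume "\<mu>0 \<in> coord_image (\<sigma> ` M)"
  then obtain m where \<mu>0: "\<mu>0 \<in> coord_domain" and m: "m \<in> M" "chart_of True \<mu>0 = \<sigma> m" by (auto simp: coord_image_def ch)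
  obtain V \<phi> c F p where mp: "maximal_patch V \<phi> c F" and p: "p \<in> V" "\<phi> p = m"
    using maximal_patch_ex[OF mx m(1)] by blast
  have np: "normal_patch V \<phi> c F" using mp by (simp add: maximal_patch_def)
  interpret cp: congruence_patch V F c "f \<circ> \<phi>" "N \<circ> \<phi>" "\<lambda>p. frechet_derivative (f \<circ> \<phi>) (at p)"
    using np by (simp add: normal_patch_def)
  interpret mc: maximal_congruence V F cp.R cp.R'
    using mp by (intro cp.maximal_congruenceI) (auto simp: maximal_patch_def)
  have VP: "(V, \<phi>) \<in> local_params M f" and chF: "\<And>q. q \<in> V \<Longrightarrow> chart_of c (F q) = \<sigma> (\<phi> q)"
    using np by (auto simp: normal_patch_def)
  note PP = local_param_props[OF VP]
  define G where "G q = (if c then F q else (1 / fst (F q), 1 / snd (F q)))" for q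
  define T where "T = {q \<in> V. c \<or> (cp.A q \<noteq> 0 \<and> cp.B q \<noteq> 0)}"
  have Ac: "continuous_on V cp.A" and Bc: "continuous_on V cp.B"
    using cp.A_deriv cp.B_deriv by (meson has_derivative_continuous continuous_at_imp_continuous_on)+
  have T: "open T"
  proof (cases c)
    case False
    then have "T = (V \<inter> cp.A -` (- {0})) \<inter> (V \<inter> cp.B -` (- {0}))" by (auto simp: T_def)
    then show ?thesis
      using continuous_open_preimage[OF Ac PP(1) open_Compl[OF closed_singleton]]
        continuous_open_preimage[OF Bc PP(1) open_Compl[OF closed_singleton]] by (simp add: open_Int)
  qed (use PP(1) in \<open>simp add: T_def\<close>)
  have nzF: "fst (F q) \<noteq> 0" "snd (F q) \<noteq> 0" if "q \<in> T" "\<not> c" for q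
    using that by (auto simp: T_def cp.A_def cp.B_def)
  have G: "G q \<in> coord_domain" "chart_of True (G q) = \<sigma> (\<phi> q)" if q: "q \<in> T" for q
  proof -
    have qV: "q \<in> V" using q by (simp add: T_def)
    have "G q \<in> coord_domain \<and> chart_of True (G q) = \<sigma> (\<phi> q)"
    proof (cases c)
      case True
      then show ?thesis using cp.dom[OF qV] chF[OF qV] by (simp add: G_def)
    next
      case False
      note nz = nzF[OF q False]
      show ?thesis
        using chart_of_flip(1)[OF cp.dom[OF qV] nz] chart_of_flip(2)[OF cp.dom[OF qV] nz, of False] chF[OF qV] False
        by (simp add: G_def)
    qed
    then show "G q \<in> coord_domain" "chart_of True (G q) = \<sigma> (\<phi> q)" by simp_all
  qed
  have eq: "chart_of c (F p) = chart_of True \<mu>0" using chF[OF p(1)] p(2) m(2) by simp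
  note un = chart_of_eq_iff[OF cp.dom[OF p(1)] \<mu>0 eq]
  have pT: "p \<in> T" using p(1) un by (auto simp: T_def cp.A_def cp.B_def)
  have Gp: "G p = \<mu>0" using un by (auto simp: G_def)
  define L where "L = (if c then cp.dA p else (\<lambda>w. - (inverse (cp.A p) * cp.dA p w * inverse (cp.A p))))"
  have Ld: "((\<lambda>q. fst (G q)) has_derivative L) (at p)"
  proof (cases c)
    case True
    then show ?thesis using cp.A_deriv[OF p(1)] by (simp add: G_def L_def cp.A_def[abs_def])
  next
    case False
    have "cp.A p \<noteq> 0" using pT False by (simp add: T_def)
    from Deriv.has_derivative_inverse[OF this cp.A_deriv[OF p(1)]] False
    show ?thesis by (simp add: G_def L_def cp.A_def inverse_eq_divide)
  qed
  have linL: "linear L" using Ld has_derivative_linear by blast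
  have "w = 0" if "L w = 0" for w
    using that mc.dA_inj[OF p(1), of w] pT by (auto simp: L_def T_def split: if_splits)
  then have "surj L" using linear_R2_independent(2)[OF linL] by blast
  then obtain L' where L': "linear L'" "L \<circ> L' = id" using linear_surjective_right_inverse[OF linL] by blast
  have Gc: "continuous_on T (\<lambda>q. fst (G q))"
  proof (cases c)
    case True
    then show ?thesis using continuous_on_subset[OF Ac] by (simp add: G_def T_def cp.A_def[abs_def])
  next
    case False
    have "continuous_on T (\<lambda>q. 1 / cp.A q)"
      by (intro continuous_intros continuous_on_subset[OF Ac]) (auto simp: T_def False)
    then show ?thesis using False by (simp add: G_def cp.A_def)
  qed
  have "fst (G p) \<in> interior ((\<lambda>q. fst (G q)) ` T)"
  proof (rule sussmann_open_mapping[OF T Gc pT Ld _ L'(2)])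
    show "bounded_linear L'" using L'(1) linear_conv_bounded_linear by blast
    show "p \<in> interior T" using T pT by (simp add: interior_open)
  qed auto
  then have i0: "\<mu>0 \<in> fst -` interior ((\<lambda>q. fst (G q)) ` T)" by (simp add: Gp)
  have "{\<mu> \<in> coord_domain. graph_eq True P (fst \<mu>) (cnj (snd \<mu>)) = 0} \<inter> fst -` interior ((\<lambda>q. fst (G q)) ` T) \<subseteq> coord_image (\<sigma> ` M)"
  proof
    fix \<mu> assume \<mu>: "\<mu> \<in> {\<mu> \<in> coord_domain. graph_eq True P (fst \<mu>) (cnj (snd \<mu>)) = 0} \<inter> fst -` interior ((\<lambda>q. fst (G q)) ` T)"
    then have "fst \<mu> \<in> (\<lambda>q. fst (G q)) ` T" using interior_subset by blast
    then obtain q where q: "q \<in> T" "fst \<mu> = fst (G q)" by blast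
    have qM: "\<phi> q \<in> M" using q(1) PP(6) by (simp add: T_def)
    have 1: "graph_eq True P (fst \<mu>) (cnj (snd \<mu>)) = 0" using \<mu> by simp
    have 2: "graph_eq True P (fst \<mu>) (cnj (snd (G q))) = 0"
      unfolding q(2)
      using meets_perp_chart[OF G(1)[OF q(1)], of P True] G(2)[OF q(1)] mpP[OF qM] by simp
    have "cnj (snd \<mu>) = cnj (snd (G q))" by (rule graph_eq_unique[OF disc 1 2])
    then have "\<mu> = G q" using q(2) by (simp add: prod_eq_iff)
    then show "\<mu> \<in> coord_image (\<sigma> ` M)" using G[OF q(1)] qM by (simp add: coord_image_def ch)
  qed
  then show "\<exists>T. open T \<and> \<mu>0 \<in> T \<and> {\<mu> \<in> coord_domain. graph_eq True P (fst \<mu>) (cnj (snd \<mu>)) = 0} \<inter> T \<subseteq> coord_image (\<sigma> ` M)"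
    using i0 open_vimage_fst[OF open_interior] by blast
qed

end

text \<open>The quadratic forms with \<open>p \<noteq> 0\<close> give the family, those with \<open>p = 0\<close> its limits.\<close>

lemma graph_family_eq:
  assumes "p \<noteq> 0" "discr (p, m, n) \<noteq> 0"
  shows "{\<mu> \<in> coord_domain. graph_eq True (p, m, n) (fst \<mu>) (cnj (snd \<mu>)) = 0} = graph_family (- n / p) (m / p)"
    and "(- n / p) * (m / p) \<noteq> 1"
proof -
  have d: "p\<^sup>2 + m * n \<noteq> 0" using assms(2) by (simp add: discr_def)
  show "(- n / p) * (m / p) \<noteq> 1"
  proof
    assume "(- n / p) * (m / p) = 1"
    then have h: "- (m * n) = p\<^sup>2" using assms(1) by (simp add: field_simps power2_eq_square)
    show False using d unfolding h[symmetric] by simp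
  qed
  have "graph_eq True (p, m, n) a b = 0 \<longleftrightarrow> m / p + a \<noteq> 0 \<and> b = (1 + - n / p * a) / (m / p + a)" for a b
  proof -
    have g: "graph_eq True (p, m, n) a b = p * (b * (m / p + a) - (1 + - n / p * a))"
      using assms(1) by (simp add: graph_eq_def field_simps)
    show ?thesis
    proof (cases "m / p + a = 0")
      case True
      have a: "a = - m / p" using add_eq_0_iff[THEN iffD1, OF True] by simp
      have "p * (1 + - n / p * a) = (p\<^sup>2 + m * n) / p" using assms(1) by (simp add: a field_simps power2_eq_square)
      then have "1 + - n / p * a \<noteq> 0" using d assms(1) by auto
      then show ?thesis using assms(1) by (simp add: g True)
    next
      case False
      then show ?thesis using assms(1) unfolding g by (simp add: nonzero_eq_divide_eq)
    qed
  qed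
  then show "{\<mu> \<in> coord_domain. graph_eq True (p, m, n) (fst \<mu>) (cnj (snd \<mu>)) = 0} = graph_family (- n / p) (m / p)"
    unfolding graph_family_def by blast
qed

lemma graph_limit_eq:
  assumes "discr (0, m, n) \<noteq> 0"
  shows "{\<mu> \<in> coord_domain. graph_eq True (0, m, n) (fst \<mu>) (cnj (snd \<mu>)) = 0} = graph_limit (- n / m)"
    and "- n / m \<noteq> 0"
proof -
  have d: "m \<noteq> 0" "n \<noteq> 0" using assms by (auto simp: discr_def)
  then show "- n / m \<noteq> 0" by simp
  have "graph_eq True (0, m, n) a b = 0 \<longleftrightarrow> b = - n / m * a" for a b
    using d by (auto simp: graph_eq_def field_simps add_eq_0_iff2)
  then show "{\<mu> \<in> coord_domain. graph_eq True (0, m, n) (fst \<mu>) (cnj (snd \<mu>)) = 0} = graph_limit (- n / m)"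
    unfolding graph_limit_def by blast
qed

theorem mainTheorem1:
  fixes M :: "'m::{t2_space, second_countable_topology} set"
    and f N :: "'m \<Rightarrow> half_space"
    and \<sigma> :: "'m \<Rightarrow> oriented_geodesic"
  assumes "oriented_immersed_surface M f N"
    and "\<sigma> = normal_geodesic f N"
  shows
    "(maximal_surface M (local_params M f) \<sigma> \<longleftrightarrow>
        (\<exists>l\<in>LH3. \<exists>\<rho>>0. openin (top_of_set (equidistant_tube l \<rho>)) (f ` M)))
     \<and> (maximal_surface M (local_params M f) \<sigma> \<longrightarrow>
        (\<exists>l1 l2. l1 * l2 \<noteq> 1 \<and> openin (top_of_set (graph_family l1 l2)) (coord_image (\<sigma> ` M)))
        \<or> (\<exists>c. c \<noteq> 0 \<and> openin (top_of_set (graph_limit c)) (coord_image (\<sigma> ` M))))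
     \<and> (\<forall>l1 l2. l1 * l2 \<noteq> 1 \<and> \<sigma> ` M \<subseteq> chart ` graph_family l1 l2 \<longrightarrow>
        maximal_surface M (local_params M f) \<sigma>)"
proof -
  interpret immersed_surface M f N by unfold_locales (rule assms(1))
  note \<sigma> = assms(2)
  show ?thesis
  proof (intro conjI impI allI iffI)
    assume mx: "maximal_surface M (local_params M f) \<sigma>"
    then obtain P where P: "discr P \<noteq> 0" "\<And>m. m \<in> M \<Longrightarrow> meets_perp P (normal_geodesic f N m)"
      using maximal_imp_meets_perp unfolding \<sigma> by blast
    show "\<exists>l\<in>LH3. \<exists>\<rho>>0. openin (top_of_set (equidistant_tube l \<rho>)) (f ` M)"
      by (rule meets_perp_imp_tube[OF P])
    obtain p m n where Pe: "P = (p, m, n)" by (cases P)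
    have op: "openin (top_of_set {\<mu> \<in> coord_domain. graph_eq True P (fst \<mu>) (cnj (snd \<mu>)) = 0}) (coord_image (\<sigma> ` M))"
      using coord_image_open[OF _ P] mx unfolding \<sigma> by blast
    show "(\<exists>l1 l2. l1 * l2 \<noteq> 1 \<and> openin (top_of_set (graph_family l1 l2)) (coord_image (\<sigma> ` M)))
        \<or> (\<exists>c. c \<noteq> 0 \<and> openin (top_of_set (graph_limit c)) (coord_image (\<sigma> ` M)))"
    proof (cases "p = 0")
      case True
      have d: "discr (0, m, n) \<noteq> 0" using P(1) by (simp only: Pe True not_False_eq_True)
      from op have "openin (top_of_set (graph_limit (- n / m))) (coord_image (\<sigma> ` M))"
        unfolding Pe True graph_limit_eq(1)[OF d] .
      then show ?thesis using graph_limit_eq(2)[OF d] by blast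
    next
      case False
      have d: "discr (p, m, n) \<noteq> 0" using P(1) by (simp only: Pe not_False_eq_True)
      from op have "openin (top_of_set (graph_family (- n / p) (m / p))) (coord_image (\<sigma> ` M))"
        unfolding Pe graph_family_eq(1)[OF False d] .
      then show ?thesis using graph_family_eq(2)[OF False d] by blast
    qed
  next
    assume "\<exists>l\<in>LH3. \<exists>\<rho>>0. openin (top_of_set (equidistant_tube l \<rho>)) (f ` M)"
    then obtain l \<rho> where l: "l \<in> LH3" "\<rho> > 0" "f ` M \<subseteq> equidistant_tube l \<rho>"
      using openin_imp_subset by blast
    then obtain b \<mu> where b: "l = chart_of b \<mu>" "\<mu> \<in> coord_domain" unfolding LH3_eq by blast
    show "maximal_surface M (local_params M f) \<sigma>"
      unfolding \<sigma> using tube_imp_meets_perp[OF b l(2,3)] by (rule meets_perp_imp_maximal)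
  next
    fix l1 l2 assume a: "l1 * l2 \<noteq> 1 \<and> \<sigma> ` M \<subseteq> chart ` graph_family l1 l2"
    have disc: "discr (1, l2, - l1) \<noteq> 0" using a by (simp add: discr_def mult.commute)
    have "meets_perp (1, l2, - l1) (\<sigma> m)" if "m \<in> M" for m
    proof -
      obtain \<mu> where \<mu>: "\<mu> \<in> graph_family l1 l2" "\<sigma> m = chart_of True \<mu>"
        using a \<open>m \<in> M\<close> by (auto simp: chart_of_def)
      have "graph_eq True (1, l2, - l1) (fst \<mu>) (cnj (snd \<mu>)) = 0"
        using graph_family_eq(1)[of 1 l2 "- l1"] disc \<mu>(1) by auto
      then show ?thesis using meets_perp_chart[of \<mu> _ True] \<mu> by (simp add: graph_family_def)
    qed
    then show "maximal_surface M (local_params M f) \<sigma>"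
      using meets_perp_imp_maximal[OF disc] unfolding \<sigma> by blast
  qed
qed

end
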